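(* Fix $\alpha\in(0,2]$ and $\zeta>0$. There is a constant $\lambda_{\mathrm{sel}}$ depending only on $\alpha$ and $\zeta$ for which the following holds. In the multi-class setting of the context, with $\eta_n\to\infty$, suppose there exists a unique true pair $(m^*,S^* )\in\widetilde{\mathcal M}_n$, and for every $\lambda\ge\lambda_{\mathrm{sel}}$ assume the following conditions hold: (i) For every $(m,S)\in\widetilde{\mathcal M}_{\mathrm{sup}}$ (so that $m=m^*$), $C_{(m^*,S)}\ge C_{(m^*,S^* )}$. In addition, there exist constants $0<\tilde c_1<c_1$ such that for all $j\ge1$, $$\sum_{(m,S)\in\widetilde{\mathcal M}_{\mathrm{sup}},\ \widetilde\Delta^+(S)=j}\exp\{-c_1\lambda^{\alpha/2}(C_{(m,S)}-C_{(m^*,S^* )})\}\le\exp\{\tilde c_1(\eta_nj)^{\alpha/2}\}.$$ (ii) There exists a sufficiently large constant $c_2>1$ such that, for every $(m,S)\in\widetilde{\mathcal M}_{\mathrm{sub}}$, $$\mathrm{APP}(m,S)\ge c_2\Bigl(\eta_n(s^*-s_{(m,S)})+\lambda\bigl(C_{(m^*,S^* )}^{2/\alpha}-C_{(m,S)}^{2/\alpha}\bigr)_++\{\log\widetilde N(\widetilde\Delta^-(S))\}^{2/\alpha}\Bigr).$$ (iii) For every $(m,S)\in\widetilde{\mathcal M}_{\mathrm w}$ satisfying $2B_{(m,S)}>u_{(m,S)}$, $\mathrm{APP}(m,S)\ge2(2B_{(m,S)}-u_{(m,S)})$. Then $\Pr\{(\widehat m,\widehat S)=(m^*,S^* )\}\to1$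 as $n\to\infty$.
   Context: Noise and response: $y=\mu_n+\varepsilon\in\mathbb R^n$, with $\varepsilon_i$ independent, mean zero, $\mathbb E(\varepsilon_i^2)=\sigma^2$, $\Pr(|\varepsilon_i/\sigma|>t)\le2\exp\{-(t/\zeta)^\alpha\}$ for all $t\ge2$. Classes: there are $M$ candidate classes $\mathcal M_n^{(1)},\dots,\mathcal M_n^{(M)}$. Class $m$ has its own fixed design; its candidate models $S\in\mathcal M_n^{(m)}$ are sets of columns (variables) of that design, each being a union of atoms from a partition $\mathcal U^{(m)}$ of the class-$m$ variables into nonempty atoms, and $\mathcal U^{(m)}(S)$ is the set of atoms contained in $S$. Within-class complexities $C_S^{(m)}$ satisfy $\sum_{S\in\mathcal M_n^{(m)}}\exp\{-C_S^{(m)}\}\le1$ for each $m$. The aggregated list is $\widetilde{\mathcal M}_n=\bigcup_{m=1}^M\{(m,S):S\in\mathcal M_n^{(m)}\}$, with $C_{(m,S)}=C_S^{(m)}+\log M$. For a pair: $s_{(m,S)}$ is its number of selected variables; $X_S^{(m)}$ its design submatrix; $V_S^{(m)}=\mathrm{Col}(X_S^{(m)})$; $P_S^{(m)}$ the orthogonal projection onto $V_S^{(m)}$; $r_{(m,S)}=\mathrm{rank}(P_S^{(m)})$; $\mathrm{RSS}(m,S)=\|(\mathrm I_n-P_S^{(m)})y\|_2^2$; $\mathrm{APP}(m,S)=\|(\mathrm I_n-P_S^{(m)})\mu_n\|_2^2/\sigma^2$; $$\mathrm{DCIC}(m,S)=\mathrm{RSS}(m,S)/\sigma^2+\eta_ns_{(m,S)}+\lambda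 C_{(m,S)}^{2/\alpha},\qquad(\widehat m,\widehat S)\in\arg\min_{(m,S)\in\widetilde{\mathcal M}_n}\mathrm{DCIC}(m,S).$$ True pair: $m^*$ is the true class and $S^*$ the true model within it, so $\mu_n\in V_{S^*}^{(m^* )}$; $s^*=s_{(m^*,S^* )}$. Classification: $\widetilde{\mathcal M}_{\mathrm{sup}}=\{(m^*,S)\in\widetilde{\mathcal M}_n:S^*\subsetneq S\}$; $\widetilde{\mathcal M}_{\mathrm{sub}}=\{(m^*,S)\in\widetilde{\mathcal M}_n:S\subsetneq S^*\}$; $\widetilde{\mathcal M}_{\mathrm w}$ is the set of all remaining pairs other than $(m^*,S^* )$, split into $\widetilde{\mathcal M}_{\mathrm w}^{\mathrm{in}}$ (those with $m=m^*$) and $\widetilde{\mathcal M}_{\mathrm w}^{\mathrm{out}}$ (those with $m\ne m^*$). For pairs with $m=m^*$: $\widetilde\Delta^+(S)=|\mathcal U^{(m^* )}(S)\setminus\mathcal U^{(m^* )}(S^* )|$, $\widetilde\Delta^-(S)=|\mathcal U^{(m^* )}(S^* )\setminus\mathcal U^{(m^* )}(S)|$. For $\ell\ge1$, $\widetilde N(\ell)=|\{(m,S)\in\widetilde{\mathcal M}_{\mathrm{sub}}:\widetilde\Delta^-(S)=\ell\}|$. $\widetilde r_{(m,S)}=\dim(V_S^{(m)}\cap V_{S^*}^{(m^* )})$; $u_{(m,S)}=\eta_n(s_{(m,S)}-s^* )+\lambda(C_{(m,S)}^{2/\alpha}-C_{(m^*,S^* )}^{2/\alpha})$; $B_{(m,S)}=\frac14\lambda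 D_{(m,S)}^{2/\alpha}+\frac14\log\log n+2(r_{(m,S)}-\widetilde r_{(m,S)})$, where, with $q^*=|\mathcal U^{(m^* )}(S^* )|$ and $q=|\mathcal U^{(m^* )}|$, $D_{(m,S)}=\log\{\binom{q^*}{\widetilde\Delta^-(S)}\binom{q-q^*}{\widetilde\Delta^+(S)}\}\wedge C_{(m,S)}$ for $(m,S)\in\widetilde{\mathcal M}_{\mathrm w}^{\mathrm{in}}$, and $D_{(m,S)}=C_{(m,S)}$ for $(m,S)\in\widetilde{\mathcal M}_{\mathrm w}^{\mathrm{out}}$. $(x)_+=\max(x,0)$, $a\wedge b=\min(a,b)$.
   Formalization: In (i), c_1 must not exceed a threshold depending only on α and ζ (for arbitrary constants c̃_1<c_1 the claim fails, e.g. Gaussian noise, orthonormal design, η_n=log n); constants are stated per type of sample space, which passing to the joint law of noise and selected pair removes. *)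

theory Defs
  imports
    "HOL-Probability.Probability"
    "HOL-Library.Disjoint_Sets"
    "Jordan_Normal_Form.DL_Rank"
    "Jordan_Normal_Form.DL_Submatrix"
begin

text \<open>
  The sample size \<open>n\<close> varies, so vectors in \<open>\<real>\<^sup>n\<close> and matrices are those of
  \<open>Jordan_Normal_Form\<close>, whose dimensions are terms.
\<close>

definition sqnorm :: "real Matrix.vec \<Rightarrow> real" where
  "sqnorm v = scalar_prod v v"

definition subspace_dim :: "nat \<Rightarrow> real Matrix.vec set \<Rightarrow> nat" where
  "subspace_dim n W = vectorspace.dim class_ring (module_vec TYPE(real) n\<lparr>carrier := W\<rparr>)"

definition orth_proj :: "nat \<Rightarrow> real Matrix.vec set \<Rightarrow> real mat" where
  "orth_proj n V = (THE P. P \<in> carrier_mat n n \<and>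
     (\<forall>v \<in> carrier_vec n. P *\<^sub>v v \<in> V \<and> (\<forall>w \<in> V. scalar_prod (v - P *\<^sub>v v) w = 0)))"

text \<open>
  The deterministic data of the problem at one sample size. Classes are numbered
  \<open>1, \<dots>, nclass\<close>; the variables of class \<open>m\<close> are the column indices of \<open>design m\<close>.
  The true pair \<open>(m\<^sup>*, S\<^sup>*)\<close> is part of the data: larger models may
  well contain the signal too, so it is not determined by the signal alone.
\<close>

record selection_problem =
  nobs :: nat
  nclass :: nat
  design :: "nat \<Rightarrow> real mat"
  atoms :: "nat \<Rightarrow> nat set set"
  models :: "nat \<Rightarrow> nat set set"
  class_complexity :: "nat \<Rightarrow> nat set \<Rightarrow> real"
  signal :: "real Matrix.vec"
  true_class :: nat
  true_model :: "nat set"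

type_synonym model_pair = "nat \<times> nat set"

definition true_pair :: "selection_problem \<Rightarrow> model_pair" where
  "true_pair G = (true_class G, true_model G)"

definition agg_list :: "selection_problem \<Rightarrow> model_pair set" where
  "agg_list G = (SIGMA m : {1..nclass G}. models G m)"

definition complexity :: "selection_problem \<Rightarrow> model_pair \<Rightarrow> real" where
  "complexity G p = class_complexity G (fst p) (snd p) + ln (real (nclass G))"

definition nvars :: "model_pair \<Rightarrow> nat" where
  "nvars p = card (snd p)"

definition model_space :: "selection_problem \<Rightarrow> model_pair \<Rightarrow> real Matrix.vec set" where
  "model_space G p =
     vec_space.col_space (nobs G) (submatrix (design G (fst p)) UNIV (snd p))"

definition proj :: "selection_problem \<Rightarrow> model_pair \<Rightarrow> real mat" where
  "proj G p = orth_proj (nobs G) (model_space G p)"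

definition model_rank :: "selection_problem \<Rightarrow> model_pair \<Rightarrow> nat" where
  "model_rank G p = vec_space.rank (nobs G) (proj G p)"

definition common_rank :: "selection_problem \<Rightarrow> model_pair \<Rightarrow> nat" where
  "common_rank G p =
     subspace_dim (nobs G) (model_space G p \<inter> model_space G (true_pair G))"

definition RSS :: "selection_problem \<Rightarrow> real Matrix.vec \<Rightarrow> model_pair \<Rightarrow> real" where
  "RSS G y p = sqnorm ((1\<^sub>m (nobs G) - proj G p) *\<^sub>v y)"

definition APP :: "selection_problem \<Rightarrow> real \<Rightarrow> model_pair \<Rightarrow> real" where
  "APP G \<sigma> p = sqnorm ((1\<^sub>m (nobs G) - proj G p) *\<^sub>v signal G) / \<sigma>\<^sup>2"

definition DCIC :: "selection_problem \<Rightarrow> real \<Rightarrow> real \<Rightarrow> real \<Rightarrow> real \<Rightarrow>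
    real Matrix.vec \<Rightarrow> model_pair \<Rightarrow> real" where
  "DCIC G \<sigma> alpha lambda eta y p =
     RSS G y p / \<sigma>\<^sup>2 + eta * real (nvars p) + lambda * complexity G p powr (2 / alpha)"

definition DCIC_argmin :: "selection_problem \<Rightarrow> real \<Rightarrow> real \<Rightarrow> real \<Rightarrow> real \<Rightarrow>
    real Matrix.vec \<Rightarrow> model_pair set" where
  "DCIC_argmin G \<sigma> alpha lambda eta y =
     {p \<in> agg_list G. \<forall>p' \<in> agg_list G.
        DCIC G \<sigma> alpha lambda eta y p \<le> DCIC G \<sigma> alpha lambda eta y p'}"

definition response :: "selection_problem \<Rightarrow> (nat \<Rightarrow> 'a \<Rightarrow> real) \<Rightarrow> 'a \<Rightarrow> real Matrix.vec" where
  "response G eps \<omega> = signal G + Matrix.vec (nobs G) (\<lambda>i. eps i \<omega>)"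

definition sup_pairs :: "selection_problem \<Rightarrow> model_pair set" where
  "sup_pairs G = {p \<in> agg_list G. fst p = true_class G \<and> true_model G \<subset> snd p}"

definition sub_pairs :: "selection_problem \<Rightarrow> model_pair set" where
  "sub_pairs G = {p \<in> agg_list G. fst p = true_class G \<and> snd p \<subset> true_model G}"

definition wrong_pairs :: "selection_problem \<Rightarrow> model_pair set" where
  "wrong_pairs G = agg_list G - sup_pairs G - sub_pairs G - {true_pair G}"

definition true_class_atoms :: "selection_problem \<Rightarrow> nat set \<Rightarrow> nat set set" where
  "true_class_atoms G S = {U \<in> atoms G (true_class G). U \<subseteq> S}"

definition delta_plus :: "selection_problem \<Rightarrow> nat set \<Rightarrow> nat" where
  "delta_plus G S = card (true_class_atoms G S - true_class_atoms G (true_model G))"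

definition delta_minus :: "selection_problem \<Rightarrow> nat set \<Rightarrow> nat" where
  "delta_minus G S = card (true_class_atoms G (true_model G) - true_class_atoms G S)"

definition num_sub :: "selection_problem \<Rightarrow> nat \<Rightarrow> nat" where
  "num_sub G l = card {p \<in> sub_pairs G. delta_minus G (snd p) = l}"

definition u_pen :: "selection_problem \<Rightarrow> real \<Rightarrow> real \<Rightarrow> real \<Rightarrow> model_pair \<Rightarrow> real" where
  "u_pen G alpha lambda eta p =
     eta * (real (nvars p) - real (nvars (true_pair G)))
     + lambda * (complexity G p powr (2 / alpha) - complexity G (true_pair G) powr (2 / alpha))"

definition D_term :: "selection_problem \<Rightarrow> model_pair \<Rightarrow> real" where
  "D_term G p =
     (if fst p = true_class G
      then let qs = card (true_class_atoms G (true_model G));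
               q = card (atoms G (true_class G))
           in min (ln (real ((qs choose delta_minus G (snd p))
                             * ((q - qs) choose delta_plus G (snd p)))))
                  (complexity G p)
      else complexity G p)"

definition B_term :: "selection_problem \<Rightarrow> real \<Rightarrow> real \<Rightarrow> model_pair \<Rightarrow> real" where
  "B_term G alpha lambda p =
     lambda * D_term G p powr (2 / alpha) / 4
     + ln (ln (real (nobs G))) / 4
     + 2 * (real (model_rank G p) - real (common_rank G p))"

definition multi_class_setting :: "nat \<Rightarrow> selection_problem \<Rightarrow> bool" where
  "multi_class_setting n G \<longleftrightarrow>
     nobs G = n \<and>
     (\<forall>m \<in> {1..nclass G}.
        dim_row (design G m) = n \<and>
        partition_on {..<dim_col (design G m)} (atoms G m) \<and>
        (\<forall>S \<in> models G m. \<exists>A \<subseteq> atoms G m. S = \<Union>A) \<and>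
        (\<Sum>S \<in> models G m. exp (- class_complexity G m S)) \<le> 1) \<and>
     signal G \<in> carrier_vec n \<and>
     true_pair G \<in> agg_list G \<and>
     signal G \<in> model_space G (true_pair G)"

text \<open>
  No separate integrability assumption is needed: \<open>\<integral> \<epsilon>\<^sub>i\<^sup>2 = \<sigma>\<^sup>2 \<noteq> 0\<close>
  already forces \<open>\<epsilon>\<^sub>i\<^sup>2\<close>, hence \<open>\<epsilon>\<^sub>i\<close>, to be integrable.
\<close>

definition noise_model :: "'a measure \<Rightarrow> nat \<Rightarrow> real \<Rightarrow> real \<Rightarrow> real \<Rightarrow>
    (nat \<Rightarrow> 'a \<Rightarrow> real) \<Rightarrow> bool" where
  "noise_model M n \<sigma> alpha zeta eps \<longleftrightarrow>
     prob_space M \<and>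
     prob_space.indep_vars M (\<lambda>_. borel) eps {..<n} \<and>
     (\<forall>i<n. (\<integral>\<omega>. eps i \<omega> \<partial>M) = 0 \<and>
        (\<integral>\<omega>. (eps i \<omega>)\<^sup>2 \<partial>M) = \<sigma>\<^sup>2 \<and>
        (\<forall>t\<ge>2. measure M {\<omega> \<in> space M. \<bar>eps i \<omega> / \<sigma>\<bar> > t}
           \<le> 2 * exp (- ((t / zeta) powr alpha))))"

definition cond_sup :: "selection_problem \<Rightarrow> real \<Rightarrow> real \<Rightarrow> real \<Rightarrow> real \<Rightarrow> real \<Rightarrow> bool" where
  "cond_sup G alpha lambda eta c1' c1 \<longleftrightarrow>
     (\<forall>p \<in> sup_pairs G. complexity G p \<ge> complexity G (true_pair G)) \<and>
     (\<forall>j::nat. j \<ge> 1 \<longrightarrow>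
        (\<Sum>p \<in> {p \<in> sup_pairs G. delta_plus G (snd p) = j}.
           exp (- c1 * lambda powr (alpha / 2) * (complexity G p - complexity G (true_pair G))))
        \<le> exp (c1' * (eta * real j) powr (alpha / 2)))"

definition cond_sub :: "selection_problem \<Rightarrow> real \<Rightarrow> real \<Rightarrow> real \<Rightarrow> real \<Rightarrow> real \<Rightarrow> bool" where
  "cond_sub G \<sigma> alpha lambda eta c2 \<longleftrightarrow>
     (\<forall>p \<in> sub_pairs G. APP G \<sigma> p \<ge> c2 *
        (eta * (real (nvars (true_pair G)) - real (nvars p))
         + lambda * max (complexity G (true_pair G) powr (2 / alpha)
                         - complexity G p powr (2 / alpha)) 0
         + ln (real (num_sub G (delta_minus G (snd p)))) powr (2 / alpha)))"

definition cond_wrong :: "selection_problem \<Rightarrow> real \<Rightarrow> real \<Rightarrow> real \<Rightarrow> real \<Rightarrow> bool" where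
  "cond_wrong G \<sigma> alpha lambda eta \<longleftrightarrow>
     (\<forall>p \<in> wrong_pairs G. 2 * B_term G alpha lambda p > u_pen G alpha lambda eta p \<longrightarrow>
        APP G \<sigma> p \<ge> 2 * (2 * B_term G alpha lambda p - u_pen G alpha lambda eta p))"

end

theory Submission
  imports Defs
begin

text \<open>
  Fix a competing pair, let \<open>\<mu>\<close> be the signal and let \<open>P\<close> and \<open>P'\<close> project onto its model space and
  onto the intersection of that space with the true one. Since \<open>\<mu>\<close> lies in the true model space,
  DCIC can prefer the pair only if APP plus the penalty gap is at most \<open>\<parallel>(P - P')\<epsilon>\<parallel>\<^sup>2/\<sigma>\<^sup>2\<close> minus twice
  a linear form in \<open>\<epsilon>\<close> whose squared coefficient norm is APP. Each of the three conditions says that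
  then either \<open>\<parallel>(P - P')\<epsilon>\<parallel>\<^sup>2/\<sigma>\<^sup>2\<close> exceeds twice its mean by some \<open>x > 0\<close>, or the linear form is of the
  corresponding size. Both events have probability at most \<open>C exp (- c (x/2)\<^bsup>\<alpha>/2\<^esup>)\<close>, which is summable
  over the list: over wrong pairs by Kraft's inequality and a count of atom patterns, over nested
  pairs by the conditions (i) and (ii).

  The factor 2 in front of the mean must not depend on the noise, so a crude moment bound does not
  suffice. For a projection \<open>Q\<close> write \<open>\<parallel>Q\<epsilon>\<parallel>\<^sup>2 - tr Q\<close> as a diagonal plus an off-diagonal part. After
  decoupling, the latter is conditionally a linear form with coefficient norm at most \<open>\<parallel>Q\<epsilon>\<parallel>\<close>, so
  its moment of order \<open>2k\<close> is controlled by the moment of order \<open>k\<close> of \<open>\<parallel>Q\<epsilon>\<parallel>\<^sup>2\<close> itself, and the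
  resulting inequality closes on itself.
\<close>

section \<open>Truncated moment generating functions\<close>

text \<open>For alpha < 2 the squared noise, and for alpha < 1 even the noise itself, may have no
  exponential moments, so generating functions are cut off at a finite order. The truncation keeps
  what the classical argument needs: it is submultiplicative over independent summands, and every
  moment up to that order can be read off. The absolute value stands outside the integral so that
  the linear term of a centred variable vanishes. Up to order 2k the noise looks sub-Gaussian with a
  constant growing in k, and Markov's inequality with k of order t^(alpha/2) gives the stretched
  exponential tail.

  The moment inequality for the quadratic form is run over all sets of coordinates at once, because
  decoupling passes from a set to a smaller one. It closes only at deviations that dominate the
  trace; this is where the 2 in front of the mean comes from.

  Condition (i) gets weaker as c1 grows and (ii) stronger as c2 grows, so c1 is bounded from above
  and c2 from below, by thresholds that depend only on alpha and zeta.\<close>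

definition trunc_mgf :: "'a measure \<Rightarrow> nat \<Rightarrow> real \<Rightarrow> ('a \<Rightarrow> real) \<Rightarrow> real" where
  "trunc_mgf M k z X = (\<Sum>l\<le>k. z ^ l * \<bar>\<integral>\<omega>. X \<omega> ^ l \<partial>M\<bar> / fact l)"

lemma trunc_mgf_nonneg: "0 \<le> z \<Longrightarrow> 0 \<le> trunc_mgf M k z X"
  unfolding trunc_mgf_def by (intro sum_nonneg) auto

lemma moment_le_trunc_mgf:
  assumes "0 < z" "l \<le> k"
  shows "\<bar>\<integral>\<omega>. X \<omega> ^ l \<partial>M\<bar> \<le> fact l / z ^ l * trunc_mgf M k z X"
proof -
  have "z ^ l * \<bar>\<integral>\<omega>. X \<omega> ^ l \<partial>M\<bar> / fact l \<le> trunc_mgf M k z X"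
    unfolding trunc_mgf_def using assms
    by (intro member_le_sum[of l "{..k}" "\<lambda>l. z ^ l * \<bar>\<integral>\<omega>. X \<omega> ^ l \<partial>M\<bar> / fact l"]) auto
  then show ?thesis
    using assms by (simp add: field_simps)
qed

lemma sum_triangle_le_product:
  fixes a b :: "nat \<Rightarrow> real"
  assumes "\<And>i. 0 \<le> a i" "\<And>i. 0 \<le> b i"
  shows "(\<Sum>l\<le>k. \<Sum>j\<le>l. a j * b (l - j)) \<le> (\<Sum>j\<le>k. a j) * (\<Sum>j\<le>k. b j)"
proof -
  have "(\<Sum>l\<le>k. \<Sum>j\<le>l. a j * b (l - j)) = (\<Sum>(i, j)\<in>{(i, j). i + j \<le> k}. a i * b j)"
    by (rule sum.triangle_reindex_eq[symmetric])
  also have "\<dots> \<le> (\<Sum>(i, j)\<in>{..k} \<times> {..k}. a i * b j)"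
    by (rule sum_mono2) (auto simp: assms)
  also have "\<dots> = (\<Sum>j\<le>k. a j) * (\<Sum>j\<le>k. b j)"
    by (simp add: sum_product sum.cartesian_product)
  finally show ?thesis .
qed

context prob_space
begin

lemma integral_power_sum_indep:
  fixes X Y :: "'a \<Rightarrow> real"
  assumes ind: "indep_var borel X borel Y"
    and X: "\<And>m. integrable M (\<lambda>\<omega>. X \<omega> ^ m)" and Y: "\<And>m. integrable M (\<lambda>\<omega>. Y \<omega> ^ m)"
  shows "integrable M (\<lambda>\<omega>. (X \<omega> + Y \<omega>) ^ l)"
    and "(\<integral>\<omega>. (X \<omega> + Y \<omega>) ^ l \<partial>M) =
      (\<Sum>j\<le>l. (l choose j) * ((\<integral>\<omega>. X \<omega> ^ j \<partial>M) * (\<integral>\<omega>. Y \<omega> ^ (l - j) \<partial>M)))"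
proof -
  have ind': "indep_var borel (\<lambda>\<omega>. X \<omega> ^ i) borel (\<lambda>\<omega>. Y \<omega> ^ j)" for i j
    using indep_var_compose[OF ind, of "\<lambda>x. x ^ i" borel "\<lambda>x. x ^ j" borel]
    by (simp add: comp_def)
  have int: "integrable M (\<lambda>\<omega>. X \<omega> ^ i * Y \<omega> ^ j)"
    and eq: "(\<integral>\<omega>. X \<omega> ^ i * Y \<omega> ^ j \<partial>M) = (\<integral>\<omega>. X \<omega> ^ i \<partial>M) * (\<integral>\<omega>. Y \<omega> ^ j \<partial>M)" for i j
    using indep_var_integrable[OF ind' X Y] indep_var_lebesgue_integral[OF ind' X Y] by auto
  show "integrable M (\<lambda>\<omega>. (X \<omega> + Y \<omega>) ^ l)"
    unfolding binomial_ring
    by (intro Bochner_Integration.integrable_sum) (simp add: int mult.assoc)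
  show "(\<integral>\<omega>. (X \<omega> + Y \<omega>) ^ l \<partial>M) =
      (\<Sum>j\<le>l. (l choose j) * ((\<integral>\<omega>. X \<omega> ^ j \<partial>M) * (\<integral>\<omega>. Y \<omega> ^ (l - j) \<partial>M)))"
    unfolding binomial_ring
    by (subst Bochner_Integration.integral_sum) (simp_all add: int eq mult.assoc)
qed

text \<open>The binomial coefficient divided by l! splits into 1/j! and 1/(l - j)!, so the moments
  of the sum form a Cauchy product. The full product only adds nonnegative terms beyond the
  truncation order.\<close>

lemma trunc_mgf_add:
  fixes X Y :: "'a \<Rightarrow> real"
  assumes ind: "indep_var borel X borel Y"
    and X: "\<And>m. integrable M (\<lambda>\<omega>. X \<omega> ^ m)" and Y: "\<And>m. integrable M (\<lambda>\<omega>. Y \<omega> ^ m)"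
    and z: "0 \<le> z"
  shows "trunc_mgf M k z (\<lambda>\<omega>. X \<omega> + Y \<omega>) \<le> trunc_mgf M k z X * trunc_mgf M k z Y"
proof -
  define a where "a = (\<lambda>l. z ^ l * \<bar>\<integral>\<omega>. X \<omega> ^ l \<partial>M\<bar> / fact l)"
  define b where "b = (\<lambda>l. z ^ l * \<bar>\<integral>\<omega>. Y \<omega> ^ l \<partial>M\<bar> / fact l)"
  have "z ^ l * \<bar>\<integral>\<omega>. (X \<omega> + Y \<omega>) ^ l \<partial>M\<bar> / fact l \<le> (\<Sum>j\<le>l. a j * b (l - j))" for l
  proof -
    have "z ^ l * \<bar>\<integral>\<omega>. (X \<omega> + Y \<omega>) ^ l \<partial>M\<bar> / fact l \<le>
      z ^ l * (\<Sum>j\<le>l. \<bar>(l choose j) * ((\<integral>\<omega>. X \<omega> ^ j \<partial>M) * (\<integral>\<omega>. Y \<omega> ^ (l - j) \<partial>M))\<bar>) / fact l"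
      unfolding integral_power_sum_indep(2)[OF ind X Y]
      by (intro divide_right_mono mult_left_mono sum_abs) (auto simp: z)
    also have "\<dots> = (\<Sum>j\<le>l. a j * b (l - j))"
      unfolding sum_distrib_left sum_divide_distrib
    proof (rule sum.cong[OF refl])
      fix j assume "j \<in> {..l}"
      then have j: "j \<le> l" by simp
      then have "z ^ l = z ^ j * z ^ (l - j)" by (simp flip: power_add)
      then show "z ^ l * \<bar>(l choose j) * ((\<integral>\<omega>. X \<omega> ^ j \<partial>M) * (\<integral>\<omega>. Y \<omega> ^ (l - j) \<partial>M))\<bar> / fact l
          = a j * b (l - j)"
        using binomial_fact[OF j, where 'a = real]
        by (simp add: a_def b_def abs_mult)
    qed
    finally show ?thesis .
  qed
  then have "trunc_mgf M k z (\<lambda>\<omega>. X \<omega> + Y \<omega>) \<le> (\<Sum>l\<le>k. \<Sum>j\<le>l. a j * b (l - j))"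
    unfolding trunc_mgf_def by (rule sum_mono)
  also have "\<dots> \<le> (\<Sum>j\<le>k. a j) * (\<Sum>j\<le>k. b j)"
    by (rule sum_triangle_le_product) (auto simp: a_def b_def z)
  finally show ?thesis by (simp add: trunc_mgf_def a_def b_def)
qed

text \<open>Integrability goes through the induction together with the bound, since adding one more
  summand needs all moments of the partial sum.\<close>

lemma trunc_mgf_sum:
  fixes X :: "'i \<Rightarrow> 'a \<Rightarrow> real"
  assumes "finite I" "indep_vars (\<lambda>_. borel) X I"
    and "\<And>i m. i \<in> I \<Longrightarrow> integrable M (\<lambda>\<omega>. X i \<omega> ^ m)" and z: "0 \<le> z"
  shows "(\<forall>m. integrable M (\<lambda>\<omega>. (\<Sum>i\<in>I. X i \<omega>) ^ m)) \<and>
    trunc_mgf M k z (\<lambda>\<omega>. \<Sum>i\<in>I. X i \<omega>) \<le> (\<Prod>i\<in>I. trunc_mgf M k z (X i))"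
  using assms(1-3)
proof (induction I rule: finite_induct)
  case empty
  have "trunc_mgf M k z (\<lambda>\<omega>. 0) \<le> (\<Sum>l\<le>k. if l = 0 then 1 else 0)"
    unfolding trunc_mgf_def by (intro sum_mono) (auto simp: power_0_left prob_space)
  then show ?case by simp
next
  case (insert i I)
  have IH: "(\<forall>m. integrable M (\<lambda>\<omega>. (\<Sum>i\<in>I. X i \<omega>) ^ m)) \<and>
    trunc_mgf M k z (\<lambda>\<omega>. \<Sum>i\<in>I. X i \<omega>) \<le> (\<Prod>i\<in>I. trunc_mgf M k z (X i))"
    using insert.prems by (intro insert.IH) (auto intro: indep_vars_subset)
  have ind: "indep_var borel (X i) borel (\<lambda>\<omega>. \<Sum>i\<in>I. X i \<omega>)"
    by (rule indep_vars_sum[OF insert.hyps insert.prems(1)])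
  have Xi: "\<And>m. integrable M (\<lambda>\<omega>. X i \<omega> ^ m)" using insert.prems by simp
  have "trunc_mgf M k z (\<lambda>\<omega>. X i \<omega> + (\<Sum>i\<in>I. X i \<omega>))
      \<le> trunc_mgf M k z (X i) * trunc_mgf M k z (\<lambda>\<omega>. \<Sum>i\<in>I. X i \<omega>)"
    using IH by (intro trunc_mgf_add ind Xi z) auto
  also have "\<dots> \<le> trunc_mgf M k z (X i) * (\<Prod>i\<in>I. trunc_mgf M k z (X i))"
    using IH by (intro mult_left_mono trunc_mgf_nonneg z) auto
  finally show ?case
    using integral_power_sum_indep(1)[OF ind Xi] IH insert.hyps by simp
qed

end

section \<open>Moments of linear forms and of weighted sums of squares\<close>

lemma power_over_fact_le_exp:
  fixes x :: real
  assumes "0 \<le> x"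
  shows "x ^ n / fact n \<le> exp x"
proof -
  have "(\<Sum>i\<in>{n}. x ^ i /\<^sub>R fact i) \<le> (\<Sum>i. x ^ i /\<^sub>R fact i)"
    using assms by (intro sum_le_suminf summable_exp_generic) auto
  then show ?thesis by (simp add: exp_def divide_inverse mult.commute)
qed

lemma sum_power_over_fact_le_exp:
  fixes x :: real
  assumes "0 \<le> x"
  shows "(\<Sum>m=1..k. x ^ m / fact m) \<le> exp x - 1"
proof -
  have "(\<Sum>i\<le>k. x ^ i /\<^sub>R fact i) \<le> (\<Sum>i. x ^ i /\<^sub>R fact i)"
    using assms by (intro sum_le_suminf summable_exp_generic) auto
  moreover have "{..k} = insert 0 {1..k}" by auto
  then have "(\<Sum>i\<le>k. x ^ i /\<^sub>R fact i) = 1 + (\<Sum>m=1..k. x ^ m / fact m)"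
    by (simp add: divide_inverse mult.commute)
  ultimately show ?thesis by (simp add: exp_def)
qed

text \<open>A crude form of Stirling's formula: l^l / l! is one term of the series of exp l.\<close>

lemma power_self_le_exp_fact: "real l ^ l \<le> exp 1 ^ l * fact l"
  using power_over_fact_le_exp[of "real l" l] by (simp add: field_simps flip: exp_of_nat_mult)

text \<open>The exponent is one less than in the obvious bound, because the factor 1 is dropped. The
  odd orders in the next lemma need this.\<close>

lemma fact_Suc_le_power: "fact (Suc k) \<le> (real k + 1) ^ k"
proof (induction k)
  case (Suc k)
  have "fact (Suc (Suc k)) = (real k + 2) * fact (Suc k)" by (simp add: algebra_simps)
  also have "\<dots> \<le> (real k + 2) * (real k + 1) ^ k"
    by (rule mult_left_mono[OF Suc]) simp
  also have "\<dots> \<le> (real k + 2) * (real k + 2) ^ k"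
    by (intro mult_left_mono power_mono) auto
  finally show ?case by (simp add: algebra_simps)
qed simp

text \<open>Comparison with the series of exp x at x = y^2. The term of even order 2m is at most x^m
  / m!; a term of odd order is split between its two even neighbours by y \<le> 1 + y^2. Each x^m /
  m! is thus charged at most three times.\<close>

lemma subgaussian_series_le:
  fixes y :: real
  assumes y: "0 \<le> y"
  shows "(\<Sum>l=2..2 * k. y ^ l / sqrt (real l) ^ l) \<le> 3 * (exp (y\<^sup>2) - 1)"
proof -
  define x where "x = y\<^sup>2"
  have x: "0 \<le> x" by (simp add: x_def)
  define h where "h = (\<lambda>l. y ^ l / sqrt (real l) ^ l)"
  have even: "h (2 * m) \<le> x ^ m / fact m" if "1 \<le> m" for m
  proof -
    have "fact m \<le> real m ^ m" using fact_le_power[of m, where 'a = real] by simp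
    also have "\<dots> \<le> real (2 * m) ^ m" by (intro power_mono) auto
    finally have *: "fact m \<le> real (2 * m) ^ m" .
    have "h (2 * m) = x ^ m / real (2 * m) ^ m"
      by (simp add: h_def x_def power_mult)
    also have "\<dots> \<le> x ^ m / fact m"
      using * x that by (intro divide_left_mono mult_pos_pos) auto
    finally show ?thesis .
  qed
  have odd: "h (2 * m + 1) \<le> x ^ m / fact m + x ^ (m + 1) / fact (m + 1)" for m
  proof -
    have ym: "y ^ (2 * m + 1) \<le> x ^ m + x ^ (m + 1)"
    proof -
      have "y \<le> 1 + y\<^sup>2"
        using zero_le_power2[of "y - 1 / 2"] by (simp add: power2_eq_square algebra_simps)
      then have "y ^ (2 * m) * y \<le> y ^ (2 * m) * (1 + y\<^sup>2)"
        using y by (intro mult_left_mono) auto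
      then show ?thesis by (simp add: x_def power_mult[symmetric] algebra_simps power_add)
    qed
    define N where "N = 2 * m + 1"
    have "fact (m + 1) \<le> (real m + 1) ^ m" using fact_Suc_le_power[of m] by simp
    also have "\<dots> \<le> real N ^ m" by (intro power_mono) (auto simp: N_def)
    also have "\<dots> = sqrt (real N) ^ (2 * m)" by (simp add: power_mult)
    also have "\<dots> \<le> sqrt (real N) ^ N"
      by (intro power_increasing) (auto simp: N_def)
    finally have *: "fact (m + 1) \<le> sqrt (real N) ^ N" .
    have "h N \<le> (x ^ m + x ^ (m + 1)) / fact (m + 1)"
      unfolding h_def using * ym x by (intro frac_le) (auto simp: N_def)
    also have "\<dots> \<le> x ^ m / fact m + x ^ (m + 1) / fact (m + 1)"
      using x unfolding add_divide_distrib
      by (intro add_mono divide_left_mono fact_mono) auto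
    finally show ?thesis by (simp add: N_def)
  qed
  define t where "t = (\<lambda>m. x ^ m / fact m)"
  \<comment> \<open>The top term has only its lower odd neighbour inside the sum, hence weight 2
    instead of 3.\<close>
  have ind: "(\<Sum>l=2..2 * Suc k. h l) \<le> 3 * (\<Sum>m=1..k. t m) + 2 * t (Suc k)" for k
  proof (induction k)
    case 0
    then show ?case using even[of 1] x by (simp add: t_def)
  next
    case (Suc k)
    have eq: "2 * Suc (Suc k) = Suc (Suc (2 * Suc k))" by simp
    have "(\<Sum>l=2..2 * Suc (Suc k). h l) =
        (\<Sum>l=2..2 * Suc k. h l) + h (2 * Suc k + 1) + h (2 * Suc (Suc k))"
      by (simp add: sum.cl_ivl_Suc eq del: mult_Suc_right)
    also have "\<dots> \<le> 3 * (\<Sum>m=1..k. t m) + 2 * t (Suc k) + (t (Suc k) + t (Suc (Suc k)))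
        + t (Suc (Suc k))"
      using Suc odd[of "Suc k"] even[of "Suc (Suc k)"] by (intro add_mono) (auto simp: t_def)
    also have "\<dots> = 3 * (\<Sum>m=1..Suc k. t m) + 2 * t (Suc (Suc k))" by simp
    finally show ?case .
  qed
  show ?thesis
  proof (cases k)
    case 0
    then show ?thesis using x by (simp add: x_def)
  next
    case (Suc j)
    have "(\<Sum>l=2..2 * k. h l) \<le> 3 * (\<Sum>m=1..j. x ^ m / fact m) + 2 * (x ^ Suc j / fact (Suc j))"
      using ind[of j] Suc by (simp add: t_def)
    also have "\<dots> \<le> 3 * (\<Sum>m=1..k. x ^ m / fact m)"
      using x Suc by (simp add: divide_right_mono)
    also have "\<dots> \<le> 3 * (exp x - 1)"
      using sum_power_over_fact_le_exp[OF x, of k] by simp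
    finally show ?thesis by (simp add: h_def x_def)
  qed
qed

lemma one_plus_mult_le_exp:
  fixes x :: real
  assumes "0 \<le> x"
  shows "1 + 3 * (exp x - 1) \<le> exp (3 * x)"
proof -
  have "1 + real 3 * (exp x - 1) \<le> (1 + (exp x - 1)) ^ 3"
    using assms by (intro Bernoulli_inequality) (simp add: add_increasing)
  then show ?thesis by (simp flip: exp_of_nat_mult)
qed

lemma geometric_half_sum_le: "(\<Sum>l=2..N. (1 / 2 :: real) ^ (l - 2)) \<le> 2"
proof (cases "2 \<le> N")
  case True
  have "(\<Sum>l=2..Suc (Suc j). (1 / 2 :: real) ^ (l - 2)) = 2 - (1 / 2) ^ j" for j
    by (induction j) auto
  from this[of "N - 2"] have "(\<Sum>l=2..N. (1 / 2 :: real) ^ (l - 2)) = 2 - (1 / 2) ^ (N - 2)"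
    using True by (simp only: Suc_diff_Suc numeral_2_eq_2 flip: Suc_diff_le) simp
  then show ?thesis by simp
qed simp

lemma power_add_le:
  fixes a b :: real
  assumes "0 \<le> a" "0 \<le> b"
  shows "(a + b) ^ l \<le> 2 ^ l * (a ^ l + b ^ l)"
proof -
  have "(a + b) ^ l \<le> (2 * max a b) ^ l"
    using assms by (intro power_mono) auto
  also have "\<dots> = 2 ^ l * max (a ^ l) (b ^ l)"
    using assms by (auto simp: power_mult_distrib max_def power_mono intro: antisym)
  also have "\<dots> \<le> 2 ^ l * (a ^ l + b ^ l)"
    using assms by (intro mult_left_mono) auto
  finally show ?thesis .
qed

text \<open>The noise divided by sigma. The tail assumption enters only through the growth of the
  absolute moments.\<close>

locale weibull_noise = prob_space M for M :: "'a measure" +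
  fixes n :: nat and e :: "nat \<Rightarrow> 'a \<Rightarrow> real" and alpha K :: real
  assumes alpha: "0 < alpha" "alpha \<le> 2" and K: "1 \<le> K"
    and indep: "indep_vars (\<lambda>_. borel) e {..<n}"
    and mean: "\<And>i. i < n \<Longrightarrow> expectation (e i) = 0"
    and variance: "\<And>i. i < n \<Longrightarrow> expectation (\<lambda>\<omega>. (e i \<omega>)\<^sup>2) = 1"
    and integrable_abs: "\<And>i m. i < n \<Longrightarrow> integrable M (\<lambda>\<omega>. \<bar>e i \<omega>\<bar> ^ m)"
    and moment: "\<And>i m. i < n \<Longrightarrow> 1 \<le> m \<Longrightarrow>
      expectation (\<lambda>\<omega>. \<bar>e i \<omega>\<bar> ^ m) \<le> (K * real m powr (1 / alpha)) ^ m"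
begin

lemma measurable_e[measurable]: "i < n \<Longrightarrow> e i \<in> borel_measurable M"
  using indep_vars_def2[of "\<lambda>_. borel" e "{..<n}"] indep by auto

lemma integrable_power: "i < n \<Longrightarrow> integrable M (\<lambda>\<omega>. (e i \<omega>) ^ m)"
  by (rule Bochner_Integration.integrable_bound[OF integrable_abs[of i m]]) (auto simp: power_abs)

text \<open>For l \<le> 2k and alpha \<le> 2, l^(1/alpha) \<le> sqrt l * (2k)^(1/alpha - 1/2): below
  the truncation order the moments are sub-Gaussian at the price of a power of k. Mean zero removes
  the linear term.\<close>

lemma trunc_mgf_linear:
  assumes i: "i < n" and z: "0 \<le> z"
  shows "trunc_mgf M (2 * k) z (\<lambda>\<omega>. a * e i \<omega>)
    \<le> exp (3 * ((K * exp 1)\<^sup>2 * real (2 * k) powr (2 / alpha - 1) * z\<^sup>2 * a\<^sup>2))"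
proof -
  define ka where "ka = real (2 * k) powr (1 / alpha - 1 / 2)"
  define y where "y = K * exp 1 * ka * z * \<bar>a\<bar>"
  have ka0: "0 \<le> ka" by (simp add: ka_def)
  have y: "0 \<le> y" using K z by (simp add: y_def ka_def)
  have summand: "z ^ l * \<bar>expectation (\<lambda>\<omega>. (a * e i \<omega>) ^ l)\<bar> / fact l \<le> y ^ l / sqrt (real l) ^ l"
    if l: "2 \<le> l" "l \<le> 2 * k" for l
  proof -
    have "\<bar>expectation (\<lambda>\<omega>. (a * e i \<omega>) ^ l)\<bar> \<le> expectation (\<lambda>\<omega>. \<bar>(a * e i \<omega>) ^ l\<bar>)"
      by (rule integral_abs_bound)
    also have "\<dots> = \<bar>a\<bar> ^ l * expectation (\<lambda>\<omega>. \<bar>e i \<omega>\<bar> ^ l)"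
      by (simp add: abs_mult power_mult_distrib power_abs)
    also have "\<dots> \<le> \<bar>a\<bar> ^ l * (K * real l powr (1 / alpha)) ^ l"
      using moment[OF i, of l] l by (intro mult_left_mono) auto
    also have "real l powr (1 / alpha) = sqrt (real l) * real l powr (1 / alpha - 1 / 2)"
      using l by (simp add: powr_half_sqrt[symmetric] powr_add[symmetric])
    also have "\<bar>a\<bar> ^ l * (K * (sqrt (real l) * real l powr (1 / alpha - 1 / 2))) ^ l
        \<le> \<bar>a\<bar> ^ l * (K * (sqrt (real l) * ka)) ^ l"
      unfolding ka_def using l K alpha
      by (intro mult_left_mono power_mono powr_mono2) (auto simp: field_simps)
    finally have 1: "\<bar>expectation (\<lambda>\<omega>. (a * e i \<omega>) ^ l)\<bar> \<le> (\<bar>a\<bar> * K * ka) ^ l * sqrt (real l) ^ l"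
      by (simp add: power_mult_distrib mult_ac)
    \<comment> \<open>One factor l^(l/2) comes from the moment bound. Since l! is at least (l/e)^l,
      it cancels and leaves the same power in the denominator.\<close>
    have "sqrt (real l) ^ l * sqrt (real l) ^ l = real l ^ l"
      by (simp flip: power_mult_distrib)
    then have 2: "sqrt (real l) ^ l * sqrt (real l) ^ l \<le> exp 1 ^ l * fact l"
      using power_self_le_exp_fact[of l] by simp
    have "z ^ l * \<bar>expectation (\<lambda>\<omega>. (a * e i \<omega>) ^ l)\<bar> / fact l
        \<le> z ^ l * ((\<bar>a\<bar> * K * ka) ^ l * sqrt (real l) ^ l) / fact l"
      using 1 z by (intro divide_right_mono mult_left_mono) auto
    also have "\<dots> = (z * \<bar>a\<bar> * K * ka) ^ l * (sqrt (real l) ^ l / fact l)"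
      by (simp add: power_mult_distrib)
    also have "\<dots> \<le> (z * \<bar>a\<bar> * K * ka) ^ l * (exp 1 ^ l / sqrt (real l) ^ l)"
      using 2 l z K ka0 by (intro mult_left_mono) (auto simp: field_simps)
    also have "\<dots> = y ^ l / sqrt (real l) ^ l"
      by (simp add: y_def power_mult_distrib mult_ac)
    finally show ?thesis .
  qed
  have "trunc_mgf M (2 * k) z (\<lambda>\<omega>. a * e i \<omega>)
      \<le> 1 + (\<Sum>l=2..2 * k. y ^ l / sqrt (real l) ^ l)"
  proof (cases "k = 0")
    case True
    then show ?thesis by (simp add: trunc_mgf_def prob_space)
  next
    case False
    have "{..2 * k} = insert 0 (insert 1 {2..2 * k})" using False by auto
    then have "trunc_mgf M (2 * k) z (\<lambda>\<omega>. a * e i \<omega>) = 1 +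
      (\<Sum>l=2..2 * k. z ^ l * \<bar>expectation (\<lambda>\<omega>. (a * e i \<omega>) ^ l)\<bar> / fact l)"
      by (simp add: trunc_mgf_def prob_space mean[OF i])
    also have "\<dots> \<le> 1 + (\<Sum>l=2..2 * k. y ^ l / sqrt (real l) ^ l)"
      by (intro add_left_mono sum_mono summand) auto
    finally show ?thesis .
  qed
  also have "\<dots> \<le> 1 + 3 * (exp (y\<^sup>2) - 1)"
    using subgaussian_series_le[OF y, of k] by simp
  also have "\<dots> \<le> exp (3 * y\<^sup>2)"
    by (rule one_plus_mult_le_exp) simp
  also have "ka\<^sup>2 = real (2 * k) powr (2 / alpha - 1)"
  proof (cases "k = 0")
    case False
    then show ?thesis
      by (simp add: ka_def power2_eq_square powr_add[symmetric])
  qed (simp add: ka_def)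
  then have "y\<^sup>2 = (K * exp 1)\<^sup>2 * real (2 * k) powr (2 / alpha - 1) * z\<^sup>2 * a\<^sup>2"
    by (simp add: y_def power_mult_distrib)
  finally show ?thesis .
qed

lemma linear_moment:
  assumes I: "I \<subseteq> {..<n}" and k: "1 \<le> k"
  shows "integrable M (\<lambda>\<omega>. (\<Sum>i\<in>I. a i * e i \<omega>) ^ m)"
    and "expectation (\<lambda>\<omega>. (\<Sum>i\<in>I. a i * e i \<omega>) ^ (2 * k))
      \<le> (6 * exp 3 * K\<^sup>2 * real (2 * k) powr (2 / alpha)) ^ k * (\<Sum>i\<in>I. (a i)\<^sup>2) ^ k"
proof -
  define X where "X = (\<lambda>i \<omega>. a i * e i \<omega>)"
  have fin: "finite I" using I finite_subset by blast
  have "indep_vars (\<lambda>_. borel) e I" using indep I by (rule indep_vars_subset)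
  then have ind: "indep_vars (\<lambda>_. borel) X I"
    unfolding X_def by (rule indep_vars_compose2) auto
  have int: "integrable M (\<lambda>\<omega>. X i \<omega> ^ m)" if "i \<in> I" for i m
    using integrable_power[of i m] that I by (auto simp: X_def power_mult_distrib)
  note T = trunc_mgf_sum[OF fin ind int]
  \<comment> \<open>Only the integrability half of \<open>T\<close> is wanted here, so its order and
    argument are dummies.\<close>
  show "integrable M (\<lambda>\<omega>. (\<Sum>i\<in>I. a i * e i \<omega>) ^ m)"
    using T[of 0 0] by (simp add: X_def)
  define A where "A = (\<Sum>i\<in>I. (a i)\<^sup>2)"
  define kk where "kk = real (2 * k) powr (2 / alpha - 1)"
  define L where "L = (K * exp 1)\<^sup>2 * kk"
  have kk: "0 < kk" using k by (simp add: kk_def)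
  have L: "0 < L" using kk K by (simp add: L_def)
  show "expectation (\<lambda>\<omega>. (\<Sum>i\<in>I. a i * e i \<omega>) ^ (2 * k))
      \<le> (6 * exp 3 * K\<^sup>2 * real (2 * k) powr (2 / alpha)) ^ k * (\<Sum>i\<in>I. (a i)\<^sup>2) ^ k"
  proof (cases "A = 0")
    case True
    then have "a i = 0" if "i \<in> I" for i
      using that fin by (simp add: A_def sum_nonneg_eq_0_iff)
    then have "(\<Sum>i\<in>I. a i * e i \<omega>) = 0" for \<omega> by simp
    then show ?thesis using k True by (cases k) (auto simp: A_def)
  next
    case False
    then have A: "0 < A" by (simp add: A_def order_less_le sum_nonneg)
    \<comment> \<open>Makes the exponent 3 * L * z^2 * A equal to k. The quotient needs A > 0; for A
      = 0 the form vanishes identically.\<close>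
    define z where "z = sqrt (real k / (3 * L * A))"
    have z: "0 < z" using k L A by (simp add: z_def)
    have z2: "z\<^sup>2 = real k / (3 * L * A)" using L A by (simp add: z_def)
    have "expectation (\<lambda>\<omega>. (\<Sum>i\<in>I. X i \<omega>) ^ (2 * k))
        \<le> fact (2 * k) / z ^ (2 * k) * trunc_mgf M (2 * k) z (\<lambda>\<omega>. \<Sum>i\<in>I. X i \<omega>)"
      using moment_le_trunc_mgf[OF z order_refl, of M "\<lambda>\<omega>. \<Sum>i\<in>I. X i \<omega>" "2 * k"] by linarith
    also have "trunc_mgf M (2 * k) z (\<lambda>\<omega>. \<Sum>i\<in>I. X i \<omega>) \<le> (\<Prod>i\<in>I. trunc_mgf M (2 * k) z (X i))"
      using T[of z "2 * k"] z by simp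
    also have "\<dots> \<le> (\<Prod>i\<in>I. exp (3 * (L * z\<^sup>2 * (a i)\<^sup>2)))"
      unfolding X_def L_def kk_def using I z
      by (intro prod_mono conjI trunc_mgf_nonneg trunc_mgf_linear) auto
    also have "\<dots> = exp (3 * L * z\<^sup>2 * A)"
      using fin by (simp add: exp_sum A_def sum_distrib_left mult_ac)
    also have "3 * L * z\<^sup>2 * A = real k"
      using L A by (simp add: z2)
    also have "fact (2 * k) / z ^ (2 * k) * exp (real k)
        \<le> (real (2 * k)) ^ (2 * k) / z ^ (2 * k) * exp (real k)"
      using fact_le_power[of "2 * k", where 'a = real] z
      by (intro mult_right_mono divide_right_mono) auto
    also have "\<dots> = ((real (2 * k))\<^sup>2 / z\<^sup>2 * exp 1) ^ k"
      by (simp add: power_mult power_mult_distrib power_divide flip: exp_of_nat_mult)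
    also have "(real (2 * k))\<^sup>2 / z\<^sup>2 * exp 1 = 6 * exp 1 * real (2 * k) * L * A"
      unfolding z2 using L A k by (simp add: field_simps power2_eq_square)
    also have "\<dots> = 6 * exp 3 * K\<^sup>2 * (real (2 * k) * kk) * A"
    proof -
      have "exp (3::real) = exp 1 * (exp 1)\<^sup>2"
        by (simp add: power2_eq_square flip: exp_add)
      then show ?thesis by (simp add: L_def power_mult_distrib mult_ac)
    qed
    also have "real (2 * k) * kk = real (2 * k) powr (2 / alpha)"
      using k powr_add[of "real (2 * k)" 1 "2 / alpha - 1"] by (simp add: kk_def)
    finally show ?thesis
      using z by (simp add: X_def A_def power_mult_distrib divide_right_mono)
  qed
qed

text \<open>A centred square is at best sub-exponential, so \<open>z\<close> must stay below a
  threshold that depends on k. Under \<open>zk\<close> the terms of order l \<ge> 2 decay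
  geometrically and the quadratic one dominates.\<close>

lemma trunc_mgf_square:
  assumes i: "i < n" and b: "0 \<le> b" "b \<le> 1" and z: "0 \<le> z" and k: "1 \<le> k"
    and K3: "K3 = 2 * 4 powr (2 / alpha) * exp 1 * K\<^sup>2"
    and zk: "K3 * z * real (4 * k) powr (2 / alpha - 1) \<le> 1 / 2"
  shows "trunc_mgf M (2 * k) z (\<lambda>\<omega>. b * ((e i \<omega>)\<^sup>2 - 1)) \<le> exp (2 * K3\<^sup>2 * z\<^sup>2 * b\<^sup>2)"
proof -
  define be where "be = 2 / alpha - 1"
  have be: "0 \<le> be" using alpha by (simp add: be_def field_simps)
  define w where "w = K3 * z * b"
  have K3': "0 < K3" using K by (simp add: K3)
  have w: "0 \<le> w" using K3' z b by (simp add: w_def)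
  have "w * real (4 * k) powr be \<le> K3 * z * 1 * real (4 * k) powr be"
    unfolding w_def using b z K3' by (intro mult_right_mono mult_left_mono) auto
  then have wk: "w * real (4 * k) powr be \<le> 1 / 2" using zk by (simp add: be_def)
  have summand: "z ^ l * \<bar>expectation (\<lambda>\<omega>. (b * ((e i \<omega>)\<^sup>2 - 1)) ^ l)\<bar> / fact l \<le> w\<^sup>2 * (1 / 2) ^ (l - 2)"
    if l: "2 \<le> l" "l \<le> 2 * k" for l
  proof -
    define Q where "Q = K * real (2 * l) powr (1 / alpha)"
    \<comment> \<open>\<open>Q\<close> has to be at least 1 so that the subtracted mean 1 can be
      absorbed into the moment bound.\<close>
    have "1 \<le> real (2 * l) powr (1 / alpha)"
      using l alpha by (intro ge_one_powr_ge_zero) auto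
    then have Q: "1 \<le> Q" using mult_mono[OF K] K by (fastforce simp: Q_def)
    have "\<bar>expectation (\<lambda>\<omega>. (b * ((e i \<omega>)\<^sup>2 - 1)) ^ l)\<bar>
        \<le> expectation (\<lambda>\<omega>. \<bar>(b * ((e i \<omega>)\<^sup>2 - 1)) ^ l\<bar>)"
      by (rule integral_abs_bound)
    also have "\<dots> \<le> expectation (\<lambda>\<omega>. b ^ l * (2 ^ l * (\<bar>e i \<omega>\<bar> ^ (2 * l) + 1)))"
    proof (rule integral_mono_AE')
      show "integrable M (\<lambda>\<omega>. b ^ l * (2 ^ l * (\<bar>e i \<omega>\<bar> ^ (2 * l) + 1)))"
        using integrable_abs[OF i, of "2 * l"] by auto
      show "AE \<omega> in M. \<bar>(b * ((e i \<omega>)\<^sup>2 - 1)) ^ l\<bar> \<le> b ^ l * (2 ^ l * (\<bar>e i \<omega>\<bar> ^ (2 * l) + 1))"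
      proof (rule AE_I2)
        fix \<omega>
        have "\<bar>(e i \<omega>)\<^sup>2 - 1\<bar> ^ l \<le> ((e i \<omega>)\<^sup>2 + 1) ^ l"
          by (intro power_mono) (simp_all add: abs_le_iff)
        also have "\<dots> \<le> 2 ^ l * (((e i \<omega>)\<^sup>2) ^ l + 1)"
          using power_add_le[of "(e i \<omega>)\<^sup>2" 1 l] by simp
        also have "((e i \<omega>)\<^sup>2) ^ l = \<bar>e i \<omega>\<bar> ^ (2 * l)" by (simp add: power_mult)
        finally show "\<bar>(b * ((e i \<omega>)\<^sup>2 - 1)) ^ l\<bar> \<le> b ^ l * (2 ^ l * (\<bar>e i \<omega>\<bar> ^ (2 * l) + 1))"
          using b by (simp add: power_mult_distrib abs_mult power_abs mult_left_mono)
      qed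
    qed (auto intro!: AE_I2 mult_nonneg_nonneg simp: b)
    also have "\<dots> = b ^ l * (2 ^ l * (expectation (\<lambda>\<omega>. \<bar>e i \<omega>\<bar> ^ (2 * l)) + 1))"
      using integrable_abs[OF i, of "2 * l"] by (simp add: prob_space)
    also have "\<dots> \<le> b ^ l * (2 ^ l * (Q ^ (2 * l) + Q ^ (2 * l)))"
      using moment[OF i, of "2 * l"] l Q b
      by (intro mult_left_mono add_mono one_le_power) (auto simp: Q_def)
    also have "\<dots> = 2 * (b * 2 * Q\<^sup>2) ^ l"
      by (simp add: power_mult_distrib power_mult)
    also have "\<dots> \<le> 2 ^ l * (b * 2 * Q\<^sup>2) ^ l"
      using l b self_le_power[of "2::real" l] by (intro mult_right_mono) auto
    also have "\<dots> = (b * 4 * Q\<^sup>2) ^ l"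
      unfolding power_mult_distrib[symmetric] by (simp add: mult_ac)
    also have "Q\<^sup>2 = K\<^sup>2 * (real (2 * l) * real (2 * l) powr be)"
    proof -
      have "(real (2 * l) powr (1 / alpha))\<^sup>2 = real (2 * l) powr (1 + be)"
        using l by (simp add: power2_eq_square be_def flip: powr_add)
      also have "\<dots> = real (2 * l) * real (2 * l) powr be"
        using l by (subst powr_add) auto
      finally show ?thesis by (simp add: Q_def power_mult_distrib)
    qed
    finally have 1: "\<bar>expectation (\<lambda>\<omega>. (b * ((e i \<omega>)\<^sup>2 - 1)) ^ l)\<bar>
        \<le> (8 * b * K\<^sup>2) ^ l * (real (2 * l) powr be) ^ l * real l ^ l"
      unfolding power_mult_distrib[symmetric] by (simp add: mult_ac)
    \<comment> \<open>Only l - 2 of the l factors are bounded through the truncation order; the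
      other two go into the l-th power of a constant, as 2l \<le> 2^l. So the quadratic term carries
      no power of k, which would worsen the exponent alpha/2 of the final tail.\<close>
    have 2: "(real (2 * l) powr be) ^ l \<le> (4 powr be) ^ l * (real (4 * k) powr be) ^ (l - 2)"
    proof -
      have "2 * l \<le> 2 ^ l" using l
      proof (induction l rule: dec_induct)
        case (step l)
        then show ?case by simp
      qed simp
      then have "real (2 * l) \<le> 2 ^ l" by (metis of_nat_le_iff of_nat_numeral of_nat_power)
      then have "real (2 * l) powr be \<le> (2 ^ l) powr be" using be by (intro powr_mono2) auto
      then have "(real (2 * l) powr be)\<^sup>2 \<le> ((2 ^ l) powr be)\<^sup>2" by (intro power_mono) auto
      also have "\<dots> = (4 powr be) ^ l"
        by (simp add: powr_powr[symmetric] powr_realpow[symmetric] powr_powr powr_def mult_ac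
            flip: exp_of_nat_mult)
          (simp add: ln_realpow[of 2 2, simplified])
      finally have a: "(real (2 * l) powr be)\<^sup>2 \<le> (4 powr be) ^ l" .
      have b: "(real (2 * l) powr be) ^ (l - 2) \<le> (real (4 * k) powr be) ^ (l - 2)"
        using be l by (intro power_mono powr_mono2) auto
      have "(real (2 * l) powr be) ^ l = (real (2 * l) powr be)\<^sup>2 * (real (2 * l) powr be) ^ (l - 2)"
        using power_add[of "real (2 * l) powr be" 2 "l - 2"] unfolding le_add_diff_inverse[OF l(1)] .
      also have "\<dots> \<le> (4 powr be) ^ l * (real (4 * k) powr be) ^ (l - 2)"
        using a b by (intro mult_mono) auto
      finally show ?thesis .
    qed
    have "z ^ l * \<bar>expectation (\<lambda>\<omega>. (b * ((e i \<omega>)\<^sup>2 - 1)) ^ l)\<bar> / fact l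
        \<le> z ^ l * ((8 * b * K\<^sup>2) ^ l * ((4 powr be) ^ l * (real (4 * k) powr be) ^ (l - 2)) *
            (exp 1 ^ l * fact l)) / fact l"
      using z b K
      by (intro divide_right_mono mult_left_mono order_trans[OF 1] mult_mono 2 power_self_le_exp_fact) auto
    also have "\<dots> = (z * 8 * b * K\<^sup>2 * 4 powr be * exp 1) ^ l * (real (4 * k) powr be) ^ (l - 2)"
      by (simp add: power_mult_distrib)
    also have "z * 8 * b * K\<^sup>2 * 4 powr be * exp 1 = w"
    proof -
      have "4 powr (2 / alpha) = 4 * (4 :: real) powr be"
        using powr_add[of "4::real" 1 be] by (simp add: be_def)
      then show ?thesis by (simp add: w_def K3 mult_ac)
    qed
    also have "w ^ l * (real (4 * k) powr be) ^ (l - 2) = w\<^sup>2 * (w * real (4 * k) powr be) ^ (l - 2)"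
      using power_add[of w 2 "l - 2"] unfolding le_add_diff_inverse[OF l(1)]
      by (simp add: power_mult_distrib)
    also have "\<dots> \<le> w\<^sup>2 * (1 / 2) ^ (l - 2)"
      using wk w by (intro mult_left_mono power_mono) auto
    finally show ?thesis .
  qed
  have "{..2 * k} = insert 0 (insert 1 {2..2 * k})" using k by auto
  moreover have "expectation (\<lambda>\<omega>. b * ((e i \<omega>)\<^sup>2 - 1)) = 0"
    using variance[OF i] integrable_power[OF i, of 2] by (simp add: prob_space)
  ultimately have "trunc_mgf M (2 * k) z (\<lambda>\<omega>. b * ((e i \<omega>)\<^sup>2 - 1)) = 1 +
      (\<Sum>l=2..2 * k. z ^ l * \<bar>expectation (\<lambda>\<omega>. (b * ((e i \<omega>)\<^sup>2 - 1)) ^ l)\<bar> / fact l)"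
    by (simp add: trunc_mgf_def prob_space)
  also have "\<dots> \<le> 1 + (\<Sum>l=2..2 * k. w\<^sup>2 * (1 / 2) ^ (l - 2))"
    by (intro add_left_mono sum_mono summand) auto
  also have "\<dots> \<le> 1 + w\<^sup>2 * 2"
    unfolding sum_distrib_left[symmetric]
    by (intro add_left_mono mult_left_mono geometric_half_sum_le) auto
  also have "\<dots> \<le> exp (w\<^sup>2 * 2)" by (rule exp_ge_add_one_self)
  finally show ?thesis by (simp add: w_def power_mult_distrib mult_ac)
qed

text \<open>\<open>z\<close> stays a parameter: its admissible range \<open>zk\<close> and the size
  of the exponent can be balanced only once the deviation level is known.\<close>

lemma diagonal_moment:
  assumes J: "J \<subseteq> {..<n}" and b: "\<And>i. i \<in> J \<Longrightarrow> 0 \<le> b i \<and> b i \<le> 1" and z: "0 < z" and k: "1 \<le> k"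
    and K3: "K3 = 2 * 4 powr (2 / alpha) * exp 1 * K\<^sup>2"
    and zk: "K3 * z * real (4 * k) powr (2 / alpha - 1) \<le> 1 / 2"
  shows "integrable M (\<lambda>\<omega>. (\<Sum>i\<in>J. b i * ((e i \<omega>)\<^sup>2 - 1)) ^ m)"
    and "expectation (\<lambda>\<omega>. (\<Sum>i\<in>J. b i * ((e i \<omega>)\<^sup>2 - 1)) ^ (2 * k))
      \<le> fact (2 * k) / z ^ (2 * k) * exp (2 * K3\<^sup>2 * z\<^sup>2 * (\<Sum>i\<in>J. (b i)\<^sup>2))"
proof -
  define X where "X = (\<lambda>i \<omega>. b i * ((e i \<omega>)\<^sup>2 - 1))"
  have fin: "finite J" using J finite_subset by blast
  have "indep_vars (\<lambda>_. borel) e J" using indep J by (rule indep_vars_subset)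
  then have ind: "indep_vars (\<lambda>_. borel) X J"
    unfolding X_def by (rule indep_vars_compose2) auto
  have int: "integrable M (\<lambda>\<omega>. X i \<omega> ^ m)" if i: "i \<in> J" for i m
  proof -
    have "X i \<omega> ^ m = (\<Sum>j\<le>m. b i ^ m * (real (m choose j) * (e i \<omega>) ^ (2 * j) * (-1) ^ (m - j)))" for \<omega>
      using binomial_ring[of "(e i \<omega>)\<^sup>2" "-1" m]
      by (simp add: X_def power_mult_distrib power_mult sum_distrib_left)
    then show ?thesis using integrable_power[of i] i J by auto
  qed
  note T = trunc_mgf_sum[OF fin ind int]
  show "integrable M (\<lambda>\<omega>. (\<Sum>i\<in>J. b i * ((e i \<omega>)\<^sup>2 - 1)) ^ m)"
    using T[of 0 0] by (simp add: X_def)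
  have "expectation (\<lambda>\<omega>. (\<Sum>i\<in>J. X i \<omega>) ^ (2 * k))
      \<le> fact (2 * k) / z ^ (2 * k) * trunc_mgf M (2 * k) z (\<lambda>\<omega>. \<Sum>i\<in>J. X i \<omega>)"
    using moment_le_trunc_mgf[OF z order_refl, of M "\<lambda>\<omega>. \<Sum>i\<in>J. X i \<omega>" "2 * k"] by linarith
  also have "trunc_mgf M (2 * k) z (\<lambda>\<omega>. \<Sum>i\<in>J. X i \<omega>) \<le> (\<Prod>i\<in>J. trunc_mgf M (2 * k) z (X i))"
    using T[of z "2 * k"] z by simp
  also have "\<dots> \<le> (\<Prod>i\<in>J. exp (2 * K3\<^sup>2 * z\<^sup>2 * (b i)\<^sup>2))"
    unfolding X_def using J z b k K3 zk
    by (intro prod_mono conjI trunc_mgf_nonneg trunc_mgf_square) auto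
  also have "\<dots> = exp (2 * K3\<^sup>2 * z\<^sup>2 * (\<Sum>i\<in>J. (b i)\<^sup>2))"
    using fin by (simp add: exp_sum sum_distrib_left)
  finally show "expectation (\<lambda>\<omega>. (\<Sum>i\<in>J. b i * ((e i \<omega>)\<^sup>2 - 1)) ^ (2 * k))
      \<le> fact (2 * k) / z ^ (2 * k) * exp (2 * K3\<^sup>2 * z\<^sup>2 * (\<Sum>i\<in>J. (b i)\<^sup>2))"
    using z by (simp add: X_def divide_right_mono)
qed

end

section \<open>Decoupling of quadratic forms\<close>

text \<open>Such a set is i added to an arbitrary subset of the remaining card J - 2
  elements.\<close>

lemma card_separating_subsets:
  assumes "finite J" "i \<in> J" "j \<in> J" "i \<noteq> j"
  shows "4 * card {I \<in> Pow J. i \<in> I \<and> j \<notin> I} = 2 ^ card J"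
proof -
  have eq: "{I \<in> Pow J. i \<in> I \<and> j \<notin> I} = insert i ` Pow (J - {i, j})"
  proof
    show "{I \<in> Pow J. i \<in> I \<and> j \<notin> I} \<subseteq> insert i ` Pow (J - {i, j})"
    proof
      fix I assume "I \<in> {I \<in> Pow J. i \<in> I \<and> j \<notin> I}"
      then have "I = insert i (I - {i})" "I - {i} \<in> Pow (J - {i, j})" by auto
      then show "I \<in> insert i ` Pow (J - {i, j})" by blast
    qed
  qed (use assms in auto)
  have inj: "inj_on (insert i) (Pow (J - {i, j}))"
    by (rule inj_onI) (metis Diff_iff Pow_iff insertI1 insert_ident subsetD)
  define c where "c = card (J - {i, j})"
  have "c = card J - 2" using assms by (simp add: c_def card_Diff_subset)
  moreover have "2 \<le> card J" using assms card_mono[of J "{i, j}"] by simp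
  ultimately have c: "card J = Suc (Suc c)" by simp
  have "card (Pow (J - {i, j})) = 2 ^ c" using assms by (simp add: card_Pow c_def)
  then show ?thesis
    unfolding eq card_image[OF inj] c by simp
qed

text \<open>Choosing \<open>I\<close> uniformly among the subsets of \<open>J\<close>, every off-diagonal pair is separated
  with probability \<open>1/4\<close>.\<close>

lemma decoupling_identity:
  fixes f :: "'i \<Rightarrow> 'i \<Rightarrow> real"
  assumes J: "finite J"
  shows "(\<Sum>i\<in>J. \<Sum>j\<in>J - {i}. f i j) = (\<Sum>I\<in>Pow J. 1 / 2 ^ card J * (4 * (\<Sum>i\<in>I. \<Sum>j\<in>J - I. f i j)))"
proof -
  let ?c = "\<lambda>i j. card {I \<in> Pow J. i \<in> I \<and> j \<notin> I}"
  have c: "4 * real (?c i j) = 2 ^ card J" if "i \<in> J" "j \<in> J - {i}" for i j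
  proof -
    have "4 * ?c i j = 2 ^ card J"
      using that by (intro card_separating_subsets J) auto
    then have "real (4 * ?c i j) = real (2 ^ card J)" by (rule arg_cong)
    then show ?thesis by simp
  qed
  have "(\<Sum>I\<in>Pow J. \<Sum>i\<in>I. \<Sum>j\<in>J - I. f i j) =
      (\<Sum>I\<in>Pow J. \<Sum>i\<in>J. \<Sum>j\<in>J. if i \<in> I \<and> j \<notin> I then f i j else 0)"
  proof (rule sum.cong[OF refl])
    fix I assume I: "I \<in> Pow J"
    have "(\<Sum>i\<in>J. \<Sum>j\<in>J. if i \<in> I \<and> j \<notin> I then f i j else 0)
        = (\<Sum>i\<in>J. if i \<in> I then \<Sum>j\<in>J. if j \<in> J - I then f i j else 0 else 0)"
      by (intro sum.cong) auto
    also have "\<dots> = (\<Sum>i\<in>I. \<Sum>j\<in>J. if j \<in> J - I then f i j else 0)"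
      using I J by (subst sum.inter_restrict[symmetric]) (auto simp: Int_absorb1)
    also have "\<dots> = (\<Sum>i\<in>I. \<Sum>j\<in>J - I. f i j)"
    proof (rule sum.cong[OF refl])
      fix i
      have "J \<inter> (J - I) = J - I" by auto
      then show "(\<Sum>j\<in>J. if j \<in> J - I then f i j else 0) = (\<Sum>j\<in>J - I. f i j)"
        using sum.inter_restrict[OF J, of "f i" "J - I"] by simp
    qed
    finally show "(\<Sum>i\<in>I. \<Sum>j\<in>J - I. f i j) =
        (\<Sum>i\<in>J. \<Sum>j\<in>J. if i \<in> I \<and> j \<notin> I then f i j else 0)" by simp
  qed
  also have "\<dots> = (\<Sum>i\<in>J. \<Sum>I\<in>Pow J. \<Sum>j\<in>J. if i \<in> I \<and> j \<notin> I then f i j else 0)"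
    by (rule sum.swap)
  also have "\<dots> = (\<Sum>i\<in>J. \<Sum>j\<in>J. \<Sum>I\<in>Pow J. if i \<in> I \<and> j \<notin> I then f i j else 0)"
    by (intro sum.cong refl sum.swap)
  also have "\<dots> = (\<Sum>i\<in>J. \<Sum>j\<in>J. real (?c i j) * f i j)"
    using J by (intro sum.cong refl) (simp add: sum.inter_filter[symmetric])
  also have "\<dots> = (\<Sum>i\<in>J. \<Sum>j\<in>J - {i}. real (?c i j) * f i j)"
  proof (rule sum.cong[OF refl])
    fix i
    show "(\<Sum>j\<in>J. real (?c i j) * f i j) = (\<Sum>j\<in>J - {i}. real (?c i j) * f i j)"
    proof (rule sum.mono_neutral_right[OF J], force, rule ballI)
      \<comment> \<open>Here j = i, and no set both contains and omits i.\<close>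
      fix j assume "j \<in> J - (J - {i})"
      then have "{I \<in> Pow J. i \<in> I \<and> j \<notin> I} = {}" by auto
      then have "?c i j = 0" by (simp only: card.empty)
      then show "real (?c i j) * f i j = 0" by (simp only: of_nat_0 mult_zero_left)
    qed
  qed
  finally have eq: "(\<Sum>I\<in>Pow J. \<Sum>i\<in>I. \<Sum>j\<in>J - I. f i j) =
      (\<Sum>i\<in>J. \<Sum>j\<in>J - {i}. real (?c i j) * f i j)" .
  have "(\<Sum>I\<in>Pow J. 1 / 2 ^ card J * (4 * (\<Sum>i\<in>I. \<Sum>j\<in>J - I. f i j))) =
      1 / 2 ^ card J * (4 * (\<Sum>I\<in>Pow J. \<Sum>i\<in>I. \<Sum>j\<in>J - I. f i j))"
    by (simp only: sum_distrib_left)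
  also have "\<dots> = (\<Sum>i\<in>J. \<Sum>j\<in>J - {i}. 1 / 2 ^ card J * (4 * real (?c i j)) * f i j)"
    unfolding eq by (simp only: sum_distrib_left mult.assoc)
  also have "\<dots> = (\<Sum>i\<in>J. \<Sum>j\<in>J - {i}. f i j)"
    by (intro sum.cong refl) (simp only: c, simp)
  finally show ?thesis by simp
qed

lemma power_sum_le:
  fixes y :: "'i \<Rightarrow> real"
  assumes "finite A" "\<And>i. i \<in> A \<Longrightarrow> 0 \<le> y i" "0 < m"
  shows "(\<Sum>i\<in>A. y i) ^ m \<le> real (card A) ^ m * (\<Sum>i\<in>A. y i ^ m)"
proof (cases "A = {}")
  case True
  then show ?thesis using assms by (simp add: zero_power)
next
  case False
  then obtain i where i: "i \<in> A" "\<And>j. j \<in> A \<Longrightarrow> y j \<le> y i"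
    using obtains_MAX[OF assms(1) False, of y] by (metis Max_ge assms(1) finite_imageI imageI)
  have "(\<Sum>i\<in>A. y i) \<le> real (card A) * y i" using i by (intro sum_bounded_above) auto
  then have "(\<Sum>i\<in>A. y i) ^ m \<le> (real (card A) * y i) ^ m"
    using assms by (intro power_mono sum_nonneg) auto
  also have "\<dots> = real (card A) ^ m * y i ^ m" by (rule power_mult_distrib)
  also have "y i ^ m \<le> (\<Sum>i\<in>A. y i ^ m)" using i assms by (intro member_le_sum) auto
  finally show ?thesis by (simp add: mult_left_mono)
qed

text \<open>Nonnegativity of the variance.\<close>

lemma (in prob_space) square_expectation_le:
  fixes X :: "'a \<Rightarrow> real"
  assumes "integrable M X" "integrable M (\<lambda>x. (X x)\<^sup>2)"
  shows "(expectation X)\<^sup>2 \<le> expectation (\<lambda>x. (X x)\<^sup>2)"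
  using variance_eq[OF assms] variance_positive[of X] by simp

section \<open>Quadratic forms of a projection matrix, restricted to coordinate sets\<close>

locale projection_matrix =
  fixes n :: nat and Q :: "nat \<Rightarrow> nat \<Rightarrow> real"
  assumes sym: "\<And>i j. i < n \<Longrightarrow> j < n \<Longrightarrow> Q i j = Q j i"
    and idem: "\<And>i k. i < n \<Longrightarrow> k < n \<Longrightarrow> (\<Sum>j<n. Q i j * Q j k) = Q i k"
begin

text \<open>\<open>J\<close> restricts the argument rather than the matrix. A principal submatrix of
  a projection need not be idempotent, but the restricted form is still the squared norm of a
  projected vector.\<close>

definition qform :: "nat set \<Rightarrow> (nat \<Rightarrow> real) \<Rightarrow> real" where
  "qform J x = (\<Sum>i\<in>J. \<Sum>j\<in>J. Q i j * x i * x j)"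

definition qdiag :: "nat set \<Rightarrow> (nat \<Rightarrow> real) \<Rightarrow> real" where
  "qdiag J x = (\<Sum>i\<in>J. Q i i * ((x i)\<^sup>2 - 1))"

definition qoff :: "nat set \<Rightarrow> (nat \<Rightarrow> real) \<Rightarrow> real" where
  "qoff J x = (\<Sum>i\<in>J. \<Sum>j\<in>J - {i}. Q i j * x i * x j)"

definition qcross :: "nat set \<Rightarrow> nat set \<Rightarrow> (nat \<Rightarrow> real) \<Rightarrow> real" where
  "qcross I J x = (\<Sum>i\<in>I. \<Sum>j\<in>J - I. Q i j * x i * x j)"

definition qtrace :: "nat set \<Rightarrow> real" where
  "qtrace J = (\<Sum>i\<in>J. Q i i)"

text \<open>By symmetry and idempotence Q i i is the squared norm of row i, and this sum contains
  the square of Q i i itself.\<close>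

lemma diag_bounds:
  assumes "i < n"
  shows "0 \<le> Q i i" "Q i i \<le> 1"
proof -
  have eq: "Q i i = (\<Sum>j<n. (Q i j)\<^sup>2)"
    using idem[OF assms assms] sym[OF assms] by (simp add: power2_eq_square)
  show nn: "0 \<le> Q i i" unfolding eq by (rule sum_nonneg) simp
  have "(Q i i)\<^sup>2 \<le> Q i i"
    by (subst (2) eq, rule member_le_sum[of i "{..<n}" "\<lambda>j. (Q i j)\<^sup>2"]) (use assms in auto)
  then show "Q i i \<le> 1" using nn by (cases "Q i i = 0") (auto simp: power2_eq_square)
qed

lemma qtrace_bounds:
  assumes "J \<subseteq> {..<n}"
  shows "0 \<le> qtrace J" "qtrace J \<le> qtrace {..<n}"
  using assms diag_bounds by (auto simp: qtrace_def intro!: sum_nonneg sum_mono2)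

lemma qform_eq:
  assumes "J \<subseteq> {..<n}"
  shows "qform J x = qtrace J + qdiag J x + qoff J x"
proof -
  have J: "finite J" using assms finite_subset by blast
  have "qform J x = (\<Sum>i\<in>J. Q i i * x i * x i + (\<Sum>j\<in>J - {i}. Q i j * x i * x j))"
    unfolding qform_def using J by (intro sum.cong refl sum.remove) auto
  also have "\<dots> = (\<Sum>i\<in>J. Q i i * x i * x i) + qoff J x"
    by (simp add: qoff_def sum.distrib)
  also have "(\<Sum>i\<in>J. Q i i * x i * x i) = qtrace J + qdiag J x"
    by (simp add: qtrace_def qdiag_def sum.distrib[symmetric] power2_eq_square algebra_simps)
  finally show ?thesis .
qed

text \<open>The outer sum still runs over all coordinates, so idempotence of the full matrix applies
  to the vector that is set to 0 outside \<open>J\<close>.\<close>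

lemma qform_eq_norm:
  assumes "J \<subseteq> {..<n}"
  shows "qform J x = (\<Sum>i<n. (\<Sum>j\<in>J. Q i j * x j)\<^sup>2)"
proof -
  have "(\<Sum>i<n. (\<Sum>j\<in>J. Q i j * x j)\<^sup>2) = (\<Sum>i<n. \<Sum>j\<in>J. \<Sum>k\<in>J. Q j i * Q i k * x j * x k)"
    unfolding power2_eq_square sum_product using assms sym
    by (intro sum.cong refl) (auto simp: subset_iff mult_ac)
  also have "\<dots> = (\<Sum>j\<in>J. \<Sum>i<n. \<Sum>k\<in>J. Q j i * Q i k * x j * x k)"
    by (rule sum.swap)
  also have "\<dots> = (\<Sum>j\<in>J. \<Sum>k\<in>J. \<Sum>i<n. Q j i * Q i k * x j * x k)"
    by (intro sum.cong refl sum.swap)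
  also have "\<dots> = (\<Sum>j\<in>J. \<Sum>k\<in>J. Q j k * x j * x k)"
    using assms idem by (intro sum.cong refl) (auto simp: sum_distrib_right[symmetric] subset_iff)
  finally show ?thesis by (simp add: qform_def)
qed

lemma qform_nonneg: "J \<subseteq> {..<n} \<Longrightarrow> 0 \<le> qform J x"
  by (simp add: qform_eq_norm sum_nonneg)

text \<open>Jensen's inequality for an even power, under the uniform choice of \<open>I\<close> in
  the decoupling identity. The 4 is the inverse of the separation probability.\<close>

lemma qoff_power_le:
  assumes "finite J"
  shows "qoff J x ^ (2 * k) \<le> (\<Sum>I\<in>Pow J. 1 / 2 ^ card J * (4 * qcross I J x) ^ (2 * k))"
proof -
  have "qoff J x = (\<Sum>I\<in>Pow J. (1 / 2 ^ card J) *\<^sub>R (4 * qcross I J x))"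
    unfolding qoff_def qcross_def by (simp only: real_scaleR_def decoupling_identity[OF assms])
  moreover have "(\<Sum>I\<in>Pow J. 1 / 2 ^ card J * (4 * qcross I J x) ^ (2 * k)) \<ge>
      (\<Sum>I\<in>Pow J. (1 / 2 ^ card J) *\<^sub>R (4 * qcross I J x)) ^ (2 * k)"
    using assms by (intro convex_on_sum[where C = UNIV] convex_power_even) (auto simp: card_Pow)
  ultimately show ?thesis by simp
qed

end

section \<open>Moments of quadratic forms in the noise\<close>

locale weibull_quadratic = weibull_noise M n e alpha K + projection_matrix n Q
  for M :: "'a measure" and n e alpha K Q
begin

abbreviation noise :: "'a \<Rightarrow> nat \<Rightarrow> real" where
  "noise \<omega> \<equiv> (\<lambda>i. e i \<omega>)"

abbreviation lin_const :: "nat \<Rightarrow> real" where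
  "lin_const k \<equiv> 6 * exp 3 * K\<^sup>2 * real (2 * k) powr (2 / alpha)"

lemma integrable_qform_power:
  assumes J: "J \<subseteq> {..<n}"
  shows "integrable M (\<lambda>\<omega>. qform J (noise \<omega>) ^ m)"
proof (cases "m = 0")
  case False
  show ?thesis
  proof (rule Bochner_Integration.integrable_bound)
    have "integrable M (\<lambda>\<omega>. (\<Sum>j\<in>J. Q i j * e j \<omega>) ^ (2 * m))" for i
      by (rule linear_moment(1)[OF J order_refl])
    then show "integrable M (\<lambda>\<omega>. real n ^ m * (\<Sum>i<n. (\<Sum>j\<in>J. Q i j * e j \<omega>) ^ (2 * m)))"
      by auto
    show "(\<lambda>\<omega>. qform J (noise \<omega>) ^ m) \<in> borel_measurable M"
      unfolding qform_def using J by (auto intro!: borel_measurable_power borel_measurable_sum borel_measurable_times)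
    have "qform J (noise \<omega>) ^ m \<le> real n ^ m * (\<Sum>i<n. (\<Sum>j\<in>J. Q i j * e j \<omega>) ^ (2 * m))" for \<omega>
      using power_sum_le[of "{..<n}" "\<lambda>i. (\<Sum>j\<in>J. Q i j * e j \<omega>)\<^sup>2" m] False
      by (simp add: qform_eq_norm[OF J] power_mult)
    then show "AE \<omega> in M. norm (qform J (noise \<omega>) ^ m)
        \<le> norm (real n ^ m * (\<Sum>i<n. (\<Sum>j\<in>J. Q i j * e j \<omega>) ^ (2 * m)))"
      using qform_nonneg[OF J] by (intro AE_I2) (auto simp: abs_of_nonneg sum_nonneg)
  qed
qed simp

text \<open>Given the noise outside \<open>I\<close>, the cross term is a linear form in the noise on \<open>I\<close>, whose
  coefficient vector is bounded by the projected noise outside \<open>I\<close>.\<close>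

lemma qcross_moment:
  assumes J: "J \<subseteq> {..<n}" and I: "I \<subseteq> J" and k: "1 \<le> k"
  shows "integrable M (\<lambda>\<omega>. qcross I J (noise \<omega>) ^ (2 * k))"
    and "expectation (\<lambda>\<omega>. qcross I J (noise \<omega>) ^ (2 * k))
      \<le> lin_const k ^ k * expectation (\<lambda>\<omega>. qform (J - I) (noise \<omega>) ^ k)"
proof -
  define L where "L = J - I"
  define g where "g = lin_const k"
  have g: "0 \<le> g" by (simp add: g_def)
  have In: "I \<subseteq> {..<n}" and Ln: "L \<subseteq> {..<n}" using I J by (auto simp: L_def)
  define PI where "PI = PiM I (\<lambda>_. borel :: real measure)"
  define PL where "PL = PiM L (\<lambda>_. borel :: real measure)"
  define X where "X = (\<lambda>\<omega>. restrict (noise \<omega>) I)"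
  define Y where "Y = (\<lambda>\<omega>. restrict (noise \<omega>) L)"
  \<comment> \<open>Disjoint blocks of coordinates are independent, so the joint law of
    \<open>Y\<close> and \<open>X\<close> is a product and Tonelli's theorem applies.\<close>
  have ind: "indep_var PL Y PI X"
    unfolding X_def Y_def PI_def PL_def using In Ln
    by (intro indep_var_restrict[OF indep]) (auto simp: L_def)
  have mX[measurable]: "X \<in> measurable M PI" and mY[measurable]: "Y \<in> measurable M PL"
    using indep_var_rv1[OF ind] indep_var_rv2[OF ind] by auto
  interpret NI: prob_space "distr M PI X" by (rule prob_space_distr) simp
  define h where "h = (\<lambda>y x. (\<Sum>i\<in>I. (\<Sum>j\<in>L. Q i j * y j) * x i) ^ (2 * k))"
  have cI[measurable]: "(\<lambda>x. x i) \<in> borel_measurable PI" if "i \<in> I" for i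
    unfolding PI_def using that by measurable
  have cL[measurable]: "(\<lambda>x. x i) \<in> borel_measurable PL" if "i \<in> L" for i
    unfolding PL_def using that by measurable
  have mh: "(\<lambda>(y, x). ennreal (h y x)) \<in> borel_measurable (PL \<Otimes>\<^sub>M PI)"
    unfolding h_def case_prod_beta
    by (intro measurable_compose[OF _ measurable_ennreal] borel_measurable_power borel_measurable_sum
        borel_measurable_times measurable_compose[OF measurable_fst] measurable_compose[OF measurable_snd] cI cL) auto
  have mhx: "(\<lambda>x. ennreal (h y x)) \<in> borel_measurable PI" for y
    unfolding h_def by (intro measurable_compose[OF _ measurable_ennreal] borel_measurable_power
        borel_measurable_sum borel_measurable_times cI) auto
  have mq: "(\<lambda>y. ennreal (g ^ k * qform L y ^ k)) \<in> borel_measurable PL"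
    unfolding qform_def by (intro measurable_compose[OF _ measurable_ennreal] borel_measurable_power
        borel_measurable_sum borel_measurable_times cL) auto
  have inner: "(\<integral>\<^sup>+x. ennreal (h y x) \<partial>distr M PI X) \<le> ennreal (g ^ k * qform L y ^ k)" for y
  proof -
    define a where "a = (\<lambda>i. \<Sum>j\<in>L. Q i j * y j)"
    have "(\<integral>\<^sup>+x. ennreal (h y x) \<partial>distr M PI X) = (\<integral>\<^sup>+\<omega>. ennreal (h y (X \<omega>)) \<partial>M)"
      by (rule nn_integral_distr[OF mX]) (simp add: mhx)
    also have "\<dots> = (\<integral>\<^sup>+\<omega>. ennreal ((\<Sum>i\<in>I. a i * e i \<omega>) ^ (2 * k)) \<partial>M)"
      by (simp add: h_def X_def a_def)
    also have "\<dots> = ennreal (expectation (\<lambda>\<omega>. (\<Sum>i\<in>I. a i * e i \<omega>) ^ (2 * k)))"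
      by (intro nn_integral_eq_integral linear_moment(1)[OF In k]) auto
    also have "\<dots> \<le> ennreal (g ^ k * (\<Sum>i\<in>I. (a i)\<^sup>2) ^ k)"
      unfolding g_def by (intro ennreal_leI linear_moment(2)[OF In k])
    \<comment> \<open>Extending the sum of squared coefficients from \<open>I\<close> to all rows
      gives the full projected norm.\<close>
    also have "\<dots> \<le> ennreal (g ^ k * qform L y ^ k)"
      unfolding qform_eq_norm[OF Ln] a_def using In g
      by (intro ennreal_leI mult_left_mono power_mono sum_mono2 sum_nonneg) auto
    finally show ?thesis .
  qed
  have "(\<integral>\<^sup>+\<omega>. ennreal (qcross I J (noise \<omega>) ^ (2 * k)) \<partial>M) = (\<integral>\<^sup>+\<omega>. ennreal (h (Y \<omega>) (X \<omega>)) \<partial>M)"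
  proof -
    have "qcross I J (noise \<omega>) ^ (2 * k) = h (Y \<omega>) (X \<omega>)" for \<omega>
    proof -
      have "qcross I J (noise \<omega>) = (\<Sum>i\<in>I. (\<Sum>j\<in>L. Q i j * Y \<omega> j) * X \<omega> i)"
        unfolding qcross_def L_def[symmetric] sum_distrib_right
        by (intro sum.cong refl) (auto simp: X_def Y_def)
      then show ?thesis by (simp add: h_def)
    qed
    then show ?thesis by simp
  qed
  also have "\<dots> = (\<integral>\<^sup>+p. (case p of (y, x) \<Rightarrow> ennreal (h y x)) \<partial>distr M (PL \<Otimes>\<^sub>M PI) (\<lambda>\<omega>. (Y \<omega>, X \<omega>)))"
    by (subst nn_integral_distr) (use mh in auto)
  also have "distr M (PL \<Otimes>\<^sub>M PI) (\<lambda>\<omega>. (Y \<omega>, X \<omega>)) = distr M PL Y \<Otimes>\<^sub>M distr M PI X"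
    using indep_var_distribution_eq[of PL Y PI X] ind by simp
  also have "(\<integral>\<^sup>+p. (case p of (y, x) \<Rightarrow> ennreal (h y x)) \<partial>(distr M PL Y \<Otimes>\<^sub>M distr M PI X))
      = (\<integral>\<^sup>+y. \<integral>\<^sup>+x. ennreal (h y x) \<partial>distr M PI X \<partial>distr M PL Y)"
    using mh by (subst NI.nn_integral_fst[symmetric]) (auto simp: measurable_distr_eq1 cong: measurable_cong_sets)
  also have "\<dots> \<le> (\<integral>\<^sup>+y. ennreal (g ^ k * qform L y ^ k) \<partial>distr M PL Y)"
    by (intro nn_integral_mono inner)
  also have "\<dots> = (\<integral>\<^sup>+\<omega>. ennreal (g ^ k * qform L (Y \<omega>) ^ k) \<partial>M)"
    by (rule nn_integral_distr[OF mY]) (simp add: mq)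
  also have "\<dots> = (\<integral>\<^sup>+\<omega>. ennreal (g ^ k * qform L (noise \<omega>) ^ k) \<partial>M)"
    by (simp add: qform_def Y_def)
  also have "\<dots> = ennreal (expectation (\<lambda>\<omega>. g ^ k * qform L (noise \<omega>) ^ k))"
    using integrable_qform_power[OF Ln, of k] qform_nonneg[OF Ln] g
    by (intro nn_integral_eq_integral) auto
  \<comment> \<open>This bound between nonnegative integrals precedes the integrability of the cross
    term, which then follows from finiteness of the right-hand side.\<close>
  finally have le: "(\<integral>\<^sup>+\<omega>. ennreal (qcross I J (noise \<omega>) ^ (2 * k)) \<partial>M)
      \<le> ennreal (g ^ k * expectation (\<lambda>\<omega>. qform L (noise \<omega>) ^ k))" by simp
  have meas: "(\<lambda>\<omega>. qcross I J (noise \<omega>) ^ (2 * k)) \<in> borel_measurable M"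
    unfolding qcross_def using In J
    by (intro borel_measurable_power borel_measurable_sum borel_measurable_times measurable_e) auto
  show int: "integrable M (\<lambda>\<omega>. qcross I J (noise \<omega>) ^ (2 * k))"
  proof (rule integrableI_bounded[OF meas])
    have "(\<integral>\<^sup>+\<omega>. ennreal (norm (qcross I J (noise \<omega>) ^ (2 * k))) \<partial>M)
        = (\<integral>\<^sup>+\<omega>. ennreal (qcross I J (noise \<omega>) ^ (2 * k)) \<partial>M)"
      by simp
    also have "\<dots> < \<infinity>" using le by (simp add: le_less_trans)
    finally show "(\<integral>\<^sup>+\<omega>. ennreal (norm (qcross I J (noise \<omega>) ^ (2 * k))) \<partial>M) < \<infinity>" .
  qed
  have "0 \<le> expectation (\<lambda>\<omega>. qform L (noise \<omega>) ^ k)"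
    using qform_nonneg[OF Ln] by (intro integral_nonneg_AE) auto
  then have "0 \<le> g ^ k * expectation (\<lambda>\<omega>. qform L (noise \<omega>) ^ k)" using g by simp
  moreover have "ennreal (expectation (\<lambda>\<omega>. qcross I J (noise \<omega>) ^ (2 * k)))
      \<le> ennreal (g ^ k * expectation (\<lambda>\<omega>. qform L (noise \<omega>) ^ k))"
    using le nn_integral_eq_integral[OF int] by simp
  ultimately show "expectation (\<lambda>\<omega>. qcross I J (noise \<omega>) ^ (2 * k))
      \<le> lin_const k ^ k * expectation (\<lambda>\<omega>. qform (J - I) (noise \<omega>) ^ k)"
    by (simp add: ennreal_le_iff g_def L_def)
qed

text \<open>By Cauchy-Schwarz the moment of order k of a restricted form is at most the root of its
  moment of order 2k; this square root is what later lets the inequality close. \<open>U\<close>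
  covers all subsets of \<open>J\<close> because decoupling removes an arbitrary
  \<open>I\<close>.\<close>

lemma qoff_moment:
  assumes J: "J \<subseteq> {..<n}" and k: "1 \<le> k"
    and U: "\<And>L. L \<subseteq> J \<Longrightarrow> expectation (\<lambda>\<omega>. qform L (noise \<omega>) ^ (2 * k)) \<le> U"
  shows "integrable M (\<lambda>\<omega>. qoff J (noise \<omega>) ^ (2 * k))"
    and "expectation (\<lambda>\<omega>. qoff J (noise \<omega>) ^ (2 * k)) \<le> 4 ^ (2 * k) * lin_const k ^ k * sqrt U"
proof -
  have fin: "finite J" using J finite_subset by blast
  let ?R = "\<lambda>\<omega>. \<Sum>I\<in>Pow J. 1 / 2 ^ card J * (4 * qcross I J (noise \<omega>)) ^ (2 * k)"
  have int: "integrable M (\<lambda>\<omega>. (4 * qcross I J (noise \<omega>)) ^ (2 * k))" if "I \<in> Pow J" for I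
    using qcross_moment(1)[OF J _ k, of I] that by (simp add: power_mult_distrib)
  have intI: "integrable M (\<lambda>\<omega>. 1 / 2 ^ card J * (4 * qcross I J (noise \<omega>)) ^ (2 * k))"
    if "I \<in> Pow J" for I
    by (intro integrable_mult_right int that)
  have intR: "integrable M ?R"
    by (intro Bochner_Integration.integrable_sum intI)
  have meas: "(\<lambda>\<omega>. qoff J (noise \<omega>) ^ (2 * k)) \<in> borel_measurable M"
    unfolding qoff_def using J
    by (intro borel_measurable_power borel_measurable_sum borel_measurable_times measurable_e) auto
  have le: "qoff J (noise \<omega>) ^ (2 * k) \<le> ?R \<omega>" for \<omega> by (rule qoff_power_le[OF fin])
  show intO: "integrable M (\<lambda>\<omega>. qoff J (noise \<omega>) ^ (2 * k))"
    by (rule Bochner_Integration.integrable_bound[OF intR meas])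
      (use le in \<open>auto intro!: AE_I2 intro: order_trans[OF _ abs_ge_self]\<close>)
  have cross: "expectation (\<lambda>\<omega>. (4 * qcross I J (noise \<omega>)) ^ (2 * k))
      \<le> 4 ^ (2 * k) * lin_const k ^ k * sqrt U" if I: "I \<in> Pow J" for I
  proof -
    have L: "J - I \<subseteq> {..<n}" using J by auto
    have "(expectation (\<lambda>\<omega>. qform (J - I) (noise \<omega>) ^ k))\<^sup>2
        \<le> expectation (\<lambda>\<omega>. (qform (J - I) (noise \<omega>) ^ k)\<^sup>2)"
      using integrable_qform_power[OF L, of "k * 2"]
      by (intro square_expectation_le integrable_qform_power[OF L]) (simp add: power_mult)
    also have "\<dots> \<le> U" using U[of "J - I"] by (simp add: power_mult[symmetric] mult.commute)
    finally have q: "expectation (\<lambda>\<omega>. qform (J - I) (noise \<omega>) ^ k) \<le> sqrt U"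
      by (rule real_le_rsqrt)
    have "expectation (\<lambda>\<omega>. (4 * qcross I J (noise \<omega>)) ^ (2 * k))
        = 4 ^ (2 * k) * expectation (\<lambda>\<omega>. qcross I J (noise \<omega>) ^ (2 * k))"
      by (simp add: power_mult_distrib)
    also have "\<dots> \<le> 4 ^ (2 * k) * (lin_const k ^ k * expectation (\<lambda>\<omega>. qform (J - I) (noise \<omega>) ^ k))"
      using I by (intro mult_left_mono qcross_moment(2)[OF J _ k]) auto
    also have "\<dots> \<le> 4 ^ (2 * k) * (lin_const k ^ k * sqrt U)"
      using q by (intro mult_left_mono) auto
    finally show ?thesis by (simp only: mult.assoc)
  qed
  have "expectation (\<lambda>\<omega>. qoff J (noise \<omega>) ^ (2 * k)) \<le> expectation ?R"
    by (rule integral_mono[OF intO intR le])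
  also have "\<dots> = (\<Sum>I\<in>Pow J. 1 / 2 ^ card J * expectation (\<lambda>\<omega>. (4 * qcross I J (noise \<omega>)) ^ (2 * k)))"
    by (subst Bochner_Integration.integral_sum[OF intI]) simp_all
  also have "\<dots> \<le> (\<Sum>I\<in>Pow J. 1 / 2 ^ card J * (4 ^ (2 * k) * lin_const k ^ k * sqrt U))"
    by (intro sum_mono mult_left_mono cross) auto
  also have "\<dots> = 4 ^ (2 * k) * lin_const k ^ k * sqrt U"
    using fin by (simp add: card_Pow)
  finally show "expectation (\<lambda>\<omega>. qoff J (noise \<omega>) ^ (2 * k)) \<le> 4 ^ (2 * k) * lin_const k ^ k * sqrt U" .
qed

end

section \<open>Tails of projected noise\<close>

lemma power_add3_le:
  fixes a b c :: real
  shows "(a + b + c) ^ (2 * k) \<le> 3 ^ (2 * k) * (a ^ (2 * k) + b ^ (2 * k) + c ^ (2 * k))"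
proof -
  define m where "m = max \<bar>a\<bar> (max \<bar>b\<bar> \<bar>c\<bar>)"
  have "\<bar>a + b + c\<bar> \<le> 3 * m" by (simp add: m_def)
  then have "\<bar>a + b + c\<bar> ^ (2 * k) \<le> (3 * m) ^ (2 * k)" by (intro power_mono) auto
  then have "(a + b + c) ^ (2 * k) \<le> 3 ^ (2 * k) * m ^ (2 * k)"
    by (simp only: power_even_abs even_mult_iff even_numeral simp_thms power_mult_distrib)
  moreover have "m = \<bar>a\<bar> \<or> m = \<bar>b\<bar> \<or> m = \<bar>c\<bar>" by (auto simp: m_def max_def)
  then have "m ^ (2 * k) = a ^ (2 * k) \<or> m ^ (2 * k) = b ^ (2 * k) \<or> m ^ (2 * k) = c ^ (2 * k)"
    by (auto simp only: power_even_abs even_mult_iff even_numeral simp_thms)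
  then have "m ^ (2 * k) \<le> a ^ (2 * k) + b ^ (2 * k) + c ^ (2 * k)"
    using zero_le_even_power'[of a k] zero_le_even_power'[of b k] zero_le_even_power'[of c k] by auto
  ultimately show ?thesis by (meson mult_left_mono order_trans zero_le_numeral zero_le_power)
qed

text \<open>Closes the moment inequality: b will be the normalised root of the largest moment, which
  is bounded by an expression linear in b.\<close>

lemma self_bound:
  fixes b T :: real
  assumes "b\<^sup>2 \<le> 2 * T\<^sup>2 + b" "1 \<le> T"
  shows "b \<le> 2 * T"
proof (rule ccontr)
  assume "\<not> b \<le> 2 * T"
  then have "2 * T * (2 * T - 1) < b * (b - 1)" using assms by (intro mult_strict_mono) auto
  moreover have "2 * T * T \<le> 2 * T * (2 * T - 1)" using assms by (intro mult_left_mono) auto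
  ultimately have "2 * T * T < b * (b - 1)" by simp
  then show False using assms by (simp add: power2_eq_square algebra_simps)
qed

context weibull_quadratic
begin

text \<open>The deviation \<open>s\<close> must dominate both the trace and a multiple of
  k^(2/alpha). \<open>H\<close> collects three demands: a diagonal exponent of at most 2k, an
  admissible z, and a linear-form constant of at most d^2 * s. \<open>B\<close> makes the diagonal
  part of size d * s in the norm of order 2k, and \<open>d\<close> is small enough for the last
  Markov step to gain a factor e per order.\<close>

lemma qform_tail_moment:
  assumes k: "1 \<le> k" and d: "d = 1 / (48 * exp 1)"
    and K3: "K3 = 2 * 4 powr (2 / alpha) * exp 1 * K\<^sup>2" and B: "B = 2 * exp 1 / d"
    and H: "H = K3\<^sup>2 * B\<^sup>2 + 2 * K3 * B + 6 * exp 3 * K\<^sup>2 / d\<^sup>2"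
    and s: "H * real (4 * k) powr (2 / alpha) \<le> s" and r: "qtrace {..<n} \<le> s"
  shows "prob {\<omega> \<in> space M. qtrace {..<n} + s \<le> qform {..<n} (noise \<omega>)} \<le> exp (- 2 * real k)"
proof -
  define p where "p = real (4 * k) powr (2 / alpha)"
  have d0: "0 < d" by (simp add: d)
  have K30: "0 < K3" using K by (simp add: K3)
  have B0: "0 < B" using d0 by (simp add: B)
  \<comment> \<open>Here alpha \<le> 2 enters: p is at least linear in k, which keeps the exponent
    in the diagonal moment under control.\<close>
  have "real (4 * k) powr 1 \<le> p"
    unfolding p_def using k alpha by (intro powr_mono) (auto simp: field_simps)
  then have kp: "4 * real k \<le> p" using k by simp
  then have p0: "0 < p" using k by simp
  have H1: "K3\<^sup>2 * B\<^sup>2 * p \<le> s" "2 * K3 * B * p \<le> s" "6 * exp 3 * K\<^sup>2 / d\<^sup>2 * p \<le> s"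
  proof -
    have "0 \<le> K3\<^sup>2 * B\<^sup>2 * p" "0 \<le> 2 * K3 * B * p" "0 \<le> 6 * exp 3 * K\<^sup>2 / d\<^sup>2 * p"
      using K30 B0 p0 by auto
    then show "K3\<^sup>2 * B\<^sup>2 * p \<le> s" "2 * K3 * B * p \<le> s" "6 * exp 3 * K\<^sup>2 / d\<^sup>2 * p \<le> s"
      using s[folded p_def] unfolding H distrib_right by linarith+
  qed
  have "0 < 2 * K3 * B * p" using K30 B0 p0 by simp
  then have s0: "0 < s" using H1(2) by linarith
  have lin: "lin_const k \<le> d\<^sup>2 * s"
  proof -
    have "real (2 * k) powr (2 / alpha) \<le> p"
      unfolding p_def using alpha by (intro powr_mono2) auto
    then have "lin_const k \<le> 6 * exp 3 * K\<^sup>2 * p" by (intro mult_left_mono) auto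
    also have "\<dots> \<le> d\<^sup>2 * s" using H1(3) d0 by (simp add: field_simps)
    finally show ?thesis .
  qed
  define z where "z = B * real k / s"
  have z0: "0 < z" using B0 k s0 by (simp add: z_def)
  have zk: "K3 * z * real (4 * k) powr (2 / alpha - 1) \<le> 1 / 2"
  proof -
    have "real (4 * k) * real (4 * k) powr (2 / alpha - 1) = p"
      using k powr_add[of "real (4 * k)" 1 "2 / alpha - 1"] by (simp add: p_def)
    then have eq: "real k * real (4 * k) powr (2 / alpha - 1) = p / 4" by simp
    have "K3 * z * real (4 * k) powr (2 / alpha - 1)
        = K3 * B * (real k * real (4 * k) powr (2 / alpha - 1)) / s"
      by (simp add: z_def)
    also have "\<dots> = K3 * B * p / (4 * s)" unfolding eq by simp
    also have "\<dots> \<le> 1 / 2" using H1(2) s0 \<open>0 < 2 * K3 * B * p\<close> by (simp add: field_simps)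
    finally show ?thesis .
  qed
  have diag: "integrable M (\<lambda>\<omega>. qdiag J (noise \<omega>) ^ (2 * k))"
    "expectation (\<lambda>\<omega>. qdiag J (noise \<omega>) ^ (2 * k)) \<le> (d * s) ^ (2 * k)" if J: "J \<subseteq> {..<n}" for J
  proof -
    have b: "0 \<le> Q i i \<and> Q i i \<le> 1" if "i \<in> J" for i using diag_bounds[of i] that J by auto
    show "integrable M (\<lambda>\<omega>. qdiag J (noise \<omega>) ^ (2 * k))"
      unfolding qdiag_def by (rule diagonal_moment(1)[OF J b z0 k K3 zk])
    have "(\<Sum>i\<in>J. (Q i i)\<^sup>2) \<le> qtrace J"
      unfolding qtrace_def power2_eq_square using b by (intro sum_mono mult_left_le) auto
    also have "\<dots> \<le> s" using qtrace_bounds[OF J] r by simp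
    finally have "2 * K3\<^sup>2 * z\<^sup>2 * (\<Sum>i\<in>J. (Q i i)\<^sup>2) \<le> 2 * K3\<^sup>2 * z\<^sup>2 * s" by (intro mult_left_mono) auto
    also have "\<dots> = 2 * real k * (K3\<^sup>2 * B\<^sup>2 * real k / s)"
      using s0 by (simp add: z_def field_simps power2_eq_square)
    also have "\<dots> \<le> 2 * real k * 1"
    proof (rule mult_left_mono)
      have "K3\<^sup>2 * B\<^sup>2 * real k \<le> K3\<^sup>2 * B\<^sup>2 * p" using kp k by (intro mult_left_mono) auto
      also have "\<dots> \<le> s" by (rule H1(1))
      finally show "K3\<^sup>2 * B\<^sup>2 * real k / s \<le> 1" using s0 by simp
    qed simp
    finally have ex: "2 * K3\<^sup>2 * z\<^sup>2 * (\<Sum>i\<in>J. (Q i i)\<^sup>2) \<le> real (2 * k)" by simp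
    have "expectation (\<lambda>\<omega>. qdiag J (noise \<omega>) ^ (2 * k))
        \<le> fact (2 * k) / z ^ (2 * k) * exp (2 * K3\<^sup>2 * z\<^sup>2 * (\<Sum>i\<in>J. (Q i i)\<^sup>2))"
      unfolding qdiag_def by (rule diagonal_moment(2)[OF J b z0 k K3 zk])
    also have "\<dots> \<le> real (2 * k) ^ (2 * k) / z ^ (2 * k) * exp (real (2 * k))"
      using fact_le_power[of "2 * k", where 'a = real] z0 ex
      by (intro mult_mono divide_right_mono) auto
    also have "\<dots> = (real (2 * k) / z * exp 1) ^ (2 * k)"
      by (simp add: power_mult_distrib power_divide flip: exp_of_nat_mult)
    also have "real (2 * k) / z * exp 1 = d * s"
      using k d0 B0 s0 by (simp add: z_def B field_simps)
    finally show "expectation (\<lambda>\<omega>. qdiag J (noise \<omega>) ^ (2 * k)) \<le> (d * s) ^ (2 * k)" .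
  qed
  \<comment> \<open>A maximum over all coordinate sets, since decoupling bounds one restricted form
    by others. It is attained, and the inequality is then applied at the maximising set.\<close>
  define m where "m = (\<lambda>J. expectation (\<lambda>\<omega>. qform J (noise \<omega>) ^ (2 * k)))"
  define A where "A = Max (m ` Pow {..<n})"
  have mA: "m J \<le> A" if "J \<subseteq> {..<n}" for J
    unfolding A_def using that by (intro Max_ge) auto
  have "A \<in> m ` Pow {..<n}" unfolding A_def by (rule Max_in) auto
  then obtain J0 where J0: "J0 \<subseteq> {..<n}" "A = m J0" by auto
  have A0: "0 \<le> A" unfolding J0 m_def using qform_nonneg[OF J0(1)] by (intro integral_nonneg_AE) auto
  have off: "integrable M (\<lambda>\<omega>. qoff J (noise \<omega>) ^ (2 * k))"
    "expectation (\<lambda>\<omega>. qoff J (noise \<omega>) ^ (2 * k)) \<le> 4 ^ (2 * k) * (d\<^sup>2 * s) ^ k * sqrt A"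
    if J: "J \<subseteq> {..<n}" for J
  proof -
    have U: "expectation (\<lambda>\<omega>. qform L (noise \<omega>) ^ (2 * k)) \<le> A" if "L \<subseteq> J" for L
      using mA[of L] that J by (auto simp: m_def)
    show "integrable M (\<lambda>\<omega>. qoff J (noise \<omega>) ^ (2 * k))" by (rule qoff_moment(1)[OF J k U])
    have "expectation (\<lambda>\<omega>. qoff J (noise \<omega>) ^ (2 * k)) \<le> 4 ^ (2 * k) * lin_const k ^ k * sqrt A"
      by (rule qoff_moment(2)[OF J k U])
    also have "\<dots> \<le> 4 ^ (2 * k) * (d\<^sup>2 * s) ^ k * sqrt A"
      using A0 lin by (intro mult_right_mono mult_left_mono power_mono) auto
    finally show "expectation (\<lambda>\<omega>. qoff J (noise \<omega>) ^ (2 * k)) \<le> 4 ^ (2 * k) * (d\<^sup>2 * s) ^ k * sqrt A" .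
  qed
  have "A \<le> expectation (\<lambda>\<omega>. 3 ^ (2 * k) * (s ^ (2 * k) + qdiag J0 (noise \<omega>) ^ (2 * k) + qoff J0 (noise \<omega>) ^ (2 * k)))"
    unfolding J0(2) m_def
  proof (rule integral_mono[OF integrable_qform_power[OF J0(1)]])
    show "integrable M (\<lambda>\<omega>. 3 ^ (2 * k) * (s ^ (2 * k) + qdiag J0 (noise \<omega>) ^ (2 * k) + qoff J0 (noise \<omega>) ^ (2 * k)))"
      using diag(1)[OF J0(1)] off(1)[OF J0(1)] by auto
    fix \<omega>
    have "qform J0 (noise \<omega>) ^ (2 * k) \<le>
      3 ^ (2 * k) * (qtrace J0 ^ (2 * k) + qdiag J0 (noise \<omega>) ^ (2 * k) + qoff J0 (noise \<omega>) ^ (2 * k))"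
      unfolding qform_eq[OF J0(1)] by (rule power_add3_le)
    also have "qtrace J0 ^ (2 * k) \<le> s ^ (2 * k)"
      using qtrace_bounds[OF J0(1)] r by (intro power_mono) auto
    finally show "qform J0 (noise \<omega>) ^ (2 * k) \<le>
      3 ^ (2 * k) * (s ^ (2 * k) + qdiag J0 (noise \<omega>) ^ (2 * k) + qoff J0 (noise \<omega>) ^ (2 * k))"
      by simp
  qed
  also have "\<dots> = 3 ^ (2 * k) * (s ^ (2 * k) + expectation (\<lambda>\<omega>. qdiag J0 (noise \<omega>) ^ (2 * k))
      + expectation (\<lambda>\<omega>. qoff J0 (noise \<omega>) ^ (2 * k)))"
    using diag(1)[OF J0(1)] off(1)[OF J0(1)] by (simp add: prob_space)
  also have "\<dots> \<le> 3 ^ (2 * k) * (s ^ (2 * k) + (d * s) ^ (2 * k) + 4 ^ (2 * k) * (d\<^sup>2 * s) ^ k * sqrt A)"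
    using diag(2)[OF J0(1)] off(2)[OF J0(1)] by (intro mult_left_mono add_mono) auto
  finally have Ale: "A \<le> 3 ^ (2 * k) * (s ^ (2 * k) + (d * s) ^ (2 * k) + 4 ^ (2 * k) * (d\<^sup>2 * s) ^ k * sqrt A)" .
  have d1: "144 * d\<^sup>2 \<le> 1" "d \<le> 1"
  proof -
    have "1 \<le> exp (1::real)" by simp
    then have e1: "1 \<le> exp (1::real) * 48" "12 \<le> exp (1::real) * 48" by linarith+
    show "d \<le> 1" using e1(1) by (simp add: d field_simps)
    have "12 * d \<le> 1" using e1(2) by (simp add: d field_simps)
    then have "(12 * d)\<^sup>2 \<le> 1\<^sup>2" using d0 by (intro power_mono) auto
    then show "144 * d\<^sup>2 \<le> 1" by (simp add: power_mult_distrib)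
  qed
  \<comment> \<open>In units of s^k the inequality is quadratic in the root of \<open>A\<close>, and
    144 * d^2 \<le> 1 keeps its linear coefficient at most 1.\<close>
  define b where "b = sqrt A / s ^ k"
  have b0: "0 \<le> b" using A0 s0 by (simp add: b_def)
  have sA: "sqrt A = b * s ^ k" using s0 by (simp add: b_def)
  have "b\<^sup>2 * s ^ (2 * k) = A"
    using sA A0 real_sqrt_pow2[OF A0] by (simp add: power_mult_distrib power_mult[symmetric] mult.commute)
  then have "b\<^sup>2 * s ^ (2 * k) \<le> 3 ^ (2 * k) * (s ^ (2 * k) + (d * s) ^ (2 * k) + 4 ^ (2 * k) * (d\<^sup>2 * s) ^ k * (b * s ^ k))"
    using Ale unfolding sA by simp
  also have "\<dots> = (9 ^ k * (1 + d ^ (2 * k)) + (144 * d\<^sup>2) ^ k * b) * s ^ (2 * k)"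
  proof -
    have "(144::real) ^ k = 9 ^ k * 16 ^ k" by (simp flip: power_mult_distrib)
    moreover have "s ^ (2 * k) = s ^ k * s ^ k" by (simp flip: power_add mult_2)
    moreover have "(3::real) ^ (2 * k) = 9 ^ k" "(4::real) ^ (2 * k) = 16 ^ k" "d ^ (2 * k) = (d\<^sup>2) ^ k"
      by (simp_all add: power_mult)
    ultimately show ?thesis
      by (simp add: power_mult_distrib algebra_simps)
  qed
  finally have "b\<^sup>2 \<le> 9 ^ k * (1 + d ^ (2 * k)) + (144 * d\<^sup>2) ^ k * b"
    using s0 by (simp add: mult_le_cancel_right)
  also have "\<dots> \<le> 9 ^ k * (1 + 1) + 1 * b"
    using d0 d1 b0 by (intro add_mono mult_left_mono mult_right_mono power_le_one) auto
  also have "\<dots> = 2 * (3 ^ k)\<^sup>2 + b" by (simp add: power_mult[symmetric] mult.commute[of k] power_mult)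
  finally have "b \<le> 2 * 3 ^ k" by (rule self_bound) simp
  also have "\<dots> \<le> 3 ^ k * 3 ^ k"
    using self_le_power[of "3::real" k] k by (intro mult_right_mono) auto
  also have "\<dots> = 9 ^ k" by (simp flip: power_mult_distrib)
  finally have sA9: "sqrt A \<le> 9 ^ k * s ^ k" unfolding sA using s0 by (intro mult_right_mono) auto
  let ?J = "{..<n}"
  let ?D = "\<lambda>\<omega>. qdiag ?J (noise \<omega>) + qoff ?J (noise \<omega>)"
  \<comment> \<open>\<open>sA9\<close> is too crude for the form itself. Put back into the
    off-diagonal estimate, it meets the factor d^2 and gives a small multiple of s.\<close>
  have offn: "expectation (\<lambda>\<omega>. qoff ?J (noise \<omega>) ^ (2 * k)) \<le> (12 * d * s) ^ (2 * k)"
  proof -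
    have "expectation (\<lambda>\<omega>. qoff ?J (noise \<omega>) ^ (2 * k)) \<le> 4 ^ (2 * k) * (d\<^sup>2 * s) ^ k * sqrt A"
      by (rule off(2)) simp
    also have "\<dots> \<le> 4 ^ (2 * k) * (d\<^sup>2 * s) ^ k * (9 ^ k * s ^ k)"
      using sA9 s0 by (intro mult_left_mono) auto
    also have "\<dots> = (4\<^sup>2 * (d\<^sup>2 * s) * (9 * s)) ^ k"
      by (simp only: power_mult power_mult_distrib)
    also have "4\<^sup>2 * (d\<^sup>2 * s) * (9 * s) = (12 * d * s)\<^sup>2" by (simp add: power2_eq_square)
    finally show ?thesis by (simp only: power_mult)
  qed
  have intD: "integrable M (\<lambda>\<omega>. ?D \<omega> ^ (2 * k))"
  proof (rule Bochner_Integration.integrable_bound)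
    show "integrable M (\<lambda>\<omega>. 3 ^ (2 * k) * (0 ^ (2 * k) + qdiag ?J (noise \<omega>) ^ (2 * k) + qoff ?J (noise \<omega>) ^ (2 * k)))"
      using diag(1)[of ?J] off(1)[of ?J] by auto
    show "(\<lambda>\<omega>. ?D \<omega> ^ (2 * k)) \<in> borel_measurable M"
      unfolding qdiag_def qoff_def by (intro borel_measurable_power borel_measurable_add
          borel_measurable_sum borel_measurable_times borel_measurable_diff measurable_e) auto
    show "AE \<omega> in M. norm (?D \<omega> ^ (2 * k)) \<le>
        norm (3 ^ (2 * k) * (0 ^ (2 * k) + qdiag ?J (noise \<omega>) ^ (2 * k) + qoff ?J (noise \<omega>) ^ (2 * k)))"
      using power_add3_le[of 0 _ _ k] by (intro AE_I2) (auto intro: order_trans[OF _ abs_ge_self])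
  qed
  have "prob {\<omega> \<in> space M. qtrace ?J + s \<le> qform ?J (noise \<omega>)} \<le> prob {\<omega> \<in> space M. s ^ (2 * k) \<le> ?D \<omega> ^ (2 * k)}"
  proof (rule finite_measure_mono)
    show "{\<omega> \<in> space M. qtrace ?J + s \<le> qform ?J (noise \<omega>)} \<subseteq> {\<omega> \<in> space M. s ^ (2 * k) \<le> ?D \<omega> ^ (2 * k)}"
      using s0 by (auto simp: qform_eq intro!: power_mono)
    show "{\<omega> \<in> space M. s ^ (2 * k) \<le> ?D \<omega> ^ (2 * k)} \<in> events"
      using borel_measurable_integrable[OF intD] by measurable
  qed
  also have "\<dots> \<le> expectation (\<lambda>\<omega>. ?D \<omega> ^ (2 * k)) / s ^ (2 * k)"
    using intD s0 by (intro integral_Markov_inequality_measure[where A = "space M"]) auto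
  also have "expectation (\<lambda>\<omega>. ?D \<omega> ^ (2 * k)) \<le> (s / exp 1) ^ (2 * k)"
  proof -
    have "expectation (\<lambda>\<omega>. ?D \<omega> ^ (2 * k)) \<le>
      expectation (\<lambda>\<omega>. 2 ^ (2 * k) * (qdiag ?J (noise \<omega>) ^ (2 * k) + qoff ?J (noise \<omega>) ^ (2 * k)))"
    proof (rule integral_mono[OF intD])
      show "integrable M (\<lambda>\<omega>. 2 ^ (2 * k) * (qdiag ?J (noise \<omega>) ^ (2 * k) + qoff ?J (noise \<omega>) ^ (2 * k)))"
        using diag(1)[of ?J] off(1)[of ?J] by auto
      fix \<omega>
      have "\<bar>?D \<omega>\<bar> ^ (2 * k) \<le> (\<bar>qdiag ?J (noise \<omega>)\<bar> + \<bar>qoff ?J (noise \<omega>)\<bar>) ^ (2 * k)"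
        by (intro power_mono) auto
      also have "\<dots> \<le> 2 ^ (2 * k) * (\<bar>qdiag ?J (noise \<omega>)\<bar> ^ (2 * k) + \<bar>qoff ?J (noise \<omega>)\<bar> ^ (2 * k))"
        by (rule power_add_le) auto
      finally show "?D \<omega> ^ (2 * k) \<le> 2 ^ (2 * k) * (qdiag ?J (noise \<omega>) ^ (2 * k) + qoff ?J (noise \<omega>) ^ (2 * k))"
        by (simp only: power_even_abs even_mult_iff even_numeral simp_thms)
    qed
    also have "\<dots> = 2 ^ (2 * k) * (expectation (\<lambda>\<omega>. qdiag ?J (noise \<omega>) ^ (2 * k))
        + expectation (\<lambda>\<omega>. qoff ?J (noise \<omega>) ^ (2 * k)))"
      using diag(1)[of ?J] off(1)[of ?J] by simp
    also have "\<dots> \<le> 2 ^ (2 * k) * ((12 * d * s) ^ (2 * k) + (12 * d * s) ^ (2 * k))"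
    proof (intro mult_left_mono add_mono offn)
      have "(d * s) ^ (2 * k) \<le> (12 * d * s) ^ (2 * k)" using d0 s0 by (intro power_mono) auto
      then show "expectation (\<lambda>\<omega>. qdiag ?J (noise \<omega>) ^ (2 * k)) \<le> (12 * d * s) ^ (2 * k)"
        using diag(2)[of ?J] by simp
    qed simp
    also have "\<dots> = 2 ^ (2 * k) * (2 * (12 * d * s) ^ (2 * k))" by simp
    also have "\<dots> \<le> 2 ^ (2 * k) * (2 ^ (2 * k) * (12 * d * s) ^ (2 * k))"
      using self_le_power[of "2::real" "2 * k"] k d0 s0 by (intro mult_left_mono mult_right_mono) auto
    also have "\<dots> = (2 * 2 * (12 * d * s)) ^ (2 * k)" by (simp only: power_mult_distrib mult.assoc)
    \<comment> \<open>This identity dictates the value 1 / (48 e) of d.\<close>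
    also have "2 * 2 * (12 * d * s) = s / exp 1" by (simp add: d)
    finally show ?thesis .
  qed
  also have "(s / exp 1) ^ (2 * k) / s ^ (2 * k) = 1 / exp 1 ^ (2 * k)"
    using s0 by (simp add: power_divide)
  also have "\<dots> = exp (- 2 * real k)"
    by (simp add: exp_minus field_simps flip: exp_of_nat_mult)
  finally show ?thesis using s0 by (simp add: divide_right_mono)
qed

end

text \<open>A Hanson--Wright type bound: only the deviation \<open>t\<close>, not the constant 2 in front of the
  trace, is affected by the tails of the noise.\<close>

lemma qform_tail:
  assumes "0 < alpha" "alpha \<le> 2" "1 \<le> K"
  obtains C c :: real where "0 < C" "0 < c"
    "\<And>(M :: 'a measure) n e Q t. weibull_quadratic M n e alpha K Q \<Longrightarrow> 0 \<le> t \<Longrightarrow>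
      measure M {\<omega> \<in> space M. 2 * (\<Sum>i<n. Q i i) + t \<le> (\<Sum>i<n. \<Sum>j<n. Q i j * e i \<omega> * e j \<omega>)}
      \<le> C * exp (- c * t powr (alpha / 2))"
proof -
  define d :: real where "d = 1 / (48 * exp 1)"
  define K3 where "K3 = 2 * 4 powr (2 / alpha) * exp 1 * K\<^sup>2"
  define B where "B = 2 * exp 1 / d"
  define H where "H = K3\<^sup>2 * B\<^sup>2 + 2 * K3 * B + 6 * exp 3 * K\<^sup>2 / d\<^sup>2"
  have "0 < d" "0 < K3" using assms by (auto simp: d_def K3_def)
  then have "0 < K3" "0 < B" by (auto simp: B_def)
  then have H0: "0 < H" by (auto simp: H_def intro!: add_pos_nonneg)
  define c where "c = 1 / (2 * H powr (alpha / 2))"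
  show thesis
  proof (rule that[of "exp 2" c])
    show "0 < exp (2::real)" "0 < c" using H0 by (auto simp: c_def)
    fix M :: "'a measure" and n e Q and t :: real
    assume "weibull_quadratic M n e alpha K Q" and t: "0 \<le> t"
    then interpret weibull_quadratic M n e alpha K Q by simp
    \<comment> \<open>The deviation contains the trace, as the moment bound demands; adding the mean
      gives twice the trace plus t.\<close>
    define s where "s = qtrace {..<n} + t"
    have r0: "0 \<le> qtrace {..<n}" using qtrace_bounds by simp
    have s0: "0 \<le> s" "t \<le> s" using r0 t by (auto simp: s_def)
    \<comment> \<open>Solves H * (4x)^(2/alpha) = s, so the integer part of x is the largest
      admissible moment order. The constant exp 2 pays for the rounding, and k = 0 is the trivial
      bound 1.\<close>
    define x where "x = (s / H) powr (alpha / 2) / 4"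
    have x0: "0 \<le> x" by (simp add: x_def)
    define k where "k = nat \<lfloor>x\<rfloor>"
    have kx: "real k \<le> x" "x - 1 \<le> real k" using x0 by (simp_all add: k_def)
    let ?P = "prob {\<omega> \<in> space M. qtrace {..<n} + s \<le> qform {..<n} (noise \<omega>)}"
    have "?P \<le> exp (- 2 * real k)"
    proof (cases "k = 0")
      case False
      have "real (4 * k) powr (2 / alpha) \<le> (4 * x) powr (2 / alpha)"
        using kx assms by (intro powr_mono2) auto
      also have "\<dots> = s / H"
        using s0 H0 assms by (simp add: x_def powr_powr)
      finally have "H * real (4 * k) powr (2 / alpha) \<le> s" using H0 by (simp add: field_simps)
      then show ?thesis
        using False t by (intro qform_tail_moment[OF _ d_def K3_def B_def H_def]) (auto simp: s_def)
    qed simp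
    also have "\<dots> \<le> exp (2 - 2 * x)" using kx by simp
    also have "\<dots> = exp 2 * exp (- (2 * x))" by (simp flip: exp_add)
    also have "\<dots> \<le> exp 2 * exp (- c * t powr (alpha / 2))"
    proof -
      have "c * t powr (alpha / 2) \<le> c * s powr (alpha / 2)"
        using s0 t assms H0 by (intro mult_left_mono powr_mono2) (auto simp: c_def)
      also have "\<dots> = 2 * x" using s0 H0 by (simp add: c_def x_def powr_divide)
      finally show ?thesis by simp
    qed
    finally show "prob {\<omega> \<in> space M. 2 * (\<Sum>i<n. Q i i) + t \<le> (\<Sum>i<n. \<Sum>j<n. Q i j * e i \<omega> * e j \<omega>)}
        \<le> exp 2 * exp (- c * t powr (alpha / 2))"
      by (simp add: s_def qtrace_def qform_def algebra_simps)
  qed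
qed

section \<open>From tails to moments\<close>

text \<open>The left side is largest at x = y; the proof is ln u \<le> u - 1 at u = x / y.\<close>

lemma powr_mult_exp_le:
  fixes x y :: real
  assumes "0 \<le> x" "0 < y"
  shows "x powr y * exp (- x) \<le> y powr y"
proof (cases "x = 0")
  case False
  then have x: "0 < x" using assms by simp
  have "ln (x / y) \<le> x / y - 1" using x assms by (intro ln_le_minus_one) auto
  then have "y * (ln x - ln y) \<le> y * (x / y - 1)"
    using x assms by (intro mult_left_mono) (auto simp: ln_div)
  then have "y * ln x - x \<le> y * ln y" using assms by (simp add: right_diff_distrib)
  then have "exp (y * ln x - x) \<le> exp (y * ln y)" by simp
  then show ?thesis using x assms by (simp add: powr_def exp_diff exp_minus divide_inverse)
qed simp

text \<open>The exponent 2 / alpha in the previous lemma is chosen to produce x^2. Stretched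
  exponentials thereby become summable over the integers, here over layers of the noise and later
  over levels of models.\<close>

lemma exp_neg_powr_le:
  fixes b x alpha :: real
  assumes "0 < b" "0 < x" "0 < alpha"
  shows "exp (- (b * x powr alpha)) \<le> ((2 / alpha) powr (2 / alpha) * b powr (- (2 / alpha))) * (1 / x\<^sup>2)"
proof -
  have "(b * x powr alpha) powr (2 / alpha) * exp (- (b * x powr alpha)) \<le> (2 / alpha) powr (2 / alpha)"
    using assms by (intro powr_mult_exp_le) auto
  moreover have "(b * x powr alpha) powr (2 / alpha) = b powr (2 / alpha) * x\<^sup>2"
    using assms by (simp add: powr_mult powr_powr powr_numeral)
  ultimately show ?thesis using assms by (simp add: powr_minus field_simps)
qed

lemma summable_exp_neg_powr:
  fixes b alpha :: real
  assumes "0 < b" "0 < alpha"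
  shows "summable (\<lambda>j. exp (- (b * real (Suc j) powr alpha)))"
proof (rule summable_comparison_test')
  show "summable (\<lambda>j. ((2 / alpha) powr (2 / alpha) * b powr (- (2 / alpha))) * (1 / (real (Suc j))\<^sup>2))"
    using inverse_squares_sums by (intro summable_mult) (auto simp: sums_iff add.commute)
  show "norm (exp (- (b * real (Suc n) powr alpha)))
      \<le> ((2 / alpha) powr (2 / alpha) * b powr (- (2 / alpha))) * (1 / (real (Suc n))\<^sup>2)" if "0 \<le> n" for n
    using exp_neg_powr_le[OF assms(1) _ assms(2), of "real (Suc n)"] by simp
qed

text \<open>exp (a * |X|^alpha) is integrated over unit layers of |X|; moments follow because x^m is
  at most a multiple of that exponential. \<open>K\<close> is fixed before the measure and the
  variable.\<close>

lemma weibull_tail_moments: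
  fixes alpha zeta :: real
  assumes alpha: "0 < alpha" and zeta: "0 < zeta"
  obtains K :: real where "1 \<le> K"
    "\<And>(M :: 'a measure) X m. prob_space M \<Longrightarrow> X \<in> borel_measurable M \<Longrightarrow>
      (\<And>t. 2 \<le> t \<Longrightarrow> measure M {\<omega> \<in> space M. t < \<bar>X \<omega>\<bar>} \<le> 2 * exp (- ((t / zeta) powr alpha))) \<Longrightarrow>
      1 \<le> m \<Longrightarrow> integrable M (\<lambda>\<omega>. \<bar>X \<omega>\<bar> ^ m) \<and>
        (\<integral>\<omega>. \<bar>X \<omega>\<bar> ^ m \<partial>M) \<le> (K * real m powr (1 / alpha)) ^ m"
proof -
  \<comment> \<open>Since j + 3 \<le> 3/2 * (j + 2), this value makes the integrand on layer j cost
    at most half of the tail exponent at j + 2. The other half, with rate \<open>b\<close>, makes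
    the layers summable.\<close>
  define a where "a = (2 / (3 * zeta)) powr alpha / 2"
  have a0: "0 < a" using zeta by (simp add: a_def)
  define F where "F = (\<lambda>x. exp (a * x powr alpha))"
  have Fmono: "F x \<le> F y" if "0 \<le> x" "x \<le> y" for x y
    using that a0 alpha by (auto simp: F_def intro!: mult_left_mono powr_mono2)
  define b where "b = (1 / zeta) powr alpha / 2"
  have b0: "0 < b" using zeta by (simp add: b_def)
  have sum0: "summable (\<lambda>j. exp (- (b * real (Suc j) powr alpha)))"
    by (rule summable_exp_neg_powr[OF b0 alpha])
  have sum: "summable (\<lambda>j. 2 * exp (- (b * real (j + 2) powr alpha)))"
    using summable_ignore_initial_segment[OF sum0, of 1] by (intro summable_mult) simp
  \<comment> \<open>F 3 covers all values |X| \<le> 3, including those below 2 where no tail bound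
    is given.\<close>
  define C0 where "C0 = F 3 + (\<Sum>j. 2 * exp (- (b * real (j + 2) powr alpha)))"
  have "1 \<le> F 3" using a0 by (simp add: F_def)
  moreover have "0 \<le> (\<Sum>j. 2 * exp (- (b * real (j + 2) powr alpha)))"
    by (rule suminf_nonneg[OF sum]) simp
  ultimately have C0: "1 \<le> C0" by (simp add: C0_def)
  have step: "F (real j + 3) * (2 * exp (- ((real (j + 2) / zeta) powr alpha)))
      \<le> 2 * exp (- (b * real (j + 2) powr alpha))" for j
  proof -
    have "a * (real j + 3) powr alpha \<le> a * (3 / 2 * real (j + 2)) powr alpha"
      using a0 alpha by (intro mult_left_mono powr_mono2) auto
    also have "\<dots> = (2 / (3 * zeta) * (3 / 2 * real (j + 2))) powr alpha / 2"
    proof -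
      have "(2 / (3 * zeta) * (3 / 2 * real (j + 2))) powr alpha
          = (2 / (3 * zeta)) powr alpha * (3 / 2 * real (j + 2)) powr alpha"
        by (rule powr_mult)
      then show ?thesis unfolding a_def by simp
    qed
    also have "2 / (3 * zeta) * (3 / 2 * real (j + 2)) = 1 / zeta * real (j + 2)"
      using zeta by (simp add: field_simps)
    also have "(1 / zeta * real (j + 2)) powr alpha / 2 = b * real (j + 2) powr alpha"
    proof -
      have "(1 / zeta * real (j + 2)) powr alpha = (1 / zeta) powr alpha * real (j + 2) powr alpha"
        by (rule powr_mult)
      then show ?thesis unfolding b_def by simp
    qed
    finally have 1: "a * (real j + 3) powr alpha \<le> b * real (j + 2) powr alpha" .
    have "(real (j + 2) / zeta) powr alpha = 2 * (b * real (j + 2) powr alpha)"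
      using zeta by (simp add: b_def powr_divide)
    with 1 have "a * (real j + 3) powr alpha - (real (j + 2) / zeta) powr alpha \<le> - (b * real (j + 2) powr alpha)"
      by simp
    then have "exp (a * (real j + 3) powr alpha - (real (j + 2) / zeta) powr alpha) \<le> exp (- (b * real (j + 2) powr alpha))"
      by simp
    then show ?thesis by (simp add: F_def exp_diff exp_minus divide_inverse)
  qed
  \<comment> \<open>From the maximum of x^m * exp (- a * x^alpha), which is (m / (e * alpha * a))^(m
    / alpha); the e is dropped.\<close>
  define K1 where "K1 = (1 / (alpha * a)) powr (1 / alpha)"
  have K1: "0 < K1" using alpha a0 by (simp add: K1_def)
  define K where "K = max 1 (C0 * K1)"
  show thesis
  proof (rule that[of K])
    show "1 \<le> K" by (simp add: K_def)
    fix M :: "'a measure" and X and m :: nat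
    assume "prob_space M" and X[measurable]: "X \<in> borel_measurable M" and m: "1 \<le> m"
      and tail: "\<And>t. 2 \<le> t \<Longrightarrow> measure M {\<omega> \<in> space M. t < \<bar>X \<omega>\<bar>} \<le> 2 * exp (- ((t / zeta) powr alpha))"
    interpret prob_space M by fact
    define S where "S = (\<lambda>j::nat. {\<omega> \<in> space M. real (j + 2) < \<bar>X \<omega>\<bar>})"
    have S[measurable]: "S j \<in> sets M" for j unfolding S_def by measurable
    have pt: "ennreal (F \<bar>X \<omega>\<bar>) \<le> ennreal (F 3) + (\<Sum>j. ennreal (F (real j + 3)) * indicator (S j) \<omega>)"
      if \<omega>: "\<omega> \<in> space M" for \<omega>
    proof (cases "\<bar>X \<omega>\<bar> \<le> 3")
      case True
      then have "ennreal (F \<bar>X \<omega>\<bar>) \<le> ennreal (F 3)" by (intro ennreal_leI Fmono) auto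
      then show ?thesis by (rule order_trans) simp
    next
      case False
      \<comment> \<open>The ceiling places |X| in the half-open layer from j + 2, excluded, to j +
        3, matching the strict inequality in the tail bound.\<close>
      define j where "j = nat (\<lceil>\<bar>X \<omega>\<bar>\<rceil> - 3)"
      have "3 < \<lceil>\<bar>X \<omega>\<bar>\<rceil>" using False by (simp add: less_ceiling_iff)
      then have j: "real j = real_of_int \<lceil>\<bar>X \<omega>\<bar>\<rceil> - 3" by (simp add: j_def)
      have lb: "real (j + 2) < \<bar>X \<omega>\<bar>" and ub: "\<bar>X \<omega>\<bar> \<le> real j + 3"
        unfolding of_nat_add j by linarith+
      have "ennreal (F \<bar>X \<omega>\<bar>) \<le> ennreal (F (real j + 3)) * indicator (S j) \<omega>"
        using ub lb \<omega> by (auto simp: S_def intro!: ennreal_leI Fmono)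
      also have "\<dots> \<le> (\<Sum>j. ennreal (F (real j + 3)) * indicator (S j) \<omega>)"
      proof -
        have "f j \<le> (\<Sum>j. f j)" for f :: "nat \<Rightarrow> ennreal"
          using sum_le_suminf[of f "{j}"] by simp
        then show ?thesis .
      qed
      finally show ?thesis by (rule order_trans) simp
    qed
    have mF[measurable]: "(\<lambda>\<omega>. F \<bar>X \<omega>\<bar>) \<in> borel_measurable M" unfolding F_def by measurable
    have "(\<integral>\<^sup>+\<omega>. ennreal (F \<bar>X \<omega>\<bar>) \<partial>M)
        \<le> (\<integral>\<^sup>+\<omega>. ennreal (F 3) + (\<Sum>j. ennreal (F (real j + 3)) * indicator (S j) \<omega>) \<partial>M)"
      by (intro nn_integral_mono pt)
    also have "\<dots> = ennreal (F 3) + (\<Sum>j. ennreal (F (real j + 3)) * emeasure M (S j))"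
      by (subst nn_integral_add) (auto simp: nn_integral_suminf nn_integral_cmult emeasure_space_1)
    also have "(\<Sum>j. ennreal (F (real j + 3)) * emeasure M (S j)) \<le> (\<Sum>j. ennreal (2 * exp (- (b * real (j + 2) powr alpha))))"
    proof (rule suminf_le)
      fix j
      have "measure M (S j) \<le> 2 * exp (- ((real (j + 2) / zeta) powr alpha))"
        unfolding S_def by (rule tail) simp
      then have "F (real j + 3) * measure M (S j) \<le> F (real j + 3) * (2 * exp (- ((real (j + 2) / zeta) powr alpha)))"
        by (intro mult_left_mono) (auto simp: F_def)
      also have "\<dots> \<le> 2 * exp (- (b * real (j + 2) powr alpha))" by (rule step)
      finally have "ennreal (F (real j + 3) * measure M (S j)) \<le> ennreal (2 * exp (- (b * real (j + 2) powr alpha)))"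
        by (rule ennreal_leI)
      then show "ennreal (F (real j + 3)) * emeasure M (S j) \<le> ennreal (2 * exp (- (b * real (j + 2) powr alpha)))"
        by (simp add: emeasure_eq_measure ennreal_mult'' F_def)
    qed auto
    also have "(\<Sum>j. ennreal (2 * exp (- (b * real (j + 2) powr alpha)))) = ennreal (\<Sum>j. 2 * exp (- (b * real (j + 2) powr alpha)))"
      by (rule suminf_ennreal2[OF _ sum]) simp
    finally have EF: "(\<integral>\<^sup>+\<omega>. ennreal (F \<bar>X \<omega>\<bar>) \<partial>M) \<le> ennreal C0"
      using suminf_nonneg[OF sum] by (simp add: C0_def F_def ennreal_plus[symmetric] del: ennreal_plus)
    define R where "R = (K1 * real m powr (1 / alpha)) ^ m"
    have R0: "0 \<le> R" using K1 by (simp add: R_def)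
    have ptm: "\<bar>X \<omega>\<bar> ^ m \<le> R * F \<bar>X \<omega>\<bar>" for \<omega>
    proof (cases "X \<omega> = 0")
      case False
      define x where "x = \<bar>X \<omega>\<bar>"
      have x: "0 < x" using False by (simp add: x_def)
      have "(a * x powr alpha) powr (real m / alpha) * exp (- (a * x powr alpha)) \<le> (real m / alpha) powr (real m / alpha)"
        using a0 x alpha m by (intro powr_mult_exp_le) auto
      then have "(a * x powr alpha) powr (real m / alpha) \<le> (real m / alpha) powr (real m / alpha) * F x"
        by (simp add: F_def exp_minus field_simps)
      also have "(a * x powr alpha) powr (real m / alpha) = a powr (real m / alpha) * x ^ m"
        using a0 x alpha by (simp add: powr_mult powr_powr powr_realpow)
      finally have "x ^ m \<le> (real m / alpha) powr (real m / alpha) / a powr (real m / alpha) * F x"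
        using a0 by (simp add: field_simps)
      also have "(real m / alpha) powr (real m / alpha) / a powr (real m / alpha) = (real m / (alpha * a)) powr (real m / alpha)"
        using a0 alpha by (simp add: powr_divide[symmetric])
      also have "\<dots> = ((real m / (alpha * a)) powr (1 / alpha)) powr real m"
        by (simp add: powr_powr)
      also have "\<dots> = ((real m / (alpha * a)) powr (1 / alpha)) ^ m"
        using m a0 alpha by (intro powr_realpow) auto
      also have "(real m / (alpha * a)) powr (1 / alpha) = K1 * real m powr (1 / alpha)"
        using powr_mult[of "1 / (alpha * a)" "real m" "1 / alpha"] a0 alpha by (simp add: K1_def)
      finally show ?thesis by (simp add: R_def x_def)
    next
      case True
      then show ?thesis using m R0 by (simp add: F_def zero_power)
    qed
    have "(\<integral>\<^sup>+\<omega>. ennreal (\<bar>X \<omega>\<bar> ^ m) \<partial>M) \<le> (\<integral>\<^sup>+\<omega>. ennreal R * ennreal (F \<bar>X \<omega>\<bar>) \<partial>M)"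
      using ptm R0 by (intro nn_integral_mono) (simp add: ennreal_mult'[symmetric] ennreal_leI)
    also have "\<dots> \<le> ennreal R * ennreal C0"
      using EF by (subst nn_integral_cmult) (auto intro: mult_left_mono)
    also have "\<dots> = ennreal (R * C0)" using R0 by (simp add: ennreal_mult')
    finally have le: "(\<integral>\<^sup>+\<omega>. ennreal (\<bar>X \<omega>\<bar> ^ m) \<partial>M) \<le> ennreal (R * C0)" .
    have int: "integrable M (\<lambda>\<omega>. \<bar>X \<omega>\<bar> ^ m)"
      by (rule integrableI_bounded) (use le in \<open>auto simp: power_abs le_less_trans\<close>)
    have "ennreal (\<integral>\<omega>. \<bar>X \<omega>\<bar> ^ m \<partial>M) \<le> ennreal (R * C0)"
      using le nn_integral_eq_integral[OF int] by simp
    then have "(\<integral>\<omega>. \<bar>X \<omega>\<bar> ^ m \<partial>M) \<le> R * C0" using R0 C0 by (simp add: ennreal_le_iff)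
    \<comment> \<open>As m \<ge> 1 and C0 \<ge> 1, the prefactor can be moved under the m-th power
      and into \<open>K\<close>.\<close>
    also have "\<dots> \<le> R * C0 ^ m" using self_le_power[OF C0, of m] m R0 by (intro mult_left_mono) auto
    also have "\<dots> = (C0 * K1 * real m powr (1 / alpha)) ^ m"
      by (simp add: R_def power_mult_distrib)
    also have "\<dots> \<le> (K * real m powr (1 / alpha)) ^ m"
      using C0 K1 by (intro power_mono mult_right_mono) (auto simp: K_def)
    finally show "integrable M (\<lambda>\<omega>. \<bar>X \<omega>\<bar> ^ m) \<and>
        (\<integral>\<omega>. \<bar>X \<omega>\<bar> ^ m \<partial>M) \<le> (K * real m powr (1 / alpha)) ^ m"
      using int by simp
  qed
qed

section \<open>Orthogonal projections\<close>

unbundle no inner_syntax and no vec_syntax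

text \<open>Bare closure conditions; the module structure comes in only where dimension and rank
  do.\<close>

definition vec_subspace :: "nat \<Rightarrow> real Matrix.vec set \<Rightarrow> bool" where
  "vec_subspace n W \<longleftrightarrow> W \<subseteq> carrier_vec n \<and> 0\<^sub>v n \<in> W \<and>
     (\<forall>v\<in>W. \<forall>w\<in>W. v + w \<in> W) \<and> (\<forall>c. \<forall>v\<in>W. c \<cdot>\<^sub>v v \<in> W)"

definition orthonormal :: "nat \<Rightarrow> real Matrix.vec set \<Rightarrow> bool" where
  "orthonormal n B \<longleftrightarrow> finite B \<and> B \<subseteq> carrier_vec n \<and>
     (\<forall>u\<in>B. \<forall>v\<in>B. u \<bullet> v = (if u = v then 1 else 0))"

text \<open>For orthonormal \<open>B\<close> this is the orthogonal projection of \<open>v\<close>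
  onto the span of \<open>B\<close>, in coordinates.\<close>

definition expand :: "nat \<Rightarrow> real Matrix.vec set \<Rightarrow> real Matrix.vec \<Rightarrow> real Matrix.vec" where
  "expand n B v = Matrix.vec n (\<lambda>i. \<Sum>u\<in>B. (u \<bullet> v) * u $ i)"

lemma vec_subspaceD:
  assumes "vec_subspace n W"
  shows "W \<subseteq> carrier_vec n" "0\<^sub>v n \<in> W" "v \<in> W \<Longrightarrow> w \<in> W \<Longrightarrow> v + w \<in> W" "v \<in> W \<Longrightarrow> c \<cdot>\<^sub>v v \<in> W"
  using assms by (simp_all add: vec_subspace_def)

lemma vec_subspace_Int:
  assumes V: "vec_subspace n V" and W: "vec_subspace n W"
  shows "vec_subspace n (V \<inter> W)"
  unfolding vec_subspace_def[of n "V \<inter> W"]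
proof (intro conjI ballI allI)
  show "V \<inter> W \<subseteq> carrier_vec n" using vec_subspaceD(1)[OF V] by blast
  show "0\<^sub>v n \<in> V \<inter> W" using vec_subspaceD(2)[OF V] vec_subspaceD(2)[OF W] by blast
  fix v assume v: "v \<in> V \<inter> W"
  show "v + w \<in> V \<inter> W" if "w \<in> V \<inter> W" for w
    using v that vec_subspaceD(3)[OF V, of v w] vec_subspaceD(3)[OF W, of v w] by simp
  show "c \<cdot>\<^sub>v v \<in> V \<inter> W" for c
    using v vec_subspaceD(4)[OF V, of v c] vec_subspaceD(4)[OF W, of v c] by simp
qed

lemma vec_subspace_minus:
  assumes "vec_subspace n W" "v \<in> W" "w \<in> W"
  shows "v - w \<in> W"
proof -
  have "v - w = v + (-1) \<cdot>\<^sub>v w"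
    using vec_subspaceD(1)[OF assms(1)] assms by (intro eq_vecI) auto
  then show ?thesis using assms by (simp add: vec_subspaceD)
qed

lemma vec_eq_if_minus_eq_zero:
  fixes a b :: "real Matrix.vec"
  assumes "a \<in> carrier_vec n" "b \<in> carrier_vec n" "a - b = 0\<^sub>v n"
  shows "a = b"
proof (rule eq_vecI)
  fix i assume "i < dim_vec b"
  then have "i < n" using assms by simp
  then have "a $ i - b $ i = (a - b) $ i" using assms(1,2) by simp
  also have "\<dots> = 0" unfolding assms(3) using \<open>i < n\<close> by simp
  finally show "a $ i = b $ i" by simp
qed (use assms in simp)

lemma sqnorm_eq_sum: "v \<in> carrier_vec n \<Longrightarrow> sqnorm v = (\<Sum>i<n. (v $ i)\<^sup>2)"
  by (auto simp: sqnorm_def scalar_prod_def power2_eq_square atLeast0LessThan)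

lemma sqnorm_nonneg: "0 \<le> sqnorm v"
  by (simp add: sqnorm_def scalar_prod_def sum_nonneg)

lemma sqnorm_eq_0: "v \<in> carrier_vec n \<Longrightarrow> sqnorm v = 0 \<longleftrightarrow> v = 0\<^sub>v n"
  by (auto simp: sqnorm_eq_sum sum_nonneg_eq_0_iff intro!: eq_vecI)

lemma sqnorm_add:
  assumes "v \<in> carrier_vec n" "w \<in> carrier_vec n"
  shows "sqnorm (v + w) = sqnorm v + 2 * (v \<bullet> w) + sqnorm w"
  using assms by (simp add: sqnorm_def add_scalar_prod_distrib[of _ n] scalar_prod_add_distrib[of _ n]
      comm_scalar_prod[of w n v])

lemma sqnorm_smult: "sqnorm (c \<cdot>\<^sub>v v) = c\<^sup>2 * sqnorm v"
  by (simp add: sqnorm_def power2_eq_square)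

lemma sqnorm_minus:
  assumes "v \<in> carrier_vec n" "w \<in> carrier_vec n"
  shows "sqnorm (v - w) = sqnorm v - 2 * (v \<bullet> w) + sqnorm w"
  using assms by (simp add: sqnorm_def minus_scalar_prod_distrib[of _ n] scalar_prod_minus_distrib[of _ n]
      comm_scalar_prod[of w n v])

lemma expand_carrier [simp]: "expand n B v \<in> carrier_vec n"
  by (simp add: expand_def)

lemma dim_expand [simp]: "dim_vec (expand n B v) = n"
  by (simp add: expand_def)

lemma expand_scalar_prod:
  assumes "B \<subseteq> carrier_vec n" "w \<in> carrier_vec n"
  shows "expand n B v \<bullet> w = (\<Sum>u\<in>B. (u \<bullet> v) * (u \<bullet> w))"
proof -
  have "expand n B v \<bullet> w = (\<Sum>i<n. \<Sum>u\<in>B. (u \<bullet> v) * (u $ i * w $ i))"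
    using assms by (auto simp: expand_def scalar_prod_def atLeast0LessThan sum_distrib_right mult.assoc)
  also have "\<dots> = (\<Sum>u\<in>B. (u \<bullet> v) * (u \<bullet> w))"
    using assms by (subst sum.swap) (auto simp: scalar_prod_def atLeast0LessThan sum_distrib_left
        carrier_vecD intro!: sum.cong)
  finally show ?thesis .
qed

lemma expand_in_subspace:
  assumes "vec_subspace n W" "finite B" "B \<subseteq> W"
  shows "expand n B v \<in> W"
  using assms(2,3)
proof (induction rule: finite_induct)
  case empty
  have "expand n {} v = 0\<^sub>v n" by (intro eq_vecI) (auto simp: expand_def)
  then show ?case using assms(1) by (simp add: vec_subspaceD)
next
  case (insert u B)
  have "expand n (insert u B) v = (u \<bullet> v) \<cdot>\<^sub>v u + expand n B v"
    using insert vec_subspaceD(1)[OF assms(1)] by (intro eq_vecI) (auto simp: expand_def)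
  then show ?case using assms(1) insert by (simp add: vec_subspaceD)
qed

lemma expand_orthogonal:
  assumes "orthonormal n B" "u \<in> B" "v \<in> carrier_vec n"
  shows "u \<bullet> (v - expand n B v) = 0"
proof -
  have u: "u \<in> carrier_vec n" and B: "B \<subseteq> carrier_vec n" "finite B" using assms by (auto simp: orthonormal_def)
  have "u \<bullet> expand n B v = expand n B v \<bullet> u" using u by (intro comm_scalar_prod) auto
  also have "\<dots> = (\<Sum>w\<in>B. (w \<bullet> v) * (w \<bullet> u))" by (rule expand_scalar_prod[OF B(1) u])
  also have "\<dots> = (\<Sum>w\<in>B. if w = u then u \<bullet> v else 0)"
    using assms by (intro sum.cong) (auto simp: orthonormal_def)
  also have "\<dots> = u \<bullet> v" using assms B by simp
  finally show ?thesis using u assms by (simp add: scalar_prod_minus_distrib[of _ n])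
qed

text \<open>Pythagoras, that is, Bessel's inequality with its remainder. The residual sums of
  squares need the identity, the size bound for orthonormal sets the inequality.\<close>

lemma bessel:
  assumes "orthonormal n B" "v \<in> carrier_vec n"
  shows "sqnorm (v - expand n B v) = sqnorm v - (\<Sum>u\<in>B. (u \<bullet> v)\<^sup>2)"
proof -
  let ?p = "expand n B v"
  have B: "B \<subseteq> carrier_vec n" using assms by (simp add: orthonormal_def)
  have "sqnorm ?p = (\<Sum>u\<in>B. (u \<bullet> v) * (u \<bullet> ?p))"
    unfolding sqnorm_def by (rule expand_scalar_prod[OF B]) simp
  also have "\<dots> = (\<Sum>u\<in>B. (u \<bullet> v)\<^sup>2)"
  proof (rule sum.cong[OF refl])
    fix u assume u: "u \<in> B"
    then have "u \<bullet> ?p = u \<bullet> v"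
      using expand_orthogonal[OF assms(1) u assms(2)] B assms
      by (auto simp: scalar_prod_minus_distrib[of _ n] subset_iff)
    then show "(u \<bullet> v) * (u \<bullet> ?p) = (u \<bullet> v)\<^sup>2" by (simp add: power2_eq_square)
  qed
  finally have p: "sqnorm ?p = (\<Sum>u\<in>B. (u \<bullet> v)\<^sup>2)" .
  have "v \<bullet> ?p = ?p \<bullet> v" using assms by (intro comm_scalar_prod) auto
  also have "\<dots> = (\<Sum>u\<in>B. (u \<bullet> v)\<^sup>2)"
    using expand_scalar_prod[OF B assms(2)] by (simp add: power2_eq_square)
  finally show ?thesis using sqnorm_minus[OF assms(2) expand_carrier] p by simp
qed

text \<open>Bessel at the i-th unit vector bounds the sum of the squared i-th coordinates over
  \<open>B\<close> by 1; summing over i counts \<open>B\<close>. Hence largest orthonormal sets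
  exist.\<close>

lemma orthonormal_card_le:
  assumes "orthonormal n B"
  shows "card B \<le> n"
proof -
  have B: "B \<subseteq> carrier_vec n" "finite B" using assms by (auto simp: orthonormal_def)
  have le: "(\<Sum>u\<in>B. (u $ i)\<^sup>2) \<le> 1" if i: "i < n" for i
  proof -
    have "0 \<le> sqnorm (unit_vec n i - expand n B (unit_vec n i))" by (rule sqnorm_nonneg)
    also have "\<dots> = sqnorm (unit_vec n i :: real Matrix.vec) - (\<Sum>u\<in>B. (u \<bullet> unit_vec n i)\<^sup>2)"
      by (rule bessel[OF assms]) simp
    also have "(\<Sum>u\<in>B. (u \<bullet> unit_vec n i)\<^sup>2) = (\<Sum>u\<in>B. (u $ i)\<^sup>2)"
      using B i by (intro sum.cong) (auto simp: scalar_prod_right_unit subset_iff)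
    also have "sqnorm (unit_vec n i :: real Matrix.vec) = 1"
      using i by (simp add: sqnorm_def)
    finally show ?thesis by simp
  qed
  have "real (card B) = (\<Sum>u\<in>B. sqnorm u)"
    using assms by (simp add: orthonormal_def sqnorm_def)
  also have "\<dots> = (\<Sum>u\<in>B. \<Sum>i<n. (u $ i)\<^sup>2)"
    using B by (intro sum.cong sqnorm_eq_sum) auto
  also have "\<dots> = (\<Sum>i<n. \<Sum>u\<in>B. (u $ i)\<^sup>2)" by (rule sum.swap)
  also have "\<dots> \<le> (\<Sum>i<n. 1)" using le by (intro sum_mono) auto
  finally show ?thesis by simp
qed

section \<open>Orthonormal bases and the projection matrix\<close>

definition orthonormal_basis :: "nat \<Rightarrow> real Matrix.vec set \<Rightarrow> real Matrix.vec set \<Rightarrow> bool" where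
  "orthonormal_basis n W B \<longleftrightarrow> orthonormal n B \<and> B \<subseteq> W \<and> (\<forall>w\<in>W. expand n B w = w)"

text \<open>Take a largest orthonormal subset of \<open>W\<close> containing \<open>B0\<close>. A
  vector not fixed by its expansion leaves a nonzero residual, which after normalising would enlarge
  the set. Starting from \<open>B0\<close> lets one basis of an intersection be extended to both
  spaces.\<close>

lemma orthonormal_basis_extend:
  assumes W: "vec_subspace n W" and B0: "orthonormal n B0" "B0 \<subseteq> W"
  obtains B where "orthonormal_basis n W B" "B0 \<subseteq> B"
proof -
  let ?P = "\<lambda>k. \<exists>B. orthonormal n B \<and> B \<subseteq> W \<and> B0 \<subseteq> B \<and> card B = k"
  have "?P (card B0)" using B0 by blast
  moreover have "\<forall>k. ?P k \<longrightarrow> k \<le> n" using orthonormal_card_le by blast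
  ultimately obtain k where k: "?P k" "\<And>j. ?P j \<Longrightarrow> j \<le> k"
    using ex_has_greatest_nat[of ?P "card B0" "\<lambda>x. x" "Suc n"] by (metis le_imp_less_Suc)
  then obtain B where B: "orthonormal n B" "B \<subseteq> W" "B0 \<subseteq> B" "card B = k" by blast
  have fin: "finite B" and Bc: "B \<subseteq> carrier_vec n" using B by (auto simp: orthonormal_def)
  have "expand n B w = w" if w: "w \<in> W" for w
  proof (rule ccontr)
    assume neq: "expand n B w \<noteq> w"
    define r where "r = w - expand n B w"
    have wc: "w \<in> carrier_vec n" using w W vec_subspaceD(1) by blast
    have rW: "r \<in> W"
      unfolding r_def using W w B fin by (intro vec_subspace_minus expand_in_subspace) auto
    have rc: "r \<in> carrier_vec n" using wc by (simp add: r_def)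
    have "r \<noteq> 0\<^sub>v n"
    proof
      assume "r = 0\<^sub>v n"
      then have "w = expand n B w"
        unfolding r_def by (rule vec_eq_if_minus_eq_zero[OF wc expand_carrier])
      then show False using neq by simp
    qed
    then have pos: "0 < sqnorm r" using sqnorm_eq_0[OF rc] sqnorm_nonneg[of r] by simp
    define u where "u = (1 / sqrt (sqnorm r)) \<cdot>\<^sub>v r"
    have uc: "u \<in> carrier_vec n" using rc by (simp add: u_def)
    have uW: "u \<in> W" using rW W by (simp add: u_def vec_subspaceD)
    have uu: "u \<bullet> u = 1"
      using pos unfolding u_def sqnorm_def[symmetric] sqnorm_smult by (simp add: power_divide)
    have ur: "v \<bullet> u = 0" if "v \<in> B" for v
      using expand_orthogonal[OF B(1) that wc] that Bc rc
      by (auto simp: u_def r_def[symmetric] scalar_prod_smult_distrib[of _ n] subset_iff)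
    have ru: "u \<bullet> v = 0" if "v \<in> B" for v
      using ur[OF that] comm_scalar_prod[OF uc, of v] that Bc by auto
    have "u \<notin> B" using ur[of u] uu by auto
    moreover have "orthonormal n (insert u B)"
      using B(1) uu ur ru uc fin Bc \<open>u \<notin> B\<close> unfolding orthonormal_def by auto
    ultimately have "?P (Suc k)"
      using B uW fin by (intro exI[of _ "insert u B"]) auto
    then show False using k(2)[of "Suc k"] by simp
  qed
  then show ?thesis using that[of B] B by (simp add: orthonormal_basis_def)
qed

lemma orthonormal_basis_exists:
  assumes "vec_subspace n W"
  obtains B where "orthonormal_basis n W B"
  using orthonormal_basis_extend[OF assms, of "{}"] by (auto simp: orthonormal_def)

text \<open>The sum of u u^T over the basis is a witness for the definite description. Two
  candidates differ at v by a vector that lies in \<open>W\<close> and is orthogonal to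
  \<open>W\<close>, hence is 0.\<close>

lemma orth_proj_mult_vec:
  assumes W: "vec_subspace n W" and B: "orthonormal_basis n W B"
  shows "orth_proj n W \<in> carrier_mat n n"
    and "v \<in> carrier_vec n \<Longrightarrow> orth_proj n W *\<^sub>v v = expand n B v"
proof -
  have Bo: "orthonormal n B" "B \<subseteq> W" "finite B" and Bc: "B \<subseteq> carrier_vec n"
    using B by (auto simp: orthonormal_basis_def orthonormal_def)
  define P where "P = mat n n (\<lambda>(i, j). \<Sum>u\<in>B. u $ i * u $ j)"
  have Pc: "P \<in> carrier_mat n n" by (simp add: P_def)
  have Pv: "P *\<^sub>v v = expand n B v" if v: "v \<in> carrier_vec n" for v
  proof (rule eq_vecI)
    fix i assume "i < dim_vec (expand n B v)"
    then have i: "i < n" by simp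
    have "(P *\<^sub>v v) $ i = (\<Sum>j<n. \<Sum>u\<in>B. u $ i * u $ j * v $ j)"
      using i v by (auto simp: P_def scalar_prod_def atLeast0LessThan sum_distrib_right)
    also have "\<dots> = (\<Sum>u\<in>B. (u \<bullet> v) * u $ i)"
      using v by (subst sum.swap) (auto simp: scalar_prod_def atLeast0LessThan sum_distrib_right
          sum_distrib_left mult_ac intro!: sum.cong)
    finally show "(P *\<^sub>v v) $ i = expand n B v $ i" using i by (simp add: expand_def)
  qed (simp add: P_def)
  have inW: "expand n B v \<in> W" for v by (rule expand_in_subspace[OF W Bo(3,2)])
  have perp: "(v - expand n B v) \<bullet> w = 0" if v: "v \<in> carrier_vec n" and w: "w \<in> W" for v w
  proof -
    have wc: "w \<in> carrier_vec n" using w W vec_subspaceD(1) by blast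
    have "expand n B w = w" using B w by (simp add: orthonormal_basis_def)
    then have "v \<bullet> w = v \<bullet> expand n B w" by simp
    also have "\<dots> = expand n B w \<bullet> v" using v by (intro comm_scalar_prod) auto
    also have "\<dots> = (\<Sum>u\<in>B. (u \<bullet> w) * (u \<bullet> v))" by (rule expand_scalar_prod[OF Bc v])
    also have "\<dots> = expand n B v \<bullet> w" using expand_scalar_prod[OF Bc wc] by (simp add: mult.commute)
    finally show ?thesis using v wc by (simp add: minus_scalar_prod_distrib[of _ n])
  qed
  have "orth_proj n W = P"
    unfolding orth_proj_def
  proof (rule the_equality)
    show "P \<in> carrier_mat n n \<and>
      (\<forall>v\<in>carrier_vec n. P *\<^sub>v v \<in> W \<and> (\<forall>w\<in>W. (v - P *\<^sub>v v) \<bullet> w = 0))"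
      using Pc Pv inW perp by auto
  next
    fix Q assume Q: "Q \<in> carrier_mat n n \<and>
      (\<forall>v\<in>carrier_vec n. Q *\<^sub>v v \<in> W \<and> (\<forall>w\<in>W. (v - Q *\<^sub>v v) \<bullet> w = 0))"
    have eq: "Q *\<^sub>v v = P *\<^sub>v v" if v: "v \<in> carrier_vec n" for v
    proof -
      define d where "d = Q *\<^sub>v v - P *\<^sub>v v"
      have Qv: "Q *\<^sub>v v \<in> W" "Q *\<^sub>v v \<in> carrier_vec n" and Pv': "P *\<^sub>v v \<in> W" "P *\<^sub>v v \<in> carrier_vec n"
        using Q v Pv inW W vec_subspaceD(1) by auto
      have dW: "d \<in> W" unfolding d_def by (rule vec_subspace_minus[OF W Qv(1) Pv'(1)])
      have dc: "d \<in> carrier_vec n" using dW W vec_subspaceD(1) by blast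
      have "(v - Q *\<^sub>v v) \<bullet> d = 0" "(v - P *\<^sub>v v) \<bullet> d = 0"
        using Q v dW perp Pv by auto
      moreover have "d \<bullet> d = (Q *\<^sub>v v) \<bullet> d - (P *\<^sub>v v) \<bullet> d"
        using Qv Pv' dc by (subst (1) d_def, subst minus_scalar_prod_distrib[of _ n]) auto
      ultimately have "d \<bullet> d = 0"
        using v Qv Pv' dc by (simp add: minus_scalar_prod_distrib[of _ n])
      then have "d = 0\<^sub>v n" using sqnorm_eq_0[OF dc] by (simp add: sqnorm_def)
      then show ?thesis
        unfolding d_def by (rule vec_eq_if_minus_eq_zero[OF Qv(2) Pv'(2)])
    qed
    show "Q = P"
    proof (rule eq_matI)
      fix i j assume "i < dim_row P" "j < dim_col P"
      then have ij: "i < n" "j < n" by (auto simp: P_def)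
      have "X $$ (i, j) = (X *\<^sub>v unit_vec n j) $ i" if "X \<in> carrier_mat n n" for X :: "real mat"
        using that ij by (auto simp: scalar_prod_right_unit)
      then show "Q $$ (i, j) = P $$ (i, j)" using Q Pc eq[of "unit_vec n j"] by auto
    qed (use Q Pc in auto)
  qed
  then show "orth_proj n W \<in> carrier_mat n n"
    and "v \<in> carrier_vec n \<Longrightarrow> orth_proj n W *\<^sub>v v = expand n B v"
    using Pc Pv by auto
qed

lemma residual_eq:
  assumes W: "vec_subspace n W" and B: "orthonormal_basis n W B" and v: "v \<in> carrier_vec n"
  shows "(1\<^sub>m n - orth_proj n W) *\<^sub>v v = v - expand n B v"
  using orth_proj_mult_vec[OF W B] v by (simp add: minus_mult_distrib_mat_vec[of _ n n])

section \<open>Dimension of spans and rank of projections\<close>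

context
  fixes n :: nat
begin

interpretation vec_space "TYPE(real)" n .

lemma vec_subspace_span:
  assumes "X \<subseteq> carrier_vec n"
  shows "vec_subspace n (span X)"
proof -
  have "submodule class_ring (span X) V" using assms by (intro span_is_submodule) simp
  then show ?thesis
    by (auto simp: vec_subspace_def submodule_def module_vec_simps)
qed

lemma span_subset_subspace:
  assumes W: "vec_subspace n W" and "X \<subseteq> W"
  shows "span X \<subseteq> W"
proof -
  have "submodule class_ring W V"
    using W by (auto simp: vec_subspace_def submodule_def module_vec_simps vec_module)
  then show ?thesis using assms span_is_subset by blast
qed

lemma orthonormal_lin_indpt:
  assumes "orthonormal n B"
  shows "lin_indpt B"
proof
  have B: "B \<subseteq> carrier_vec n" "finite B" using assms by (auto simp: orthonormal_def)
  assume "lin_dep B"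
  then obtain A a v where A: "finite A" "A \<subseteq> B" "lincomb a A = 0\<^sub>v n" "v \<in> A" "a v \<noteq> 0"
    unfolding lin_dep_def by (auto simp: module_vec_simps)
  have vc: "v \<in> carrier_vec n" using A B by blast
  have Ac: "A \<subseteq> carrier_vec n" using A B by blast
  have "lincomb a A \<bullet> v = (\<Sum>u\<in>A. (a u \<cdot>\<^sub>v u) \<bullet> v)"
    unfolding lincomb_def using Ac vc
    by (subst finsum_scalar_prod_sum) (auto simp: module_vec_simps)
  also have "\<dots> = (\<Sum>u\<in>A. if u = v then a v else 0)"
    using Ac vc A(2,4) assms
    by (intro sum.cong) (auto simp: orthonormal_def subset_iff smult_scalar_prod_distrib[of _ n])
  also have "\<dots> = a v" using A by simp
  finally show False using A vc by simp
qed

lemma subspace_dim_eq_card: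
  assumes W: "vec_subspace n W" and B: "orthonormal_basis n W B"
  shows "subspace_dim n W = card B" and "span B = W"
proof -
  have Bo: "orthonormal n B" "B \<subseteq> W" "finite B" and Bc: "B \<subseteq> carrier_vec n"
    using B by (auto simp: orthonormal_basis_def orthonormal_def)
  show sp: "span B = W"
  proof
    show "span B \<subseteq> W" by (rule span_subset_subspace[OF W Bo(2)])
    have "expand n B w \<in> span B" for w
      using in_own_span[of B] Bc Bo by (intro expand_in_subspace vec_subspace_span) auto
    then show "W \<subseteq> span B" using B unfolding orthonormal_basis_def by (metis subsetI)
  qed
  have max: "maximal B (\<lambda>T. T \<subseteq> B \<and> lin_indpt T)"
    using orthonormal_lin_indpt[OF Bo(1)] unfolding maximal_def by blast
  have "vectorspace.dim class_ring (span_vs B) = card B"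
    by (rule dim_span[OF _ Bo(3) max]) (simp add: Bc)
  then show "subspace_dim n W = card B" by (simp add: subspace_dim_def sp)
qed

lemma subspace_dim_span_le:
  assumes "X \<subseteq> carrier_vec n" "finite X"
  shows "subspace_dim n (span X) \<le> card X"
proof -
  obtain U where U: "finite U" "maximal U (\<lambda>T. T \<subseteq> X \<and> lin_indpt T)"
    using maximal_exists_superset[of X "\<lambda>T. T \<subseteq> X \<and> lin_indpt T" "{}"] assms
      finite_lin_indpt2[of "{}"] by auto
  have "vectorspace.dim class_ring (span_vs X) = card U"
    by (rule dim_span[OF _ assms(2) U(2)]) (simp add: assms)
  moreover have "U \<subseteq> X" using U by (simp add: maximal_def)
  ultimately show ?thesis using assms by (simp add: subspace_dim_def card_mono)
qed

text \<open>The column space of the projection is its range, which is \<open>W\<close>.\<close>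

lemma rank_orth_proj:
  assumes W: "vec_subspace n W"
  shows "rank (orth_proj n W) = subspace_dim n W"
proof -
  obtain B where B: "orthonormal_basis n W B" by (rule orthonormal_basis_exists[OF W])
  note P = orth_proj_mult_vec[OF W B]
  have Wc: "W \<subseteq> carrier_vec n" by (rule vec_subspaceD(1)[OF W])
  have "span (set (cols (orth_proj n W))) = col_space (orth_proj n W)"
    by (simp add: col_space_def)
  also have "\<dots> = {y \<in> carrier_vec n. \<exists>x\<in>carrier_vec n. expand n B x = y}"
    using P by (subst col_space_eq[OF P(1)]) (auto simp: carrier_matD[OF P(1)])
  also have "\<dots> = W"
    using B W Wc by (auto simp: orthonormal_basis_def orthonormal_def intro: expand_in_subspace)
  finally show ?thesis by (simp add: rank_def subspace_dim_def)
qed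

text \<open>Replacing \<open>X\<close> by an orthonormal basis of its span reduces the claim to
  counting generators.\<close>

lemma subspace_dim_span_Un_le:
  assumes X: "X \<subseteq> carrier_vec n" and Y: "Y \<subseteq> carrier_vec n" "finite Y"
  shows "subspace_dim n (span (X \<union> Y)) \<le> subspace_dim n (span X) + card Y"
proof -
  have sX: "vec_subspace n (span X)" by (rule vec_subspace_span[OF X])
  obtain B where B: "orthonormal_basis n (span X) B" by (rule orthonormal_basis_exists[OF sX])
  have Bc: "B \<subseteq> carrier_vec n" "finite B" using B by (auto simp: orthonormal_basis_def orthonormal_def)
  have "span (X \<union> Y) = span (B \<union> Y)"
  proof
    have BY: "vec_subspace n (span (B \<union> Y))" using Bc Y by (intro vec_subspace_span) auto
    have "X \<subseteq> span X" using X by (intro in_own_span) simp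
    also have "span X = span B" using subspace_dim_eq_card(2)[OF sX B] by simp
    also have "\<dots> \<subseteq> span (B \<union> Y)" by (rule span_is_monotone) simp
    finally have "X \<union> Y \<subseteq> span (B \<union> Y)" using in_own_span[of "B \<union> Y"] Bc Y by auto
    then show "span (X \<union> Y) \<subseteq> span (B \<union> Y)" by (rule span_subset_subspace[OF BY])
  next
    have XY: "vec_subspace n (span (X \<union> Y))" using X Y by (intro vec_subspace_span) auto
    have "B \<subseteq> span X" using B by (simp add: orthonormal_basis_def)
    also have "\<dots> \<subseteq> span (X \<union> Y)" by (rule span_is_monotone) simp
    finally have "B \<union> Y \<subseteq> span (X \<union> Y)" using in_own_span[of "X \<union> Y"] X Y by auto
    then show "span (B \<union> Y) \<subseteq> span (X \<union> Y)" by (rule span_subset_subspace[OF XY])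
  qed
  moreover have "subspace_dim n (span (B \<union> Y)) \<le> card (B \<union> Y)"
    using Bc Y by (intro subspace_dim_span_le) auto
  moreover have "card (B \<union> Y) \<le> card B + card Y" by (rule card_Un_le)
  ultimately show ?thesis using subspace_dim_eq_card(1)[OF sX B] by simp
qed

end

text \<open>\<open>C\<close> completes a basis of the intersection to one of \<open>V\<close>. The
  squared coefficients of x along the common part occur in both residuals and cancel, and the
  remaining ones along \<open>T\<close> have a favourable sign. So the quadratic noise has dimension
  dim V minus that of the intersection, not dim V.\<close>

lemma residual_difference:
  assumes V: "vec_subspace n V" and T: "vec_subspace n T" and mu: "mu \<in> T"
  obtains C w where "orthonormal n C" "card C + subspace_dim n (V \<inter> T) = subspace_dim n V"
    "w = (1\<^sub>m n - orth_proj n V) *\<^sub>v mu" "w \<in> carrier_vec n"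
    "\<And>x. x \<in> carrier_vec n \<Longrightarrow>
      sqnorm w + 2 * (w \<bullet> x) - (\<Sum>u\<in>C. (u \<bullet> x)\<^sup>2)
      \<le> sqnorm ((1\<^sub>m n - orth_proj n V) *\<^sub>v (mu + x)) - sqnorm ((1\<^sub>m n - orth_proj n T) *\<^sub>v (mu + x))"
proof -
  have muc: "mu \<in> carrier_vec n" using mu T vec_subspaceD(1) by blast
  have I: "vec_subspace n (V \<inter> T)" by (rule vec_subspace_Int[OF V T])
  obtain B0 where B0: "orthonormal_basis n (V \<inter> T) B0" by (rule orthonormal_basis_exists[OF I])
  have B0': "orthonormal n B0" "B0 \<subseteq> V" "B0 \<subseteq> T" using B0 by (auto simp: orthonormal_basis_def)
  obtain B where B: "orthonormal_basis n V B" "B0 \<subseteq> B"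
    by (rule orthonormal_basis_extend[OF V B0'(1,2)])
  obtain Bt where Bt: "orthonormal_basis n T Bt" "B0 \<subseteq> Bt"
    by (rule orthonormal_basis_extend[OF T B0'(1,3)])
  have o: "orthonormal n B" "orthonormal n Bt" and f: "finite B" "finite Bt"
    and Bc: "B \<subseteq> carrier_vec n" "Bt \<subseteq> carrier_vec n"
    using B Bt by (auto simp: orthonormal_basis_def orthonormal_def)
  define C where "C = B - B0"
  define w where "w = (1\<^sub>m n - orth_proj n V) *\<^sub>v mu"
  have C: "orthonormal n C" using o by (auto simp: C_def orthonormal_def)
  have "card C + card B0 = card B"
    using B(2) f by (simp add: C_def card_Diff_subset finite_subset card_mono)
  then have card: "card C + subspace_dim n (V \<inter> T) = subspace_dim n V"
    using subspace_dim_eq_card(1)[OF I B0] subspace_dim_eq_card(1)[OF V B(1)] by simp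
  have w: "w = mu - expand n B mu" unfolding w_def by (rule residual_eq[OF V B(1) muc])
  have wc: "w \<in> carrier_vec n" using muc by (simp add: w)
  have wu: "u \<bullet> w = 0" if "u \<in> B" for u
    using expand_orthogonal[OF o(1) that muc] by (simp add: w)
  have exp_add: "expand n A (mu + x) = expand n A mu + expand n A x"
    if "A \<subseteq> carrier_vec n" "x \<in> carrier_vec n" for A x
    using that muc by (intro eq_vecI)
      (auto simp: expand_def scalar_prod_add_distrib[of _ n] subset_iff algebra_simps sum.distrib
        intro!: sum.cong)
  have main: "sqnorm w + 2 * (w \<bullet> x) - (\<Sum>u\<in>C. (u \<bullet> x)\<^sup>2)
      \<le> sqnorm ((1\<^sub>m n - orth_proj n V) *\<^sub>v (mu + x)) - sqnorm ((1\<^sub>m n - orth_proj n T) *\<^sub>v (mu + x))"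
    if x: "x \<in> carrier_vec n" for x
  proof -
    have "(1\<^sub>m n - orth_proj n V) *\<^sub>v (mu + x) = w + (x - expand n B x)"
      using muc x by (subst residual_eq[OF V B(1)]) (auto simp: w exp_add[OF Bc(1)] intro!: eq_vecI)
    then have "sqnorm ((1\<^sub>m n - orth_proj n V) *\<^sub>v (mu + x)) =
        sqnorm w + 2 * (w \<bullet> (x - expand n B x)) + sqnorm (x - expand n B x)"
      using sqnorm_add[OF wc, of "x - expand n B x"] x by simp
    also have "w \<bullet> (x - expand n B x) = w \<bullet> x - expand n B x \<bullet> w"
      using wc x comm_scalar_prod[OF wc, of "expand n B x"] by (simp add: scalar_prod_minus_distrib[of _ n])
    also have "expand n B x \<bullet> w = 0" using expand_scalar_prod[OF Bc(1) wc] wu by simp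
    also have "sqnorm (x - expand n B x) = sqnorm x - (\<Sum>u\<in>B. (u \<bullet> x)\<^sup>2)"
      by (rule bessel[OF o(1) x])
    finally have 1: "sqnorm ((1\<^sub>m n - orth_proj n V) *\<^sub>v (mu + x)) =
        sqnorm w + 2 * (w \<bullet> x) + sqnorm x - (\<Sum>u\<in>B. (u \<bullet> x)\<^sup>2)" by simp
    \<comment> \<open>The signal lies in \<open>T\<close>, so the residual of \<open>T\<close> is
      pure noise.\<close>
    have "expand n Bt mu = mu" using Bt mu by (simp add: orthonormal_basis_def)
    then have "(1\<^sub>m n - orth_proj n T) *\<^sub>v (mu + x) = x - expand n Bt x"
      using muc x by (subst residual_eq[OF T Bt(1)]) (auto simp: exp_add[OF Bc(2)] intro!: eq_vecI)
    then have 2: "sqnorm ((1\<^sub>m n - orth_proj n T) *\<^sub>v (mu + x)) = sqnorm x - (\<Sum>u\<in>Bt. (u \<bullet> x)\<^sup>2)"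
      using bessel[OF o(2) x] by simp
    have "(\<Sum>u\<in>B. (u \<bullet> x)\<^sup>2) = (\<Sum>u\<in>C. (u \<bullet> x)\<^sup>2) + (\<Sum>u\<in>B0. (u \<bullet> x)\<^sup>2)"
      unfolding C_def using B(2) f by (simp add: sum.subset_diff)
    moreover have "(\<Sum>u\<in>B0. (u \<bullet> x)\<^sup>2) \<le> (\<Sum>u\<in>Bt. (u \<bullet> x)\<^sup>2)"
      using Bt(2) f by (intro sum_mono2) auto
    ultimately show ?thesis using 1 2 by linarith
  qed
  show ?thesis by (rule that[OF C card w_def wc main])
qed

section \<open>The error event of a single pair\<close>

text \<open>Passes from an orthonormal set to the coordinate form in which the tail of quadratic
  forms is stated; the matrix is the sum of u u^T.\<close>

lemma orthonormal_projection_matrix: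
  assumes B: "orthonormal n B"
  shows "projection_matrix n (\<lambda>i j. \<Sum>u\<in>B. u $ i * u $ j)"
    and "(\<Sum>i<n. \<Sum>u\<in>B. u $ i * u $ i) = real (card B)"
    and "(\<Sum>i<n. \<Sum>j<n. (\<Sum>u\<in>B. u $ i * u $ j) * x i * x j) = (\<Sum>u\<in>B. (\<Sum>i<n. u $ i * x i)\<^sup>2)"
proof -
  have fin: "finite B" and Bc: "B \<subseteq> carrier_vec n" using B by (auto simp: orthonormal_def)
  have dot: "(\<Sum>j<n. u $ j * v $ j) = (if u = v then 1 else 0)" if "u \<in> B" "v \<in> B" for u v
  proof -
    have "(\<Sum>j<n. u $ j * v $ j) = u \<bullet> v"
      using that Bc by (auto simp: scalar_prod_def atLeast0LessThan)
    then show ?thesis using that B by (simp add: orthonormal_def)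
  qed
  show "projection_matrix n (\<lambda>i j. \<Sum>u\<in>B. u $ i * u $ j)"
  proof
    show "(\<Sum>u\<in>B. u $ i * u $ j) = (\<Sum>u\<in>B. u $ j * u $ i)" for i j
      by (simp add: mult.commute)
    fix i k
    have "(\<Sum>j<n. (\<Sum>u\<in>B. u $ i * u $ j) * (\<Sum>v\<in>B. v $ j * v $ k))
        = (\<Sum>j<n. \<Sum>u\<in>B. \<Sum>v\<in>B. u $ i * v $ k * (u $ j * v $ j))"
      by (simp add: sum_product mult_ac)
    also have "\<dots> = (\<Sum>u\<in>B. \<Sum>j<n. \<Sum>v\<in>B. u $ i * v $ k * (u $ j * v $ j))"
      by (rule sum.swap)
    also have "\<dots> = (\<Sum>u\<in>B. \<Sum>v\<in>B. \<Sum>j<n. u $ i * v $ k * (u $ j * v $ j))"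
      by (intro sum.cong refl sum.swap)
    also have "\<dots> = (\<Sum>u\<in>B. \<Sum>v\<in>B. u $ i * v $ k * (if u = v then 1 else 0))"
      by (intro sum.cong refl) (simp only: sum_distrib_left[symmetric] dot)
    also have "\<dots> = (\<Sum>u\<in>B. u $ i * u $ k)"
      using fin by (intro sum.cong refl) (simp add: if_distrib cong: if_cong)
    finally show "(\<Sum>j<n. (\<Sum>u\<in>B. u $ i * u $ j) * (\<Sum>u\<in>B. u $ j * u $ k)) = (\<Sum>u\<in>B. u $ i * u $ k)" .
  qed
  have "(\<Sum>i<n. \<Sum>u\<in>B. u $ i * u $ i) = (\<Sum>u\<in>B. \<Sum>i<n. u $ i * u $ i)" by (rule sum.swap)
  also have "\<dots> = (\<Sum>u\<in>B. 1)" by (intro sum.cong refl) (simp add: dot)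
  finally show "(\<Sum>i<n. \<Sum>u\<in>B. u $ i * u $ i) = real (card B)" by simp
  have "(\<Sum>i<n. \<Sum>j<n. (\<Sum>u\<in>B. u $ i * u $ j) * x i * x j)
      = (\<Sum>i<n. \<Sum>j<n. \<Sum>u\<in>B. (u $ i * x i) * (u $ j * x j))"
    by (simp add: sum_distrib_right sum_distrib_left mult_ac)
  also have "\<dots> = (\<Sum>i<n. \<Sum>u\<in>B. \<Sum>j<n. (u $ i * x i) * (u $ j * x j))"
    by (intro sum.cong refl sum.swap)
  also have "\<dots> = (\<Sum>u\<in>B. \<Sum>i<n. \<Sum>j<n. (u $ i * x i) * (u $ j * x j))" by (rule sum.swap)
  also have "\<dots> = (\<Sum>u\<in>B. (\<Sum>i<n. u $ i * x i)\<^sup>2)"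
    by (simp add: power2_eq_square sum_product)
  finally show "(\<Sum>i<n. \<Sum>j<n. (\<Sum>u\<in>B. u $ i * u $ j) * x i * x j) = (\<Sum>u\<in>B. (\<Sum>i<n. u $ i * x i)\<^sup>2)" .
qed

section \<open>Tail bounds for the noise vector\<close>

definition noise_vec :: "nat \<Rightarrow> (nat \<Rightarrow> 'a \<Rightarrow> real) \<Rightarrow> 'a \<Rightarrow> real Matrix.vec" where
  "noise_vec n eps \<omega> = Matrix.vec n (\<lambda>i. eps i \<omega>)"

lemma noise_vec_carrier [simp]: "noise_vec n eps \<omega> \<in> carrier_vec n"
  by (simp add: noise_vec_def)

lemma scalar_prod_noise_vec: "u \<bullet> noise_vec n eps \<omega> = (\<Sum>i<n. u $ i * eps i \<omega>)"
  by (simp add: noise_vec_def scalar_prod_def atLeast0LessThan)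

lemma noise_model_measurable:
  assumes "noise_model M n \<sigma> alpha zeta eps"
  shows "(\<lambda>\<omega>. u \<bullet> noise_vec n eps \<omega>) \<in> borel_measurable M"
proof -
  have "eps i \<in> borel_measurable M" if "i < n" for i
    using assms that by (auto simp: noise_model_def prob_space.indep_vars_def2)
  then show ?thesis
    unfolding scalar_prod_noise_vec
    by (intro borel_measurable_sum borel_measurable_times borel_measurable_const) auto
qed

text \<open>Dividing by sigma normalises the variance. \<open>K\<close> serves all measures, sample
  sizes and values of sigma at once.\<close>

lemma noise_model_weibull:
  fixes alpha zeta :: real
  assumes alpha: "0 < alpha" "alpha \<le> 2" and zeta: "0 < zeta"
  obtains K where "1 \<le> K"
    "\<And>(M :: 'a measure) n \<sigma> eps. 0 < \<sigma> \<Longrightarrow> noise_model M n \<sigma> alpha zeta eps \<Longrightarrow>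
      weibull_noise M n (\<lambda>i \<omega>. eps i \<omega> / \<sigma>) alpha K"
proof (rule weibull_tail_moments[OF alpha(1) zeta, where 'a = 'a])
  fix K :: real assume K: "1 \<le> K"
    "\<And>(M :: 'a measure) X m. prob_space M \<Longrightarrow> X \<in> borel_measurable M \<Longrightarrow>
      (\<And>t. 2 \<le> t \<Longrightarrow> measure M {\<omega> \<in> space M. t < \<bar>X \<omega>\<bar>} \<le> 2 * exp (- ((t / zeta) powr alpha))) \<Longrightarrow>
      1 \<le> m \<Longrightarrow> integrable M (\<lambda>\<omega>. \<bar>X \<omega>\<bar> ^ m) \<and>
        (\<integral>\<omega>. \<bar>X \<omega>\<bar> ^ m \<partial>M) \<le> (K * real m powr (1 / alpha)) ^ m"
  show thesis
  proof (rule that[OF K(1)])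
    fix M :: "'a measure" and n \<sigma> eps
    assume \<sigma>: "0 < \<sigma>" and nm: "noise_model M n \<sigma> alpha zeta eps"
    interpret prob_space M using nm by (simp add: noise_model_def)
    have ind: "indep_vars (\<lambda>_. borel) eps {..<n}" using nm by (simp add: noise_model_def)
    have meas[measurable]: "eps i \<in> borel_measurable M" if "i < n" for i
      using ind that by (auto simp: indep_vars_def2)
    have mom: "integrable M (\<lambda>\<omega>. \<bar>eps i \<omega> / \<sigma>\<bar> ^ m) \<and>
        (\<integral>\<omega>. \<bar>eps i \<omega> / \<sigma>\<bar> ^ m \<partial>M) \<le> (K * real m powr (1 / alpha)) ^ m"
      if i: "i < n" and m: "1 \<le> m" for i m
    proof (rule K(2)[OF prob_space_axioms _ _ m])
      show "(\<lambda>\<omega>. eps i \<omega> / \<sigma>) \<in> borel_measurable M" using meas[OF i] by measurable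
      show "prob {\<omega> \<in> space M. t < \<bar>eps i \<omega> / \<sigma>\<bar>} \<le> 2 * exp (- ((t / zeta) powr alpha))" if "2 \<le> t" for t
        using nm i that by (simp add: noise_model_def)
    qed
    show "weibull_noise M n (\<lambda>i \<omega>. eps i \<omega> / \<sigma>) alpha K"
    proof
      show "indep_vars (\<lambda>_. borel) (\<lambda>i \<omega>. eps i \<omega> / \<sigma>) {..<n}"
        by (rule indep_vars_compose2[OF ind]) auto
      fix i m assume i: "i < n"
      show "expectation (\<lambda>\<omega>. eps i \<omega> / \<sigma>) = 0"
        using nm i by (simp add: noise_model_def)
      show "expectation (\<lambda>\<omega>. (eps i \<omega> / \<sigma>)\<^sup>2) = 1"
        using nm i \<sigma> by (simp add: noise_model_def power_divide)
      show "integrable M (\<lambda>\<omega>. \<bar>eps i \<omega> / \<sigma>\<bar> ^ m)"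
        using mom[OF i, of m] by (cases "m = 0") auto
      assume "1 \<le> m"
      then show "expectation (\<lambda>\<omega>. \<bar>eps i \<omega> / \<sigma>\<bar> ^ m) \<le> (K * real m powr (1 / alpha)) ^ m"
        using mom[OF i] by blast
    qed (use alpha K(1) in auto)
  qed
qed

text \<open>Everything quantitative that the selection argument uses about the noise. The second
  bound is scaled by \<open>sqnorm w\<close>, so that the residual signal can be inserted as it
  is.\<close>

definition noise_tail_bounds ::
    "'a measure \<Rightarrow> nat \<Rightarrow> real \<Rightarrow> (nat \<Rightarrow> 'a \<Rightarrow> real) \<Rightarrow> real \<Rightarrow> real \<Rightarrow> real \<Rightarrow> bool" where
  "noise_tail_bounds M n \<sigma> eps h C c \<longleftrightarrow>
     (\<forall>B t. orthonormal n B \<longrightarrow> 0 \<le> t \<longrightarrow>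
       measure M {\<omega> \<in> space M. 2 * real (card B) + t
           \<le> (\<Sum>u\<in>B. (u \<bullet> noise_vec n eps \<omega>)\<^sup>2) / \<sigma>\<^sup>2}
         \<le> C * exp (- c * t powr h)) \<and>
     (\<forall>w x. w \<in> carrier_vec n \<longrightarrow> 0 < sqnorm w \<longrightarrow> 0 \<le> x \<longrightarrow>
       measure M {\<omega> \<in> space M. x * sqnorm w \<le> (w \<bullet> noise_vec n eps \<omega>)\<^sup>2 / \<sigma>\<^sup>2}
         \<le> C * exp (- c * x powr h))"

lemma noise_tails:
  fixes alpha zeta :: real
  assumes alpha: "0 < alpha" "alpha \<le> 2" and zeta: "0 < zeta"
  obtains C c :: real where "0 < C" "0 < c"
    "\<And>(M :: 'a measure) n \<sigma> eps. 0 < \<sigma> \<Longrightarrow> noise_model M n \<sigma> alpha zeta eps \<Longrightarrow>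
      noise_tail_bounds M n \<sigma> eps (alpha / 2) C c"
proof (rule noise_model_weibull[OF alpha zeta, where 'a = 'a])
  fix K :: real assume K: "1 \<le> K"
    "\<And>(M :: 'a measure) n \<sigma> eps. 0 < \<sigma> \<Longrightarrow> noise_model M n \<sigma> alpha zeta eps \<Longrightarrow>
      weibull_noise M n (\<lambda>i \<omega>. eps i \<omega> / \<sigma>) alpha K"
  show thesis
  proof (rule qform_tail[OF alpha K(1), where 'a = 'a])
    fix C0 c0 :: real assume C0: "0 < C0" "0 < c0" and tail:
      "\<And>(M :: 'a measure) n e Q t. weibull_quadratic M n e alpha K Q \<Longrightarrow> 0 \<le> t \<Longrightarrow>
        measure M {\<omega> \<in> space M. 2 * (\<Sum>i<n. Q i i) + t \<le> (\<Sum>i<n. \<Sum>j<n. Q i j * e i \<omega> * e j \<omega>)}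
        \<le> C0 * exp (- c0 * t powr (alpha / 2))"
    have quad: "measure M {\<omega> \<in> space M. 2 * real (card B) + t \<le> (\<Sum>u\<in>B. (u \<bullet> noise_vec n eps \<omega>)\<^sup>2) / \<sigma>\<^sup>2}
        \<le> C0 * exp (- c0 * t powr (alpha / 2))"
      if \<sigma>: "0 < \<sigma>" and nm: "noise_model M n \<sigma> alpha zeta eps" and B: "orthonormal n B" and t: "0 \<le> t"
      for M :: "'a measure" and n \<sigma> eps B t
    proof -
      note P = orthonormal_projection_matrix[OF B]
      have "weibull_quadratic M n (\<lambda>i \<omega>. eps i \<omega> / \<sigma>) alpha K (\<lambda>i j. \<Sum>u\<in>B. u $ i * u $ j)"
        by (intro weibull_quadratic.intro K(2)[OF \<sigma> nm] P(1))
      from tail[OF this t] show ?thesis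
        unfolding P(2,3) scalar_prod_noise_vec
        by (simp add: power_divide sum_divide_distrib[symmetric])
    qed
    \<comment> \<open>A linear form is the quadratic form of one normalised vector, with 2 * 1 + (x
      - 2) = x. For x \<ge> 4 the loss x - 2 \<ge> x / 2 goes into \<open>c\<close>; for x < 4 the
      choice of \<open>C\<close> makes the bound at least 1.\<close>
    define c where "c = c0 * (1 / 2) powr (alpha / 2)"
    define C where "C = max C0 (exp (c * 4 powr (alpha / 2)))"
    have c: "0 < c" using C0 by (simp add: c_def)
    have cle: "c \<le> c0" using C0 alpha powr_mono2[of "alpha / 2" "1 / 2" 1] by (simp add: c_def)
    show thesis
    proof (rule that[of C c])
      show "0 < C" using C0 by (simp add: C_def)
      show "0 < c" by (rule c)
    next
      fix M :: "'a measure" and n \<sigma> eps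
      assume \<sigma>: "0 < \<sigma>" and nm: "noise_model M n \<sigma> alpha zeta eps"
      interpret prob_space M using nm by (simp add: noise_model_def)
      show "noise_tail_bounds M n \<sigma> eps (alpha / 2) C c"
        unfolding noise_tail_bounds_def
      proof (intro conjI allI impI)
        fix B and t :: real
        assume "orthonormal n B" "0 \<le> t"
        with \<sigma> nm have "prob {\<omega> \<in> space M. 2 * real (card B) + t
              \<le> (\<Sum>u\<in>B. (u \<bullet> noise_vec n eps \<omega>)\<^sup>2) / \<sigma>\<^sup>2}
            \<le> C0 * exp (- c0 * t powr (alpha / 2))" by (intro quad)
        also have "\<dots> \<le> C * exp (- c * t powr (alpha / 2))"
          using cle C0 by (intro mult_mono) (auto simp: C_def mult_right_mono)
        finally show "prob {\<omega> \<in> space M. 2 * real (card B) + t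
              \<le> (\<Sum>u\<in>B. (u \<bullet> noise_vec n eps \<omega>)\<^sup>2) / \<sigma>\<^sup>2}
            \<le> C * exp (- c * t powr (alpha / 2))" .
      next
        fix w and x :: real
        assume w: "w \<in> carrier_vec n" "0 < sqnorm w" and x: "0 \<le> x"
        let ?A = "{\<omega> \<in> space M. x * sqnorm w \<le> (w \<bullet> noise_vec n eps \<omega>)\<^sup>2 / \<sigma>\<^sup>2}"
        show "prob ?A \<le> C * exp (- c * x powr (alpha / 2))"
        proof (cases "4 \<le> x")
          case False
          then have "c * x powr (alpha / 2) \<le> c * 4 powr (alpha / 2)"
            using x alpha c by (intro mult_left_mono powr_mono2) auto
          then have "1 \<le> exp (c * 4 powr (alpha / 2)) * exp (- c * x powr (alpha / 2))"
            by (simp flip: exp_add)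
          also have "\<dots> \<le> C * exp (- c * x powr (alpha / 2))"
            by (intro mult_right_mono) (auto simp: C_def)
          finally show ?thesis using prob_le_1[of ?A] by linarith
        next
          case True
          define u where "u = (1 / sqrt (sqnorm w)) \<cdot>\<^sub>v w"
          have uc: "u \<in> carrier_vec n" using w by (simp add: u_def)
          have "u \<bullet> u = 1"
            using w(2) unfolding u_def sqnorm_def[symmetric] sqnorm_smult by (simp add: power_divide)
          then have B: "orthonormal n {u}" using uc by (simp add: orthonormal_def)
          have sq: "(u \<bullet> noise_vec n eps \<omega>)\<^sup>2 = (w \<bullet> noise_vec n eps \<omega>)\<^sup>2 / sqnorm w" for \<omega>
            using w by (simp add: u_def smult_scalar_prod_distrib[of _ n] power_divide)
          have iff: "x * sqnorm w \<le> (w \<bullet> noise_vec n eps \<omega>)\<^sup>2 / \<sigma>\<^sup>2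
              \<longleftrightarrow> x \<le> (u \<bullet> noise_vec n eps \<omega>)\<^sup>2 / \<sigma>\<^sup>2" for \<omega>
          proof -
            have "(w \<bullet> noise_vec n eps \<omega>)\<^sup>2 / \<sigma>\<^sup>2 = (u \<bullet> noise_vec n eps \<omega>)\<^sup>2 / \<sigma>\<^sup>2 * sqnorm w"
              unfolding sq using w(2) by simp
            then show ?thesis using w(2) by (simp only: mult_le_cancel_right_pos)
          qed
          have A: "?A = {\<omega> \<in> space M. 2 * real (card {u}) + (x - 2) \<le> (\<Sum>u\<in>{u}. (u \<bullet> noise_vec n eps \<omega>)\<^sup>2) / \<sigma>\<^sup>2}"
            unfolding iff by simp
          have "prob ?A \<le> C0 * exp (- c0 * (x - 2) powr (alpha / 2))"
            unfolding A using True by (intro quad[OF \<sigma> nm B]) simp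
          also have "\<dots> \<le> C * exp (- c * x powr (alpha / 2))"
          proof (intro mult_mono)
            have "x powr (alpha / 2) * (1 / 2) powr (alpha / 2) = (x * (1 / 2)) powr (alpha / 2)"
              by (rule powr_mult[symmetric])
            also have "\<dots> \<le> (x - 2) powr (alpha / 2)"
              using True alpha by (intro powr_mono2) auto
            finally have "c0 * (x powr (alpha / 2) * (1 / 2) powr (alpha / 2)) \<le> c0 * (x - 2) powr (alpha / 2)"
              using C0 by (intro mult_left_mono) auto
            then show "exp (- c0 * (x - 2) powr (alpha / 2)) \<le> exp (- c * x powr (alpha / 2))"
              by (simp add: c_def mult_ac)
          qed (use C0 in \<open>auto simp: C_def\<close>)
          finally show ?thesis .
        qed
      qed
    qed
  qed
qed

section \<open>Model spaces as spans of design columns\<close>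

context
  fixes n :: nat
begin

interpretation vec_space "TYPE(real)" n .

text \<open>\<open>pick S\<close> enumerates \<open>S\<close> in increasing order. The range
  assumption matters, as \<open>submatrix\<close> drops indices beyond the last column.\<close>

lemma set_cols_submatrix:
  assumes S: "S \<subseteq> {..<dim_col A}"
  shows "set (cols (submatrix A UNIV S)) = col A ` S"
proof -
  have dr: "dim_row (submatrix A UNIV S) = dim_row A" by (simp add: dim_submatrix)
  have Seq: "{j. j < dim_col A \<and> j \<in> S} = S" using S by auto
  have dc: "dim_col (submatrix A UNIV S) = card S" by (simp add: dim_submatrix Seq)
  have fin: "finite S" using S finite_subset by blast
  have pick: "pick S k \<in> S" if "k < card S" for k using that by (simp add: pick_in_set_le)
  have col: "col (submatrix A UNIV S) k = col A (pick S k)" if k: "k < card S" for k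
  proof (rule eq_vecI)
    fix i assume "i < dim_vec (col A (pick S k))"
    then have i: "i < dim_row A" by simp
    have "pick S k < dim_col A" using pick[OF k] S by auto
    moreover have "submatrix A UNIV S $$ (i, k) = A $$ (pick UNIV i, pick S k)"
      by (rule submatrix_index) (use i k Seq in auto)
    ultimately show "col (submatrix A UNIV S) k $ i = col A (pick S k) $ i"
      using i k dr dc by (simp add: pick_UNIV)
  qed (simp add: dr)
  have "set (cols (submatrix A UNIV S)) = (\<lambda>k. col A (pick S k)) ` {..<card S}"
    using col by (auto simp: cols_def dc)
  also have "\<dots> = col A ` (pick S ` {..<card S})" by (simp add: image_image)
  also have "pick S ` {..<card S} = S"
  proof
    show "pick S ` {..<card S} \<subseteq> S" using pick by auto
    show "S \<subseteq> pick S ` {..<card S}"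
    proof
      fix j assume j: "j \<in> S"
      have "{a \<in> S. a < j} \<subset> S" using j by auto
      then have "card {a \<in> S. a < j} < card S" using fin by (rule psubset_card_mono[rotated])
      moreover have "pick S (card {a \<in> S. a < j}) = j" using j by (rule pick_card_in_set)
      ultimately show "j \<in> pick S ` {..<card S}" by force
    qed
  qed
  finally show ?thesis .
qed

lemma model_space_eq_span:
  assumes "nobs G = n" "snd p \<subseteq> {..<dim_col (design G (fst p))}"
  shows "model_space G p = span (col (design G (fst p)) ` snd p)"
  using assms by (simp add: model_space_def col_space_def set_cols_submatrix)

lemma col_image_carrier:
  "dim_row A = n \<Longrightarrow> col A ` S \<subseteq> carrier_vec n"
  by (auto intro: carrier_vecI)

lemma vec_subspace_model_space:
  assumes "nobs G = n" "snd p \<subseteq> {..<dim_col (design G (fst p))}" "dim_row (design G (fst p)) = n"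
  shows "vec_subspace n (model_space G p)"
  using assms by (simp add: model_space_eq_span vec_subspace_span col_image_carrier)

lemma model_space_mono:
  assumes "nobs G = n" "S \<subseteq> T" "T \<subseteq> {..<dim_col (design G m)}"
  shows "model_space G (m, S) \<subseteq> model_space G (m, T)"
  using assms span_is_monotone[of "col (design G m) ` S" "col (design G m) ` T"]
  by (subst (1 2) model_space_eq_span) (auto simp: image_mono)

lemma subspace_dim_model_space_le:
  assumes "nobs G = n" "dim_row (design G m) = n" "S \<subseteq> T" "T \<subseteq> {..<dim_col (design G m)}"
  shows "subspace_dim n (model_space G (m, T)) \<le> subspace_dim n (model_space G (m, S)) + card (T - S)"
proof -
  let ?X = "col (design G m) ` S" and ?Y = "col (design G m) ` (T - S)"
  have fin: "finite (T - S)" using assms(4) finite_subset by blast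
  have XY: "?X \<union> ?Y = col (design G m) ` T" using assms by auto
  have e1: "model_space G (m, T) = span (?X \<union> ?Y)"
    unfolding XY using assms by (simp add: model_space_eq_span)
  have e2: "model_space G (m, S) = span ?X"
    using assms by (subst model_space_eq_span) auto
  have l: "subspace_dim n (span (?X \<union> ?Y)) \<le> subspace_dim n (span ?X) + card ?Y"
    using assms fin by (intro subspace_dim_span_Un_le col_image_carrier) auto
  have "card ?Y \<le> card (T - S)" by (rule card_image_le[OF fin])
  then show ?thesis unfolding e1 e2 using l by linarith
qed

end

text \<open>The slack \<open>x\<close> is shared by the two noise terms. If the quadratic one stays
  below 2 * card B + x, then \<open>key\<close> forces minus the linear one to be at least APP/4 +
  x/2, whose square is at least x/2 * APP by the inequality of arithmetic and geometric means. The
  other half of APP is kept out of \<open>key\<close> for this. The error event is enclosed in a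
  measurable set made of the two tail events.\<close>

lemma pair_error_event:
  fixes alpha zeta C c \<sigma> :: real and M :: "'a measure" and G :: selection_problem
  assumes tails: "noise_tail_bounds M n \<sigma> eps (alpha / 2) C c"
    and C: "0 < C" "0 < c" and alpha: "0 < alpha"
    and \<sigma>: "0 < \<sigma>" and nm: "noise_model M n \<sigma> alpha zeta eps" and n: "nobs G = n"
    and V: "vec_subspace n (model_space G p)" and T: "vec_subspace n (model_space G (true_pair G))"
    and mu: "signal G \<in> model_space G (true_pair G)"
    and x: "0 < x"
    and key: "2 * (2 * (real (model_rank G p) - real (common_rank G p)) + x)
      \<le> APP G \<sigma> p / 2 + u_pen G alpha lambda eta p"
  obtains A where "A \<in> sets M" "measure M A \<le> 2 * C * exp (- c * (x / 2) powr (alpha / 2))"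
    "{\<omega> \<in> space M. DCIC G \<sigma> alpha lambda eta (response G eps \<omega>) p
        \<le> DCIC G \<sigma> alpha lambda eta (response G eps \<omega>) (true_pair G)} \<subseteq> A"
proof -
  interpret prob_space M using nm by (simp add: noise_model_def)
  let ?X = "noise_vec n eps"
  obtain B w where B: "orthonormal n B"
    "card B + subspace_dim n (model_space G p \<inter> model_space G (true_pair G)) = subspace_dim n (model_space G p)"
    and w: "w = (1\<^sub>m n - orth_proj n (model_space G p)) *\<^sub>v signal G" "w \<in> carrier_vec n"
    and diff: "\<And>x. x \<in> carrier_vec n \<Longrightarrow> sqnorm w + 2 * (w \<bullet> x) - (\<Sum>u\<in>B. (u \<bullet> x)\<^sup>2)
      \<le> sqnorm ((1\<^sub>m n - orth_proj n (model_space G p)) *\<^sub>v (signal G + x))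
        - sqnorm ((1\<^sub>m n - orth_proj n (model_space G (true_pair G))) *\<^sub>v (signal G + x))"
    using residual_difference[OF V T mu] by blast
  have d: "real (model_rank G p) - real (common_rank G p) = real (card B)"
    using B(2) rank_orth_proj[OF V] by (simp add: model_rank_def common_rank_def proj_def n)
  have app: "APP G \<sigma> p = sqnorm w / \<sigma>\<^sup>2" by (simp add: APP_def proj_def n w(1))
  have s2: "0 < \<sigma>\<^sup>2" using \<sigma> by simp
  define q where "q = (\<lambda>\<omega>. (\<Sum>u\<in>B. (u \<bullet> ?X \<omega>)\<^sup>2) / \<sigma>\<^sup>2)"
  define L where "L = (\<lambda>\<omega>. (w \<bullet> ?X \<omega>) / \<sigma>\<^sup>2)"
  note [measurable] = noise_model_measurable[OF nm]
  define A1 where "A1 = {\<omega> \<in> space M. 2 * real (card B) + x \<le> q \<omega>}"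
  \<comment> \<open>For w = 0 the inequality below would hold everywhere, so that case is set to the
    empty event; the linear term is then 0.\<close>
  define A2 where "A2 = (if sqnorm w = 0 then {} else
    {\<omega> \<in> space M. x / 2 * sqnorm w \<le> (w \<bullet> ?X \<omega>)\<^sup>2 / \<sigma>\<^sup>2})"
  have "{\<omega> \<in> space M. x / 2 * sqnorm w \<le> (w \<bullet> ?X \<omega>)\<^sup>2 / \<sigma>\<^sup>2} \<in> sets M" by measurable
  moreover have "A1 \<in> sets M" unfolding A1_def q_def by measurable
  ultimately have meas: "A1 \<in> sets M" "A2 \<in> sets M" by (simp_all add: A2_def)
  have P1: "prob A1 \<le> C * exp (- c * (x / 2) powr (alpha / 2))"
  proof -
    have "prob A1 \<le> C * exp (- c * x powr (alpha / 2))"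
      unfolding A1_def q_def using tails B(1) x by (simp add: noise_tail_bounds_def)
    also have "\<dots> \<le> C * exp (- c * (x / 2) powr (alpha / 2))"
      using C x alpha by (auto intro!: mult_left_mono powr_mono2)
    finally show ?thesis .
  qed
  have P2: "prob A2 \<le> C * exp (- c * (x / 2) powr (alpha / 2))"
  proof (cases "sqnorm w = 0")
    case True
    then show ?thesis using C by (simp add: A2_def)
  next
    case False
    then have "0 < sqnorm w" using sqnorm_nonneg[of w] by simp
    moreover have "0 \<le> x / 2" using x by simp
    ultimately have "prob {\<omega> \<in> space M. x / 2 * sqnorm w \<le> (w \<bullet> ?X \<omega>)\<^sup>2 / \<sigma>\<^sup>2}
        \<le> C * exp (- c * (x / 2) powr (alpha / 2))"
      using tails w(2) unfolding noise_tail_bounds_def by blast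
    then show ?thesis using False by (simp add: A2_def)
  qed
  have "prob (A1 \<union> A2) \<le> prob A1 + prob A2" using meas by (rule measure_Un_le)
  then have P: "prob (A1 \<union> A2) \<le> 2 * C * exp (- c * (x / 2) powr (alpha / 2))" using P1 P2 by simp
  have sub: "\<omega> \<in> A1 \<union> A2" if \<omega>: "\<omega> \<in> space M"
    and le: "DCIC G \<sigma> alpha lambda eta (response G eps \<omega>) p
        \<le> DCIC G \<sigma> alpha lambda eta (response G eps \<omega>) (true_pair G)" for \<omega>
  proof (rule ccontr)
    assume notin: "\<omega> \<notin> A1 \<union> A2"
    have resp: "response G eps \<omega> = signal G + ?X \<omega>" by (simp add: response_def noise_vec_def n)
    have "(sqnorm w + 2 * (w \<bullet> ?X \<omega>) - (\<Sum>u\<in>B. (u \<bullet> ?X \<omega>)\<^sup>2)) / \<sigma>\<^sup>2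
        \<le> (RSS G (response G eps \<omega>) p - RSS G (response G eps \<omega>) (true_pair G)) / \<sigma>\<^sup>2"
      using diff[of "?X \<omega>"] s2 by (intro divide_right_mono) (auto simp: RSS_def proj_def n resp)
    also have "\<dots> \<le> - u_pen G alpha lambda eta p"
      using le by (simp add: DCIC_def u_pen_def algebra_simps diff_divide_distrib)
    finally have err: "APP G \<sigma> p + 2 * L \<omega> - q \<omega> + u_pen G alpha lambda eta p \<le> 0"
      by (simp add: app L_def q_def add_divide_distrib diff_divide_distrib)
    have q: "q \<omega> < 2 * real (card B) + x" using notin \<omega> by (auto simp: A1_def)
    \<comment> \<open>Subtracting the quadratic noise leaves at least APP/2 + x for minus twice the
      linear term.\<close>
    have arith: "a / 4 + x / 2 \<le> - l"
      if "a + 2 * l - q + u \<le> 0" "2 * (2 * b + x) \<le> a / 2 + u" "q < 2 * b + x" "0 \<le> b"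
      for a l q u b :: real using that by argo
    have lin: "APP G \<sigma> p / 4 + x / 2 \<le> - L \<omega>"
      by (rule arith[OF err key[unfolded d] q]) simp
    have app0: "0 \<le> APP G \<sigma> p" using sqnorm_nonneg[of w] s2 by (simp add: app)
    show False
    proof (cases "sqnorm w = 0")
      case True
      then have "w = 0\<^sub>v n" using sqnorm_eq_0[OF w(2)] by simp
      then have "L \<omega> = 0" by (simp add: L_def)
      then show False using lin x app0 by simp
    next
      case False
      have "x / 2 * APP G \<sigma> p \<le> (APP G \<sigma> p / 4 + x / 2)\<^sup>2"
        using zero_le_power2[of "APP G \<sigma> p / 4 - x / 2"] by (simp add: power2_eq_square algebra_simps)
      also have "\<dots> \<le> (- L \<omega>)\<^sup>2" using lin app0 x by (intro power_mono) auto
      also have "\<dots> = (w \<bullet> ?X \<omega>)\<^sup>2 / \<sigma>\<^sup>2 / \<sigma>\<^sup>2" by (simp add: L_def power_divide power2_eq_square)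
      finally have "x / 2 * sqnorm w / \<sigma>\<^sup>2 \<le> (w \<bullet> ?X \<omega>)\<^sup>2 / \<sigma>\<^sup>2 / \<sigma>\<^sup>2" by (simp add: app)
      then have "x / 2 * sqnorm w \<le> (w \<bullet> ?X \<omega>)\<^sup>2 / \<sigma>\<^sup>2"
        using s2 unfolding divide_le_cancel by auto
      then show False using notin \<omega> False by (simp add: A2_def)
    qed
  qed
  show thesis
    by (rule that[of "A1 \<union> A2"]) (use meas P sub in auto)
qed

section \<open>Counting models\<close>

text \<open>Nonemptiness of the atoms is essential: an empty one would lie inside every
  union.\<close>

lemma partition_subset_Union:
  assumes P: "partition_on X U" and A: "A \<subseteq> U"
  shows "{Y \<in> U. Y \<subseteq> \<Union>A} = A"
proof
  show "{Y \<in> U. Y \<subseteq> \<Union>A} \<subseteq> A"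
  proof
    fix Y assume Y: "Y \<in> {Y \<in> U. Y \<subseteq> \<Union>A}"
    then have "Y \<noteq> {}" using partition_onD3[OF P] by auto
    then obtain x Z where Z: "x \<in> Y" "x \<in> Z" "Z \<in> A" using Y by blast
    then have "Y \<inter> Z \<noteq> {}" "Y \<in> U" "Z \<in> U" using Y A by auto
    then have "Y = Z" using disjointD[OF partition_onD2[OF P]] by metis
    then show "Y \<in> A" using Z by simp
  qed
qed (use A in auto)

text \<open>Pick a point in each atom of A - B. By disjointness these points are distinct and avoid
  all atoms of B.\<close>

lemma card_partition_diff_le:
  assumes P: "partition_on X U" and X: "finite X" and A: "A \<subseteq> U" and B: "B \<subseteq> U"
  shows "card (A - B) \<le> card (\<Union>A - \<Union>B)"
proof -
  define f where "f = (\<lambda>Y::'a set. SOME x. x \<in> Y)"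
  have f: "f Y \<in> Y" if "Y \<in> U" for Y
    using that partition_onD3[OF P] some_in_eq[of Y] by (auto simp: f_def)
  have uniq: "Y = Z" if "Y \<in> U" "Z \<in> U" "x \<in> Y" "x \<in> Z" for x Y Z
    using that disjointD[OF partition_onD2[OF P]] by (metis disjoint_iff)
  have "inj_on f (A - B)"
  proof (rule inj_onI)
    fix Y Z assume YZ: "Y \<in> A - B" "Z \<in> A - B" "f Y = f Z"
    then have "Y \<in> U" "Z \<in> U" using A by auto
    then show "Y = Z" using f[of Y] f[of Z] YZ(3) by (intro uniq[of Y Z "f Y"]) auto
  qed
  moreover have "f ` (A - B) \<subseteq> \<Union>A - \<Union>B"
  proof
    fix x assume "x \<in> f ` (A - B)"
    then obtain Y where Y: "Y \<in> A" "Y \<notin> B" "x = f Y" by auto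
    then have YU: "Y \<in> U" and xY: "x \<in> Y" using A f by auto
    have "x \<notin> Z" if "Z \<in> B" for Z using uniq[OF YU _ xY, of Z] that B Y by auto
    then show "x \<in> \<Union>A - \<Union>B" using Y xY by auto
  qed
  moreover have "\<Union>A \<subseteq> X" using Union_mono[OF A] partition_onD1[OF P] by simp
  then have "finite (\<Union>A - \<Union>B)" using X by (simp add: finite_subset)
  ultimately show ?thesis by (rule card_inj_on_le)
qed

lemma binomial_ge:
  assumes "1 \<le> k" "k < n"
  shows "n \<le> n choose k"
  using assms
proof (induction n arbitrary: k)
  case (Suc n)
  obtain j where k: "k = Suc j" using Suc.prems by (cases k) auto
  show ?case
  proof (cases "k < n")
    case True
    then have "n \<le> n choose k" using Suc.IH Suc.prems by simp
    moreover have "1 \<le> n choose j" using True k by (simp add: Suc_le_eq)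
    ultimately show ?thesis using k by simp
  next
    case False
    then have "n = k" using Suc.prems by simp
    then show ?thesis using binomial_Suc_n[of n] by simp
  qed
qed simp

text \<open>For 1 \<le> k < n the coefficient is at least n, so these n - 1 terms add up to less
  than 1; the term k = n adds 1.\<close>

lemma sum_inverse_binomial_le: "(\<Sum>k=1..n. 1 / real (n choose k)) \<le> 2"
proof (cases n)
  case (Suc m)
  have "(\<Sum>k=1..m. 1 / real (n choose k)) \<le> (\<Sum>k=1..m. 1 / real n)"
  proof (rule sum_mono)
    fix k assume "k \<in> {1..m}"
    then have "n \<le> n choose k" using Suc by (intro binomial_ge) auto
    then have "real n \<le> real (n choose k)" by simp
    then show "1 / real (n choose k) \<le> 1 / real n" using Suc by (intro frac_le) auto
  qed
  also have "\<dots> \<le> 1" using Suc by simp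
  finally have "(\<Sum>k=1..m. 1 / real (n choose k)) \<le> 1" .
  moreover have "(\<Sum>k=1..n. f k) = (\<Sum>k=1..m. f k) + f n" for f :: "nat \<Rightarrow> real"
    using Suc by simp
  ultimately show ?thesis by simp
qed simp

section \<open>Complexities, atom patterns and ranks in the multi-class setting\<close>

lemma multi_class_settingD:
  assumes "multi_class_setting n G"
  shows "nobs G = n" "signal G \<in> carrier_vec n" "true_pair G \<in> agg_list G"
    "signal G \<in> model_space G (true_pair G)"
    "true_class G \<in> {1..nclass G}" "true_model G \<in> models G (true_class G)"
    "m \<in> {1..nclass G} \<Longrightarrow> dim_row (design G m) = n"
    "m \<in> {1..nclass G} \<Longrightarrow> partition_on {..<dim_col (design G m)} (atoms G m)"
    "m \<in> {1..nclass G} \<Longrightarrow> S \<in> models G m \<Longrightarrow> \<exists>A\<subseteq>atoms G m. S = \<Union>A"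
    "m \<in> {1..nclass G} \<Longrightarrow> (\<Sum>S\<in>models G m. exp (- class_complexity G m S)) \<le> 1"
proof -
  note S = assms[unfolded multi_class_setting_def]
  show "nobs G = n" "signal G \<in> carrier_vec n" "signal G \<in> model_space G (true_pair G)"
    and t: "true_pair G \<in> agg_list G"
    using S by simp_all
  show "true_class G \<in> {1..nclass G}" "true_model G \<in> models G (true_class G)"
    using SigmaD1[OF t[unfolded agg_list_def true_pair_def]]
      SigmaD2[OF t[unfolded agg_list_def true_pair_def]] by this+
  note B = bspec[OF conjunct1[OF conjunct2[OF S]]]
  show "m \<in> {1..nclass G} \<Longrightarrow> dim_row (design G m) = n" by (rule conjunct1[OF B])
  show "m \<in> {1..nclass G} \<Longrightarrow> partition_on {..<dim_col (design G m)} (atoms G m)"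
    by (rule conjunct1[OF conjunct2[OF B]])
  show "m \<in> {1..nclass G} \<Longrightarrow> S \<in> models G m \<Longrightarrow> \<exists>A\<subseteq>atoms G m. S = \<Union>A"
    by (rule bspec[OF conjunct1[OF conjunct2[OF conjunct2[OF B]]]])
  show "m \<in> {1..nclass G} \<Longrightarrow> (\<Sum>S\<in>models G m. exp (- class_complexity G m S)) \<le> 1"
    by (rule conjunct2[OF conjunct2[OF conjunct2[OF B]]])
qed

context
  fixes n :: nat and G :: selection_problem
  assumes setting: "multi_class_setting n G"
begin

private lemmas G = multi_class_settingD[OF setting]

lemma model_subset_columns:
  assumes m: "m \<in> {1..nclass G}" and "S \<in> models G m"
  shows "S \<subseteq> {..<dim_col (design G m)}"
proof -
  obtain A where "A \<subseteq> atoms G m" "S = \<Union>A" using G(9)[OF assms] by blast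
  then show ?thesis using Union_mono[of A "atoms G m"] partition_onD1[OF G(8)[OF m]] by (metis)
qed

lemma finite_models: "m \<in> {1..nclass G} \<Longrightarrow> finite (models G m)"
  by (rule finite_subset[of _ "Pow {..<dim_col (design G m)}"]) (use model_subset_columns in blast)+

lemma finite_agg_list: "finite (agg_list G)"
  unfolding agg_list_def using finite_models by (intro finite_SigmaI) auto

lemma finite_atoms: "m \<in> {1..nclass G} \<Longrightarrow> finite (atoms G m)"
  by (rule finite_UnionD) (simp flip: partition_onD1[OF G(8)])

lemma finite_model: "m \<in> {1..nclass G} \<Longrightarrow> S \<in> models G m \<Longrightarrow> finite S"
  by (rule finite_subset[OF model_subset_columns]) auto

text \<open>Each single term of the Kraft sum of its class is at most 1.\<close>

lemma complexity_nonneg: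
  assumes "p \<in> agg_list G"
  shows "0 \<le> complexity G p"
proof -
  obtain m S where p: "p = (m, S)" "m \<in> {1..nclass G}" "S \<in> models G m"
    using assms by (auto simp: agg_list_def)
  have "exp (- class_complexity G m S) \<le> (\<Sum>S\<in>models G m. exp (- class_complexity G m S))"
    using p finite_models by (intro member_le_sum) auto
  also have "\<dots> \<le> 1" by (rule G(10)[OF p(2)])
  finally have "0 \<le> class_complexity G m S" by simp
  moreover have "0 \<le> ln (real (nclass G))" using p by simp
  ultimately show ?thesis by (simp add: complexity_def p)
qed

text \<open>The logarithm of the number of classes is the code length of the class index; it
  averages the Kraft sums of the classes.\<close>

lemma sum_exp_complexity_le: "(\<Sum>p\<in>agg_list G. exp (- complexity G p)) \<le> 1"
proof -
  have pos: "0 < real (nclass G)" using G(5) by simp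
  have "(\<Sum>p\<in>agg_list G. exp (- complexity G p)) =
      (\<Sum>(m, S)\<in>agg_list G. exp (- class_complexity G m S) / real (nclass G))"
    using pos by (intro sum.cong) (auto simp: complexity_def exp_diff exp_minus exp_add divide_inverse)
  also have "\<dots> = (\<Sum>m\<in>{1..nclass G}. \<Sum>S\<in>models G m. exp (- class_complexity G m S) / real (nclass G))"
    unfolding agg_list_def using finite_models by (subst sum.Sigma) auto
  also have "\<dots> \<le> (\<Sum>m\<in>{1..nclass G}. 1 / real (nclass G))"
    using pos G(10) by (intro sum_mono) (auto simp: sum_divide_distrib[symmetric] divide_right_mono)
  also have "\<dots> = 1" using pos by simp
  finally show ?thesis .
qed

lemma true_class_atoms_Union:
  assumes "S \<in> models G (true_class G)"
  shows "true_class_atoms G S \<subseteq> atoms G (true_class G)" "\<Union>(true_class_atoms G S) = S"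
proof -
  obtain A where A: "A \<subseteq> atoms G (true_class G)" "S = \<Union>A" using G(9)[OF G(5) assms] by blast
  have "true_class_atoms G S = A"
    unfolding true_class_atoms_def A(2) by (rule partition_subset_Union[OF G(8)[OF G(5)] A(1)])
  then show "true_class_atoms G S \<subseteq> atoms G (true_class G)" "\<Union>(true_class_atoms G S) = S"
    using A by auto
qed

lemma card_true_class_atoms_diff:
  assumes "S \<in> models G (true_class G)" "T \<in> models G (true_class G)"
  shows "card (true_class_atoms G S - true_class_atoms G T) \<le> card (S - T)"
    and "\<not> S \<subseteq> T \<Longrightarrow> 1 \<le> card (true_class_atoms G S - true_class_atoms G T)"
proof -
  note S = true_class_atoms_Union[OF assms(1)] and T = true_class_atoms_Union[OF assms(2)]
  show "card (true_class_atoms G S - true_class_atoms G T) \<le> card (S - T)"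
    using card_partition_diff_le[OF G(8)[OF G(5)] _ S(1) T(1)] S(2) T(2) by simp
  assume "\<not> S \<subseteq> T"
  then have "\<not> true_class_atoms G S \<subseteq> true_class_atoms G T" using S(2) T(2) by blast
  then have "true_class_atoms G S - true_class_atoms G T \<noteq> {}" by blast
  moreover have "finite (true_class_atoms G S)" using S(1) finite_atoms[OF G(5)] finite_subset by blast
  ultimately show "1 \<le> card (true_class_atoms G S - true_class_atoms G T)"
    by (simp add: Suc_le_eq card_gt_0_iff)
qed

text \<open>Levels count atoms while the penalty counts variables. As atoms are nonempty, the
  penalty grows at least linearly in the level.\<close>

lemma sup_pairsD:
  assumes "p \<in> sup_pairs G"
  shows "1 \<le> delta_plus G (snd p)" "delta_plus G (snd p) + nvars (true_pair G) \<le> nvars p"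
proof -
  obtain S where p: "p = (true_class G, S)" "S \<in> models G (true_class G)" "true_model G \<subset> S"
    using assms by (cases p) (auto simp: sup_pairs_def agg_list_def)
  note d = card_true_class_atoms_diff[OF p(2) G(6)]
  show "1 \<le> delta_plus G (snd p)" using d(2) p by (auto simp: delta_plus_def)
  have "finite S" using finite_model[OF G(5) p(2)] .
  then have "card (S - true_model G) + card (true_model G) = card S"
    using p(3) by (metis card_Diff_subset card_mono finite_subset le_add_diff_inverse2 psubset_imp_subset)
  then show "delta_plus G (snd p) + nvars (true_pair G) \<le> nvars p"
    using d(1) p by (simp add: delta_plus_def nvars_def true_pair_def)
qed

lemma sub_pairsD:
  assumes "p \<in> sub_pairs G"
  shows "1 \<le> delta_minus G (snd p)" "delta_minus G (snd p) + nvars p \<le> nvars (true_pair G)"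
proof -
  obtain S where p: "p = (true_class G, S)" "S \<in> models G (true_class G)" "S \<subset> true_model G"
    using assms by (cases p) (auto simp: sub_pairs_def agg_list_def)
  note d = card_true_class_atoms_diff[OF G(6) p(2)]
  show "1 \<le> delta_minus G (snd p)" using d(2) p by (auto simp: delta_minus_def)
  have "finite (true_model G)" using finite_model[OF G(5) G(6)] .
  then have "card (true_model G - S) + card S = card (true_model G)"
    using p(3) by (metis card_Diff_subset card_mono finite_subset le_add_diff_inverse2 psubset_imp_subset)
  then show "delta_minus G (snd p) + nvars p \<le> nvars (true_pair G)"
    using d(1) p by (simp add: delta_minus_def nvars_def true_pair_def)
qed

text \<open>In the true class a model is determined by the true atoms it drops and the other atoms
  it adds.\<close>

lemma card_models_with_deltas_le:
  fixes qs q :: nat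
  assumes qs: "qs = card (true_class_atoms G (true_model G))" and q: "q = card (atoms G (true_class G))"
  shows "card {S \<in> models G (true_class G). delta_minus G S = l \<and> delta_plus G S = j}
    \<le> (qs choose l) * ((q - qs) choose j)"
proof -
  let ?U = "atoms G (true_class G)" and ?T = "true_class_atoms G (true_model G)"
  let ?F = "{S \<in> models G (true_class G). delta_minus G S = l \<and> delta_plus G S = j}"
  have U: "finite ?U" by (rule finite_atoms[OF G(5)])
  have T: "?T \<subseteq> ?U" "finite ?T" using true_class_atoms_Union(1)[OF G(6)] U finite_subset by auto
  define f where "f = (\<lambda>S. (?T - true_class_atoms G S, true_class_atoms G S - ?T))"
  let ?R = "{X. X \<subseteq> ?T \<and> card X = l} \<times> {Y. Y \<subseteq> ?U - ?T \<and> card Y = j}"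
  have "inj_on f ?F"
  proof (rule inj_onI)
    fix S S' assume S: "S \<in> ?F" "S' \<in> ?F" "f S = f S'"
    then have "true_class_atoms G S = true_class_atoms G S'" unfolding f_def by blast
    moreover have "S \<in> models G (true_class G)" "S' \<in> models G (true_class G)" using S by simp_all
    ultimately show "S = S'" using true_class_atoms_Union(2) by metis
  qed
  moreover have "f ` ?F \<subseteq> ?R"
    using true_class_atoms_Union(1) by (auto simp: f_def delta_minus_def delta_plus_def)
  moreover have "finite ?R" using U T by auto
  ultimately have "card ?F \<le> card ?R" by (rule card_inj_on_le)
  also have "\<dots> = (qs choose l) * (card (?U - ?T) choose j)"
    using U T by (simp add: card_cartesian_product n_subsets qs)
  also have "card (?U - ?T) = q - qs" using T U by (simp add: card_Diff_subset qs q)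
  finally show ?thesis .
qed

lemma D_term_nonneg:
  assumes "p \<in> agg_list G"
  shows "0 \<le> D_term G p"
proof -
  have "0 \<le> ln (real k)" for k :: nat by (cases k) auto
  then show ?thesis using complexity_nonneg[OF assms] by (simp add: D_term_def Let_def del: of_nat_mult)
qed

text \<open>In the true class one factor 1/N pays for the at most N models with a given atom
  pattern, and the second, due to the 2 in the exponent, makes the sum over patterns converge, to at
  most 2 * 2. Kraft's inequality adds 1 for the pairs whose minimum is the complexity, among them
  all other classes.\<close>

lemma sum_exp_D_wrong_le: "(\<Sum>p\<in>wrong_pairs G. exp (- 2 * D_term G p)) \<le> 5"
proof -
  define qs where "qs = card (true_class_atoms G (true_model G))"
  define q where "q = card (atoms G (true_class G))"
  define N where "N = (\<lambda>(l, j). real ((qs choose l) * ((q - qs) choose j)))"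
  define g where "g = (\<lambda>p :: model_pair. (delta_minus G (snd p), delta_plus G (snd p)))"
  define I where "I = {p \<in> wrong_pairs G. fst p = true_class G}"
  have U: "finite (atoms G (true_class G))" by (rule finite_atoms[OF G(5)])
  have T: "true_class_atoms G (true_model G) \<subseteq> atoms G (true_class G)"
    "finite (true_class_atoms G (true_model G))"
    using true_class_atoms_Union(1)[OF G(6)] U finite_subset by auto
  have W: "wrong_pairs G \<subseteq> agg_list G" by (auto simp: wrong_pairs_def)
  have finW: "finite (wrong_pairs G)" using W finite_agg_list finite_subset by blast
  \<comment> \<open>Such a pair is nested neither above nor below the true one, so both counts are
    at least 1 and the sums of inverse binomials may start at 1.\<close>
  have gI: "g p \<in> {1..qs} \<times> {1..q - qs}" if "p \<in> I" for p
  proof -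
    define S where "S = snd p"
    have pS: "p = (true_class G, S)" using that by (simp add: I_def S_def prod_eq_iff)
    have "p \<in> wrong_pairs G" "p \<in> agg_list G" using that W by (auto simp: I_def)
    then have p: "p = (true_class G, S)" "S \<in> models G (true_class G)"
      and "\<not> true_model G \<subset> S" "\<not> S \<subset> true_model G" "S \<noteq> true_model G"
      unfolding pS wrong_pairs_def sup_pairs_def sub_pairs_def true_pair_def
      by (simp_all add: agg_list_def)
    then have ns: "\<not> true_model G \<subseteq> S" "\<not> S \<subseteq> true_model G" by auto
    have "1 \<le> delta_minus G S" "1 \<le> delta_plus G S"
      using card_true_class_atoms_diff(2)[OF p(2) G(6) ns(2)] card_true_class_atoms_diff(2)[OF G(6) p(2) ns(1)]
      by (auto simp: delta_minus_def delta_plus_def)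
    moreover have "delta_minus G S \<le> qs"
      using T by (auto simp: delta_minus_def qs_def intro: card_mono)
    moreover have "delta_plus G S \<le> card (atoms G (true_class G) - true_class_atoms G (true_model G))"
      unfolding delta_plus_def using U true_class_atoms_Union(1)[OF p(2)] by (intro card_mono) auto
    moreover have "card (atoms G (true_class G) - true_class_atoms G (true_model G)) = q - qs"
      using T by (simp add: card_Diff_subset q_def qs_def)
    ultimately show ?thesis by (simp add: g_def p)
  qed
  have N1: "1 \<le> N x" if xin: "x \<in> {1..qs} \<times> {1..q - qs}" for x
  proof -
    obtain l j where x: "x = (l, j)" "l \<le> qs" "j \<le> q - qs" using xin by auto
    then have "1 \<le> (qs choose l) * ((q - qs) choose j)" by (simp add: Suc_le_eq)
    then show ?thesis unfolding N_def x(1) by (metis case_prod_conv of_nat_1 of_nat_le_iff)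
  qed
  have split: "exp (- 2 * D_term G p) \<le> (if p \<in> I then 1 / (N (g p))\<^sup>2 else 0) + exp (- complexity G p)"
    if p: "p \<in> wrong_pairs G" for p
  proof -
    have C: "0 \<le> complexity G p" using p W complexity_nonneg by blast
    then have e: "exp (- 2 * complexity G p) \<le> exp (- complexity G p)" by simp
    show ?thesis
    proof (cases "p \<in> I")
      case True
      have D: "D_term G p = min (ln (N (g p))) (complexity G p)"
        using True by (simp add: D_term_def I_def N_def g_def Let_def qs_def q_def)
      have "1 \<le> N (g p)" by (rule N1[OF gI[OF True]])
      then have "exp (- 2 * ln (N (g p))) = 1 / (N (g p))\<^sup>2"
        by (simp add: exp_minus exp_double divide_inverse)
      then show ?thesis
        using D True e by (cases "ln (N (g p)) \<le> complexity G p") (auto simp: min_def add_increasing2 add_increasing)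
    next
      case False
      then have "D_term G p = complexity G p" using p by (simp add: D_term_def I_def)
      then show ?thesis using False e by simp
    qed
  qed
  have fib: "(\<Sum>p\<in>{p \<in> I. g p = x}. 1 / (N (g p))\<^sup>2) \<le> 1 / N x" if x: "x \<in> {1..qs} \<times> {1..q - qs}" for x
  proof -
    obtain l j where lj: "x = (l, j)" by (cases x)
    have "card {p \<in> I. g p = x} \<le> card {S \<in> models G (true_class G). delta_minus G S = l \<and> delta_plus G S = j}"
    proof (rule card_inj_on_le[where f = snd])
      show "inj_on snd {p \<in> I. g p = x}" by (auto simp: inj_on_def I_def)
      show "snd ` {p \<in> I. g p = x} \<subseteq> {S \<in> models G (true_class G). delta_minus G S = l \<and> delta_plus G S = j}"
        using W by (auto simp: I_def g_def lj agg_list_def)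
      show "finite {S \<in> models G (true_class G). delta_minus G S = l \<and> delta_plus G S = j}"
        using finite_models[OF G(5)] by simp
    qed
    also have "\<dots> \<le> (qs choose l) * ((q - qs) choose j)"
      by (rule card_models_with_deltas_le[OF qs_def q_def])
    finally have "real (card {p \<in> I. g p = x}) \<le> real ((qs choose l) * ((q - qs) choose j))"
      by (rule of_nat_mono)
    then have c: "real (card {p \<in> I. g p = x}) \<le> N x" by (simp add: N_def lj del: of_nat_mult)
    have Nx: "1 \<le> N x" by (rule N1[OF x])
    have "(\<Sum>p\<in>{p \<in> I. g p = x}. 1 / (N (g p))\<^sup>2) = real (card {p \<in> I. g p = x}) * (1 / (N x)\<^sup>2)"
      by simp
    also have "\<dots> \<le> N x * (1 / (N x)\<^sup>2)" using c by (intro mult_right_mono) auto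
    also have "\<dots> = 1 / N x" using Nx by (simp add: power2_eq_square)
    finally show ?thesis .
  qed
  have finI: "finite I" using finW by (simp add: I_def)
  have "(\<Sum>p\<in>I. 1 / (N (g p))\<^sup>2) = (\<Sum>x\<in>{1..qs} \<times> {1..q - qs}. \<Sum>p\<in>{p \<in> I. g p = x}. 1 / (N (g p))\<^sup>2)"
  proof (rule sum.group[symmetric, OF finI])
    show "g ` I \<subseteq> {1..qs} \<times> {1..q - qs}" using gI by blast
  qed auto
  also have "\<dots> \<le> (\<Sum>x\<in>{1..qs} \<times> {1..q - qs}. 1 / N x)"
    by (intro sum_mono fib)
  also have "\<dots> = (\<Sum>l=1..qs. 1 / real (qs choose l)) * (\<Sum>j=1..q - qs. 1 / real ((q - qs) choose j))"
    unfolding sum_product sum.cartesian_product by (intro sum.cong) (auto simp: N_def)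
  also have "\<dots> \<le> 2 * 2"
    by (intro mult_mono sum_inverse_binomial_le sum_nonneg) auto
  finally have I4: "(\<Sum>p\<in>I. 1 / (N (g p))\<^sup>2) \<le> 4" by simp
  have "(\<Sum>p\<in>wrong_pairs G. exp (- 2 * D_term G p))
      \<le> (\<Sum>p\<in>wrong_pairs G. (if p \<in> I then 1 / (N (g p))\<^sup>2 else 0) + exp (- complexity G p))"
    by (intro sum_mono split)
  also have "\<dots> = (\<Sum>p\<in>I. 1 / (N (g p))\<^sup>2) + (\<Sum>p\<in>wrong_pairs G. exp (- complexity G p))"
  proof -
    have "wrong_pairs G \<inter> I = I" by (auto simp: I_def)
    then have "(\<Sum>p\<in>wrong_pairs G. if p \<in> I then 1 / (N (g p))\<^sup>2 else 0) = (\<Sum>p\<in>I. 1 / (N (g p))\<^sup>2)"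
      using sum.inter_restrict[OF finW, of "\<lambda>p. 1 / (N (g p))\<^sup>2" I] by simp
    then show ?thesis by (simp add: sum.distrib)
  qed
  also have "(\<Sum>p\<in>wrong_pairs G. exp (- complexity G p)) \<le> (\<Sum>p\<in>agg_list G. exp (- complexity G p))"
    using W finite_agg_list by (intro sum_mono2) auto
  finally show ?thesis using I4 sum_exp_complexity_le by linarith
qed

lemma agg_list_model_space:
  assumes "p \<in> agg_list G"
  shows "snd p \<subseteq> {..<dim_col (design G (fst p))}" "dim_row (design G (fst p)) = n"
    "vec_subspace n (model_space G p)" "model_rank G p = subspace_dim n (model_space G p)"
proof -
  have m: "fst p \<in> {1..nclass G}" "snd p \<in> models G (fst p)"
    using assms unfolding agg_list_def by auto
  show 1: "snd p \<subseteq> {..<dim_col (design G (fst p))}" by (rule model_subset_columns[OF m])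
  show 2: "dim_row (design G (fst p)) = n" by (rule G(7)[OF m(1)])
  show 3: "vec_subspace n (model_space G p)" by (rule vec_subspace_model_space[OF G(1) 1 2])
  show "model_rank G p = subspace_dim n (model_space G p)"
    by (simp add: model_rank_def proj_def G(1) rank_orth_proj[OF 3])
qed

text \<open>The model space lies in the true one, so the quadratic noise has dimension 0.\<close>

lemma sub_pairs_rank:
  assumes "p \<in> sub_pairs G"
  shows "model_rank G p = common_rank G p"
proof -
  have p: "p \<in> agg_list G" "p = (true_class G, snd p)" "snd p \<subseteq> true_model G"
    using assms by (auto simp: sub_pairs_def prod_eq_iff)
  have "true_model G \<subseteq> {..<dim_col (design G (true_class G))}"
    using agg_list_model_space(1)[OF G(3)] by (simp add: true_pair_def)
  then have "model_space G p \<subseteq> model_space G (true_pair G)"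
    using model_space_mono[OF G(1) p(3)] p(2) by (metis true_pair_def)
  then show ?thesis
    using agg_list_model_space(4)[OF p(1)] by (simp add: common_rank_def G(1) Int_absorb2)
qed

text \<open>Each added column raises the dimension by at most one. Hence the penalty per variable
  can pay for the mean of the quadratic noise.\<close>

lemma sup_pairs_rank:
  assumes "p \<in> sup_pairs G"
  shows "real (model_rank G p) - real (common_rank G p) \<le> real (nvars p) - real (nvars (true_pair G))"
proof -
  have p: "p \<in> agg_list G" "p = (true_class G, snd p)" "true_model G \<subseteq> snd p"
    using assms by (auto simp: sup_pairs_def prod_eq_iff)
  have s: "snd p \<subseteq> {..<dim_col (design G (true_class G))}" "dim_row (design G (true_class G)) = n"
    using agg_list_model_space(1,2)[OF p(1)] p(2) by (metis fst_conv)+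
  have "model_space G (true_pair G) \<subseteq> model_space G p"
    using model_space_mono[OF G(1) p(3) s(1)] p(2) by (metis true_pair_def)
  then have c: "common_rank G p = subspace_dim n (model_space G (true_pair G))"
    by (simp add: common_rank_def G(1) Int_absorb1)
  have "subspace_dim n (model_space G p)
      \<le> subspace_dim n (model_space G (true_pair G)) + card (snd p - true_model G)"
    using subspace_dim_model_space_le[OF G(1) s(2) p(3) s(1)] p(2) by (metis true_pair_def)
  moreover have fin: "finite (snd p)" using s(1) finite_subset by blast
  then have "card (snd p - true_model G) + nvars (true_pair G) = nvars p"
    using p(3) by (simp add: nvars_def true_pair_def card_Diff_subset finite_subset card_mono)
  ultimately show ?thesis using agg_list_model_space(4)[OF p(1)] c by linarith
qed

end

section \<open>Union bound over the candidate list\<close>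

text \<open>Crude, but valid for every h \<ge> 0. It splits a stretched exponential into two
  factors, such as one that pays for the number of models and one that tends to 0.\<close>

lemma powr_add_ge_half:
  fixes a b h :: real
  assumes "0 \<le> a" "0 \<le> b" "0 \<le> h"
  shows "(a powr h + b powr h) / 2 \<le> (a + b) powr h"
proof -
  have "a powr h \<le> (a + b) powr h" "b powr h \<le> (a + b) powr h"
    using assms by (auto intro: powr_mono2)
  then show ?thesis by simp
qed

text \<open>Divide by a^p and use u^p \<le> u on [0, 1]. This turns the gap of penalties into a
  power of the complexity gap that condition (i) weighs.\<close>

lemma powr_diff_superadditive:
  fixes a b p :: real
  assumes "0 \<le> b" "b \<le> a" "1 \<le> p"
  shows "(a - b) powr p \<le> a powr p - b powr p"
proof (cases "a = 0")
  case False
  then have a: "0 < a" using assms by simp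
  have le: "u powr p \<le> u" if "0 \<le> u" "u \<le> 1" for u
    using powr_mono'[of 1 p u] that assms by simp
  have "(a - b) powr p = a powr p * ((a - b) / a) powr p" "b powr p = a powr p * (b / a) powr p"
    using a by (simp_all flip: powr_mult)
  then have "(a - b) powr p + b powr p = a powr p * (((a - b) / a) powr p + (b / a) powr p)"
    by (simp add: distrib_left)
  also have "\<dots> \<le> a powr p * ((a - b) / a + b / a)"
    using a assms by (intro mult_left_mono add_mono le) auto
  also have "(a - b) / a + b / a = 1" using a by (simp add: diff_divide_distrib)
  finally show ?thesis by simp
qed (use assms in simp)

lemma powr_mult_powr_inverse:
  fixes a d alpha :: real
  assumes "0 \<le> d" "0 < alpha"
  shows "(a * d powr (2 / alpha)) powr (alpha / 2) = a powr (alpha / 2) * d"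
  using assms by (simp add: powr_mult powr_powr)

text \<open>Telescoping with 1/l^2 \<le> 1/(l - 1) - 1/l.\<close>

lemma sum_inverse_squares_le: "(\<Sum>l=1..Suc N. 1 / (real l)\<^sup>2) \<le> 2 - 1 / real (Suc N)"
proof (induction N)
  case (Suc N)
  have "1 / (real (Suc (Suc N)))\<^sup>2 \<le> 1 / (real (Suc N) * real (Suc (Suc N)))"
    unfolding power2_eq_square by (intro divide_left_mono mult_right_mono) auto
  also have "\<dots> = 1 / real (Suc N) - 1 / real (Suc (Suc N))"
    by (simp add: divide_simps)
  finally show ?case using Suc by simp
qed simp

lemma sum_inverse_squares_le_2:
  assumes "finite T" "T \<subseteq> {1..}"
  shows "(\<Sum>l\<in>T. 1 / (real l)\<^sup>2) \<le> 2"
proof -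
  obtain N where N: "\<And>l. l \<in> T \<Longrightarrow> l \<le> N" using assms(1) finite_nat_set_iff_bounded_le by auto
  have "(\<Sum>l\<in>T. 1 / (real l)\<^sup>2) \<le> (\<Sum>l=1..Suc N. 1 / (real l)\<^sup>2)"
    using assms N by (intro sum_mono2) (auto simp: le_SucI)
  also have "\<dots> \<le> 2 - 1 / real (Suc N)" by (rule sum_inverse_squares_le)
  also have "\<dots> \<le> 2" by simp
  finally show ?thesis .
qed

text \<open>The constant in \<open>exp_neg_powr_le\<close>, comparing exp (- b * x^h) with 1 /
  x^2.\<close>

definition exp_powr_const :: "real \<Rightarrow> real \<Rightarrow> real" where
  "exp_powr_const h b = (2 / h) powr (2 / h) * b powr (- (2 / h))"

text \<open>Level l contributes at most a constant times 1 / (eta * l)^2. So the levels are summable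
  and their total is of order 1 / eta^2, which tends to 0.\<close>

lemma sum_by_level_le:
  fixes f :: "'p \<Rightarrow> real" and lev :: "'p \<Rightarrow> nat" and b h eta :: real
  assumes F: "finite F" and lev: "\<And>p. p \<in> F \<Longrightarrow> 1 \<le> lev p"
    and b: "0 < b" and h: "0 < h" and eta: "0 < eta"
    and f: "\<And>l. 1 \<le> l \<Longrightarrow> (\<Sum>p\<in>{p \<in> F. lev p = l}. f p) \<le> exp (- (b * (eta * real l) powr h))"
  shows "(\<Sum>p\<in>F. f p) \<le> 2 * exp_powr_const h b * (1 / eta\<^sup>2)"
proof -
  have "(\<Sum>p\<in>F. f p) = (\<Sum>l\<in>lev ` F. \<Sum>p\<in>{p \<in> F. lev p = l}. f p)"
    using F by (intro sum.group[symmetric]) auto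
  also have "\<dots> \<le> (\<Sum>l\<in>lev ` F. exp_powr_const h b * (1 / eta\<^sup>2) * (1 / (real l)\<^sup>2))"
  proof (rule sum_mono)
    fix l assume "l \<in> lev ` F"
    then have l: "1 \<le> l" using lev by auto
    then have "exp (- (b * (eta * real l) powr h)) \<le> exp_powr_const h b * (1 / (eta * real l)\<^sup>2)"
      unfolding exp_powr_const_def using b h eta by (intro exp_neg_powr_le) auto
    with f[OF l] show "(\<Sum>p\<in>{p \<in> F. lev p = l}. f p) \<le> exp_powr_const h b * (1 / eta\<^sup>2) * (1 / (real l)\<^sup>2)"
      by (simp add: power_mult_distrib)
  qed
  also have "\<dots> = exp_powr_const h b * (1 / eta\<^sup>2) * (\<Sum>l\<in>lev ` F. 1 / (real l)\<^sup>2)"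
    by (simp only: sum_distrib_left)
  also have "\<dots> \<le> exp_powr_const h b * (1 / eta\<^sup>2) * 2"
    using F lev by (intro mult_left_mono sum_inverse_squares_le_2) (auto simp: exp_powr_const_def)
  finally show ?thesis by (simp add: mult_ac)
qed

lemma APP_nonneg: "0 \<le> APP G \<sigma> p"
  by (simp add: APP_def sqnorm_nonneg)

text \<open>The thresholds match the exponents of the tail bound: \<open>lam\<close> makes it cover
  2 D for wrong pairs, \<open>c1\<close> the weights in (i), \<open>c2\<close> the logarithm of the
  number of pairs in a level of (ii). With eta \<ge> 8 the penalty pays for the mean of the
  quadratic noise.\<close>

lemma selection_error_bound:
  fixes alpha zeta C c \<sigma> lambda eta c1 c1' c2 :: real
    and M :: "'a measure" and G :: selection_problem and sel :: "'a \<Rightarrow> model_pair"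
  assumes tails: "noise_tail_bounds M n \<sigma> eps (alpha / 2) C c"
    and C: "0 < C" "0 < c" and alpha: "0 < alpha" "alpha \<le> 2"
    and \<sigma>: "0 < \<sigma>" and nm: "noise_model M n \<sigma> alpha zeta eps" and setting: "multi_class_setting n G"
    and n: "0 < ln (ln (real n))" and eta: "8 \<le> eta"
    and lam: "0 \<le> lambda" "2 \<le> c / 2 * (lambda / 8) powr (alpha / 2)"
    and c1: "0 < c1'" "c1' < c1" "c1 \<le> c / 2 * (1 / 8) powr (alpha / 2)"
    and c2: "4 \<le> c2" "1 \<le> c / 2 * (c2 / 16) powr (alpha / 2)"
    and sup: "cond_sup G alpha lambda eta c1' c1"
    and sub: "cond_sub G \<sigma> alpha lambda eta c2"
    and wrong: "cond_wrong G \<sigma> alpha lambda eta"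
    and sel: "sel \<in> measurable M (count_space (agg_list G))"
      "\<And>\<omega>. \<omega> \<in> space M \<Longrightarrow> sel \<omega> \<in> DCIC_argmin G \<sigma> alpha lambda eta (response G eps \<omega>)"
  shows "1 - measure M {\<omega> \<in> space M. sel \<omega> = true_pair G}
    \<le> 10 * C * exp (- (c / 2 * (ln (ln (real n)) / 8) powr (alpha / 2)))
      + 4 * C * (exp_powr_const (alpha / 2) 1 + exp_powr_const (alpha / 2) (c1 - c1')) * (1 / eta\<^sup>2)"
proof -
  interpret prob_space M using nm by (simp add: noise_model_def)
  note G = multi_class_settingD[OF setting]
  define h where "h = alpha / 2"
  have h: "0 < h" using alpha by (simp add: h_def)
  define Cs where "Cs = complexity G (true_pair G)"
  have Cs0: "0 \<le> Cs" unfolding Cs_def by (rule complexity_nonneg[OF setting G(3)])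
  \<comment> \<open>Weights of the union bound, one family per kind of pair: \<open>fw\<close> is a
    vanishing factor times a summable weight, \<open>fs\<close> spreads the mass of a level evenly
    over its pairs, \<open>fp\<close> keeps the weight of condition (i).\<close>
  define fw where "fw = (\<lambda>p. exp (- (c / 2 * (ln (ln (real n)) / 8) powr h)) * exp (- 2 * D_term G p))"
  define fs where "fs = (\<lambda>p :: model_pair. exp (- ((eta * real (delta_minus G (snd p))) powr h))
      / real (num_sub G (delta_minus G (snd p))))"
  define fp where "fp = (\<lambda>p :: model_pair. exp (- (c1 * (eta * real (delta_plus G (snd p))) powr h))
      * exp (- c1 * lambda powr h * (complexity G p - Cs)))"
  define E where "E = (\<lambda>p. {\<omega> \<in> space M. DCIC G \<sigma> alpha lambda eta (response G eps \<omega>) p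
      \<le> DCIC G \<sigma> alpha lambda eta (response G eps \<omega>) (true_pair G)})"
  have event: "\<exists>A. A \<in> sets M \<and> measure M A \<le> 2 * C * b \<and> E p \<subseteq> A"
    if p: "p \<in> agg_list G" and x: "0 < x"
      and key: "2 * (2 * (real (model_rank G p) - real (common_rank G p)) + x)
        \<le> APP G \<sigma> p / 2 + u_pen G alpha lambda eta p"
      and b: "exp (- c * (x / 2) powr h) \<le> b"
    for p x b
  proof -
    obtain A where A: "A \<in> sets M" "measure M A \<le> 2 * C * exp (- c * (x / 2) powr h)" "E p \<subseteq> A"
      unfolding E_def h_def
      by (rule pair_error_event[OF tails C alpha(1) \<sigma> nm G(1) agg_list_model_space(3)[OF setting p]
            agg_list_model_space(3)[OF setting G(3)] G(4) x key])
    have "2 * C * exp (- c * (x / 2) powr h) \<le> 2 * C * b" using b C by (intro mult_left_mono) auto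
    with A show ?thesis by (intro exI[of _ A]) simp
  qed
  have ew: "\<exists>A. A \<in> sets M \<and> measure M A \<le> 2 * C * fw p \<and> E p \<subseteq> A" if p: "p \<in> wrong_pairs G" for p
  proof -
    define D where "D = D_term G p"
    define l where "l = ln (ln (real n))"
    have l0: "0 < l" using n by (simp add: l_def)
    \<comment> \<open>\<open>B_term\<close> without its rank part. The key inequality becomes 2 * B
      \<le> APP / 2 + u, which is condition (iii) when 2 * B > u and trivial otherwise.\<close>
    define x where "x = lambda * D powr (2 / alpha) / 4 + l / 4"
    have pa: "p \<in> agg_list G" using p by (simp add: wrong_pairs_def)
    have D0: "0 \<le> D" unfolding D_def by (rule D_term_nonneg[OF setting pa])
    have x0: "0 < x" using l0 lam(1) by (auto simp: x_def intro!: add_nonneg_pos)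
    have B: "B_term G alpha lambda p = x + 2 * (real (model_rank G p) - real (common_rank G p))"
      by (simp add: B_term_def x_def D_def l_def G(1))
    have "2 * B_term G alpha lambda p \<le> APP G \<sigma> p / 2 + u_pen G alpha lambda eta p"
    proof (cases "2 * B_term G alpha lambda p > u_pen G alpha lambda eta p")
      case True
      then have "APP G \<sigma> p \<ge> 2 * (2 * B_term G alpha lambda p - u_pen G alpha lambda eta p)"
        using wrong p by (simp add: cond_wrong_def)
      then show ?thesis by simp
    next
      case False
      then show ?thesis using APP_nonneg[of G \<sigma> p] by linarith
    qed
    then have key: "2 * (2 * (real (model_rank G p) - real (common_rank G p)) + x)
        \<le> APP G \<sigma> p / 2 + u_pen G alpha lambda eta p"
      by (simp add: B)
    have e1: "(lambda / 8 * D powr (2 / alpha)) powr h = (lambda / 8) powr h * D"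
      unfolding h_def by (rule powr_mult_powr_inverse[OF D0 alpha(1)])
    have e2: "((lambda / 8 * D powr (2 / alpha)) powr h + (l / 8) powr h) / 2
        \<le> (lambda / 8 * D powr (2 / alpha) + l / 8) powr h"
      using lam(1) l0 h by (intro powr_add_ge_half) auto
    have e3: "lambda / 8 * D powr (2 / alpha) + l / 8 = x / 2" by (simp add: x_def)
    have "((lambda / 8) powr h * D + (l / 8) powr h) / 2 \<le> (x / 2) powr h"
      using e2 unfolding e1 e3 .
    then have "c * (((lambda / 8) powr h * D + (l / 8) powr h) / 2) \<le> c * (x / 2) powr h"
      using C by (intro mult_left_mono) auto
    moreover have "c * (((lambda / 8) powr h * D + (l / 8) powr h) / 2)
        = c / 2 * (lambda / 8) powr h * D + c / 2 * (l / 8) powr h"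
      by (simp add: algebra_simps add_divide_distrib)
    moreover have "2 * D \<le> c / 2 * (lambda / 8) powr h * D"
      using lam(2) D0 unfolding h_def by (intro mult_right_mono) auto
    ultimately have "2 * D + c / 2 * (l / 8) powr h \<le> c * (x / 2) powr h" by linarith
    then have "exp (- c * (x / 2) powr h) \<le> fw p"
      by (simp add: fw_def D_def l_def flip: exp_add)
    then show ?thesis by (rule event[OF pa x0 key])
  qed
  have es: "\<exists>A. A \<in> sets M \<and> measure M A \<le> 2 * C * fs p \<and> E p \<subseteq> A" if p: "p \<in> sub_pairs G" for p
  proof -
    define l where "l = delta_minus G (snd p)"
    define N where "N = real (num_sub G l)"
    have pa: "p \<in> agg_list G" using p by (simp add: sub_pairs_def)
    note s = sub_pairsD[OF setting p]
    have l1: "1 \<le> real l" using s(1) by (simp add: l_def)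
    have ls: "real l \<le> real (nvars (true_pair G)) - real (nvars p)" using s(2) by (simp add: l_def)
    have "finite {p \<in> sub_pairs G. delta_minus G (snd p) = l}"
      using finite_agg_list[OF setting] by (rule rev_finite_subset) (auto simp: sub_pairs_def)
    moreover have "p \<in> {p \<in> sub_pairs G. delta_minus G (snd p) = l}" using p by (simp add: l_def)
    ultimately have "0 < card {p \<in> sub_pairs G. delta_minus G (snd p) = l}"
      unfolding card_gt_0_iff by blast
    then have N: "1 \<le> N" by (simp add: N_def num_sub_def)
    define Ds where "Ds = real (nvars (true_pair G)) - real (nvars p)"
    define mx where "mx = max (Cs powr (2 / alpha) - complexity G p powr (2 / alpha)) 0"
    have app: "c2 * (eta * Ds + lambda * mx + ln N powr (2 / alpha)) \<le> APP G \<sigma> p"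
      using sub p by (simp add: cond_sub_def Ds_def mx_def N_def l_def Cs_def)
    have etal: "eta * real l \<le> eta * Ds" using ls eta by (intro mult_left_mono) (auto simp: Ds_def)
    have eta0: "8 \<le> eta * real l" using mult_mono[of 8 eta 1 "real l"] eta l1 by simp
    have mx0: "0 \<le> lambda * mx" using lam by (simp add: mx_def)
    have "c2 * (eta * real l + ln N powr (2 / alpha)) \<le> c2 * (eta * Ds + lambda * mx + ln N powr (2 / alpha))"
      using etal mx0 c2 by (intro mult_left_mono) auto
    then have app': "c2 * (eta * real l + ln N powr (2 / alpha)) \<le> APP G \<sigma> p" using app by linarith
    have sum0: "8 \<le> eta * real l + ln N powr (2 / alpha)" using eta0 powr_ge_zero[of "ln N" "2 / alpha"] by linarith
    have app0: "0 < APP G \<sigma> p"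
    proof -
      have "0 < c2 * (eta * real l + ln N powr (2 / alpha))" using sum0 c2 by (intro mult_pos_pos) auto
      then show ?thesis using app' by linarith
    qed
    \<comment> \<open>The rank part vanishes, so the key inequality only asks for - u \<le> APP / 4;
      this is where c2 \<ge> 4 is used.\<close>
    define x where "x = APP G \<sigma> p / 8"
    have x0: "0 < x" using app0 by (simp add: x_def)
    have u: "- u_pen G alpha lambda eta p \<le> APP G \<sigma> p / 4"
    proof -
      have "- u_pen G alpha lambda eta p = eta * Ds + lambda * (Cs powr (2 / alpha) - complexity G p powr (2 / alpha))"
        by (simp add: u_pen_def Ds_def Cs_def algebra_simps)
      also have "\<dots> \<le> eta * Ds + lambda * mx + ln N powr (2 / alpha)"
      proof -
        have "lambda * (Cs powr (2 / alpha) - complexity G p powr (2 / alpha)) \<le> lambda * mx"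
          using lam(1) by (intro mult_left_mono) (auto simp: mx_def)
        then show ?thesis using powr_ge_zero[of "ln N" "2 / alpha"] by linarith
      qed
      finally have 1: "- u_pen G alpha lambda eta p \<le> eta * Ds + lambda * mx + ln N powr (2 / alpha)" .
      have "0 \<le> eta * Ds + lambda * mx + ln N powr (2 / alpha)" 
        using etal eta0 mx0 powr_ge_zero[of "ln N" "2 / alpha"] by linarith
      then have "4 * (eta * Ds + lambda * mx + ln N powr (2 / alpha)) \<le> c2 * (eta * Ds + lambda * mx + ln N powr (2 / alpha))"
        using c2 by (intro mult_right_mono) auto
      then have "4 * (eta * Ds + lambda * mx + ln N powr (2 / alpha)) \<le> APP G \<sigma> p"
        using app by (rule order_trans)
      then show ?thesis using 1 by argo
    qed
    have key: "2 * (2 * (real (model_rank G p) - real (common_rank G p)) + x)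
        \<le> APP G \<sigma> p / 2 + u_pen G alpha lambda eta p"
      using u by (simp add: sub_pairs_rank[OF setting p] x_def)
    have lnN: "0 \<le> ln N" using N by simp
    have "(eta * real l) powr h + ln N = (eta * real l) powr h + (1 * ln N powr (2 / alpha)) powr h"
      unfolding h_def powr_mult_powr_inverse[OF lnN alpha(1)] by simp
    also have "\<dots> / 2 \<le> (eta * real l + 1 * ln N powr (2 / alpha)) powr h"
      using eta0 h by (intro powr_add_ge_half) auto
    finally have half: "((eta * real l) powr h + ln N) / 2 \<le> (eta * real l + ln N powr (2 / alpha)) powr h" by simp
    have "(eta * real l) powr h + ln N \<le> c * (c2 / 16) powr h * (((eta * real l) powr h + ln N) / 2)"
    proof -
      have "1 * ((eta * real l) powr h + ln N) \<le> c / 2 * (c2 / 16) powr h * ((eta * real l) powr h + ln N)"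
        using c2(2) lnN unfolding h_def by (intro mult_right_mono) auto
      then show ?thesis by simp
    qed
    also have "\<dots> \<le> c * (c2 / 16) powr h * (eta * real l + ln N powr (2 / alpha)) powr h"
      using half C by (intro mult_left_mono) auto
    also have "\<dots> = c * (c2 / 16 * (eta * real l + ln N powr (2 / alpha))) powr h"
      by (simp only: powr_mult mult.assoc)
    also have "\<dots> \<le> c * (x / 2) powr h"
      using C app' sum0 c2 h by (intro mult_left_mono powr_mono2) (auto simp: x_def)
    finally have "exp (- c * (x / 2) powr h) \<le> exp (- ((eta * real l) powr h + ln N))" by simp
    also have "\<dots> = fs p"
      using N by (simp add: fs_def l_def[symmetric] N_def[symmetric] exp_diff exp_minus divide_inverse)
    finally show ?thesis by (rule event[OF pa x0 key])
  qed
  have ep: "\<exists>A. A \<in> sets M \<and> measure M A \<le> 2 * C * fp p \<and> E p \<subseteq> A" if p: "p \<in> sup_pairs G" for p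
  proof -
    define j where "j = delta_plus G (snd p)"
    define \<Delta> where "\<Delta> = complexity G p - Cs"
    have pa: "p \<in> agg_list G" using p by (simp add: sup_pairs_def)
    note s = sup_pairsD[OF setting p]
    have j1: "1 \<le> real j" using s(1) by (simp add: j_def)
    define Ds where "Ds = real (nvars p) - real (nvars (true_pair G))"
    have js: "real j \<le> Ds" using s(2) by (simp add: j_def Ds_def)
    have \<Delta>0: "0 \<le> \<Delta>" using sup p by (simp add: cond_sup_def \<Delta>_def Cs_def)
    have "\<Delta> powr (2 / alpha) \<le> complexity G p powr (2 / alpha) - Cs powr (2 / alpha)"
      unfolding \<Delta>_def using \<Delta>0 Cs0 alpha by (intro powr_diff_superadditive) (auto simp: \<Delta>_def)
    then have "lambda * \<Delta> powr (2 / alpha) \<le> lambda * (complexity G p powr (2 / alpha) - Cs powr (2 / alpha))"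
      using lam(1) by (rule mult_left_mono)
    then have u: "eta * Ds + lambda * \<Delta> powr (2 / alpha) \<le> u_pen G alpha lambda eta p"
      by (simp add: u_pen_def Ds_def Cs_def)
    define d where "d = real (model_rank G p) - real (common_rank G p)"
    have d: "d \<le> Ds" unfolding d_def Ds_def by (rule sup_pairs_rank[OF setting p])
    \<comment> \<open>Reduces the key inequality to APP \<ge> 0. As d \<le> Ds and eta \<ge> 8, the
      term 2 * d takes at most eta * Ds / 4, half of what the penalty on variables provides
      here.\<close>
    define x where "x = u_pen G alpha lambda eta p / 2 - 2 * d"
    have "8 * Ds \<le> eta * Ds" using eta js j1 by (intro mult_right_mono) auto
    moreover have "eta * real j \<le> eta * Ds" using js eta by (intro mult_left_mono) auto
    ultimately have "eta * real j / 4 + lambda * \<Delta> powr (2 / alpha) / 2 \<le> x"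
      using u d unfolding x_def by argo
    moreover have "0 \<le> lambda * \<Delta> powr (2 / alpha)" using lam by simp
    ultimately have x: "eta * real j / 8 + lambda / 8 * \<Delta> powr (2 / alpha) \<le> x / 2" by argo
    have eta0: "0 < eta * real j" using eta j1 by simp
    have "0 \<le> lambda / 8 * \<Delta> powr (2 / alpha)" using lam by simp
    then have x0: "0 < x" using x eta0 by argo
    have key: "2 * (2 * (real (model_rank G p) - real (common_rank G p)) + x)
        \<le> APP G \<sigma> p / 2 + u_pen G alpha lambda eta p"
      using APP_nonneg[of G \<sigma> p] by (simp add: x_def d_def)
    define k8 where "k8 = (1 / 8 :: real) powr h"
    have e1: "(eta * real j / 8) powr h = k8 * (eta * real j) powr h"
      using powr_mult[of "1 / 8" "eta * real j" h] by (simp add: k8_def)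
    have e2: "(lambda / 8) powr h = k8 * lambda powr h"
      using powr_mult[of "1 / 8" lambda h] by (simp add: k8_def)
    have e3: "(lambda / 8 * \<Delta> powr (2 / alpha)) powr h = (lambda / 8) powr h * \<Delta>"
      unfolding h_def by (rule powr_mult_powr_inverse[OF \<Delta>0 alpha(1)])
    have e4: "((eta * real j / 8) powr h + (lambda / 8 * \<Delta> powr (2 / alpha)) powr h) / 2
        \<le> (eta * real j / 8 + lambda / 8 * \<Delta> powr (2 / alpha)) powr h"
      using lam(1) eta0 h by (intro powr_add_ge_half) auto
    have e5: "(eta * real j / 8 + lambda / 8 * \<Delta> powr (2 / alpha)) powr h \<le> (x / 2) powr h"
      using x lam(1) eta0 h by (intro powr_mono2) auto
    have "(k8 * (eta * real j) powr h + k8 * lambda powr h * \<Delta>) / 2 \<le> (x / 2) powr h"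
      using order_trans[OF e4 e5] unfolding e3 e1 e2 .
    then have "c * ((k8 * (eta * real j) powr h + k8 * lambda powr h * \<Delta>) / 2) \<le> c * (x / 2) powr h"
      using C by (intro mult_left_mono) auto
    moreover have "c * ((k8 * (eta * real j) powr h + k8 * lambda powr h * \<Delta>) / 2)
        = c / 2 * k8 * ((eta * real j) powr h + lambda powr h * \<Delta>)"
      by (simp add: algebra_simps add_divide_distrib)
    moreover have "c1 * ((eta * real j) powr h + lambda powr h * \<Delta>)
        \<le> c / 2 * k8 * ((eta * real j) powr h + lambda powr h * \<Delta>)"
      using c1(3) \<Delta>0 unfolding h_def k8_def by (intro mult_right_mono) auto
    ultimately have "c1 * ((eta * real j) powr h + lambda powr h * \<Delta>) \<le> c * (x / 2) powr h" by linarith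
    then have "exp (- c * (x / 2) powr h) \<le> fp p"
      by (simp add: fp_def j_def[symmetric] \<Delta>_def[symmetric] distrib_left mult.assoc flip: exp_add)
    then show ?thesis by (rule event[OF pa x0 key])
  qed
  have fin: "finite (agg_list G)" by (rule finite_agg_list[OF setting])
  have finW: "finite (wrong_pairs G)" "finite (sub_pairs G)" "finite (sup_pairs G)"
    using fin by (auto simp: wrong_pairs_def sub_pairs_def sup_pairs_def)
  obtain AW where AW: "\<And>p. p \<in> wrong_pairs G \<Longrightarrow> AW p \<in> sets M \<and> measure M (AW p) \<le> 2 * C * fw p \<and> E p \<subseteq> AW p"
    using bchoice[of "wrong_pairs G"] ew by (metis (no_types, lifting))
  obtain AS where AS: "\<And>p. p \<in> sub_pairs G \<Longrightarrow> AS p \<in> sets M \<and> measure M (AS p) \<le> 2 * C * fs p \<and> E p \<subseteq> AS p"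
    using bchoice[of "sub_pairs G"] es by (metis (no_types, lifting))
  obtain AP where AP: "\<And>p. p \<in> sup_pairs G \<Longrightarrow> AP p \<in> sets M \<and> measure M (AP p) \<le> 2 * C * fp p \<and> E p \<subseteq> AP p"
    using bchoice[of "sup_pairs G"] ep by (metis (no_types, lifting))
  have union: "measure M (\<Union>p\<in>F. A p) \<le> 2 * C * (\<Sum>p\<in>F. f p)"
    if "finite F" "\<And>p. p \<in> F \<Longrightarrow> A p \<in> sets M \<and> measure M (A p) \<le> 2 * C * f p \<and> E p \<subseteq> A p"
    for F A and f :: "model_pair \<Rightarrow> real"
  proof -
    have "measure M (\<Union>p\<in>F. A p) \<le> (\<Sum>p\<in>F. measure M (A p))"
      using that by (intro measure_UNION_le) auto
    also have "\<dots> \<le> (\<Sum>p\<in>F. 2 * C * f p)" using that by (intro sum_mono) auto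
    finally show ?thesis by (simp add: sum_distrib_left)
  qed
  let ?UW = "\<Union>p\<in>wrong_pairs G. AW p" and ?US = "\<Union>p\<in>sub_pairs G. AS p" and ?UP = "\<Union>p\<in>sup_pairs G. AP p"
  have mU: "?UW \<in> sets M" "?US \<in> sets M" "?UP \<in> sets M"
    using finW AW AS AP by (auto intro!: sets.finite_UN)
  have mT: "{\<omega> \<in> space M. sel \<omega> = true_pair G} \<in> sets M"
  proof -
    have "sel -` {true_pair G} \<inter> space M \<in> sets M"
      using G(3) by (intro measurable_sets[OF sel(1)]) auto
    then show ?thesis by (simp add: vimage_def Int_def conj_commute)
  qed
  \<comment> \<open>A selected pair minimises DCIC, so it beats or ties the true pair; ties are
    counted as errors.\<close>
  have "space M - {\<omega> \<in> space M. sel \<omega> = true_pair G} \<subseteq> ?UW \<union> (?US \<union> ?UP)"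
  proof
    fix \<omega> assume "\<omega> \<in> space M - {\<omega> \<in> space M. sel \<omega> = true_pair G}"
    then have \<omega>: "\<omega> \<in> space M" "sel \<omega> \<noteq> true_pair G" by auto
    have inE: "sel \<omega> \<in> agg_list G" "\<omega> \<in> E (sel \<omega>)"
      using sel(2)[OF \<omega>(1)] G(3) \<omega>(1) by (auto simp: DCIC_argmin_def E_def)
    have "sel \<omega> \<in> wrong_pairs G \<or> sel \<omega> \<in> sub_pairs G \<or> sel \<omega> \<in> sup_pairs G"
      using inE(1) \<omega>(2) by (auto simp: wrong_pairs_def)
    then show "\<omega> \<in> ?UW \<union> (?US \<union> ?UP)"
    proof (elim disjE)
      assume p: "sel \<omega> \<in> wrong_pairs G"
      then have "\<omega> \<in> AW (sel \<omega>)" using AW[OF p] inE(2) by (meson subsetD)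
      then show ?thesis using p by (intro UnI1 UN_I)
    next
      assume p: "sel \<omega> \<in> sub_pairs G"
      then have "\<omega> \<in> AS (sel \<omega>)" using AS[OF p] inE(2) by (meson subsetD)
      then show ?thesis using p by (intro UnI2[OF UnI1] UN_I)
    next
      assume p: "sel \<omega> \<in> sup_pairs G"
      then have "\<omega> \<in> AP (sel \<omega>)" using AP[OF p] inE(2) by (meson subsetD)
      then show ?thesis using p by (intro UnI2[OF UnI2] UN_I)
    qed
  qed
  then have "prob (space M - {\<omega> \<in> space M. sel \<omega> = true_pair G}) \<le> prob (?UW \<union> (?US \<union> ?UP))"
    using mU by (intro finite_measure_mono) auto
  also have "\<dots> \<le> prob ?UW + (prob ?US + prob ?UP)"
    using measure_Un_le[of ?UW M "?US \<union> ?UP"] measure_Un_le[of ?US M ?UP] mU by simp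
  also have "\<dots> \<le> 2 * C * (\<Sum>p\<in>wrong_pairs G. fw p)
      + (2 * C * (\<Sum>p\<in>sub_pairs G. fs p) + 2 * C * (\<Sum>p\<in>sup_pairs G. fp p))"
    by (intro add_mono union finW AW AS AP)
  finally have total: "1 - prob {\<omega> \<in> space M. sel \<omega> = true_pair G} \<le> 2 * C * (\<Sum>p\<in>wrong_pairs G. fw p)
      + (2 * C * (\<Sum>p\<in>sub_pairs G. fs p) + 2 * C * (\<Sum>p\<in>sup_pairs G. fp p))"
    by (simp add: prob_compl[OF mT])
  have sw: "(\<Sum>p\<in>wrong_pairs G. fw p) \<le> exp (- (c / 2 * (ln (ln (real n)) / 8) powr h)) * 5"
    unfolding fw_def sum_distrib_left[symmetric]
    by (intro mult_left_mono sum_exp_D_wrong_le[OF setting]) auto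
  have eta0: "0 < eta" using eta by simp
  have ss: "(\<Sum>p\<in>sub_pairs G. fs p) \<le> 2 * exp_powr_const h 1 * (1 / eta\<^sup>2)"
  proof (rule sum_by_level_le[where lev = "\<lambda>p. delta_minus G (snd p)", OF finW(2) _ _ h eta0])
    fix l :: nat
    let ?F = "{p \<in> sub_pairs G. delta_minus G (snd p) = l}"
    have "(\<Sum>p\<in>?F. fs p) = (\<Sum>p\<in>?F. exp (- ((eta * real l) powr h)) / real (num_sub G l))"
      by (intro sum.cong) (auto simp: fs_def)
    also have "\<dots> = real (num_sub G l) * (exp (- ((eta * real l) powr h)) / real (num_sub G l))"
      by (simp add: num_sub_def)
    \<comment> \<open>The number of pairs in the level cancels; for an empty level the left side is
      0.\<close>
    also have "\<dots> \<le> exp (- (1 * (eta * real l) powr h))" by simp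
    finally show "(\<Sum>p\<in>?F. fs p) \<le> exp (- (1 * (eta * real l) powr h))" .
  qed (use sub_pairsD(1)[OF setting] in auto)
  have sp: "(\<Sum>p\<in>sup_pairs G. fp p) \<le> 2 * exp_powr_const h (c1 - c1') * (1 / eta\<^sup>2)"
  proof (rule sum_by_level_le[where lev = "\<lambda>p. delta_plus G (snd p)", OF finW(3) _ _ h eta0])
    fix l :: nat assume l: "1 \<le> l"
    let ?F = "{p \<in> sup_pairs G. delta_plus G (snd p) = l}"
    have "(\<Sum>p\<in>?F. fp p) = (\<Sum>p\<in>?F. exp (- (c1 * (eta * real l) powr h))
        * exp (- c1 * lambda powr h * (complexity G p - Cs)))"
      by (intro sum.cong) (auto simp: fp_def)
    also have "\<dots> = exp (- (c1 * (eta * real l) powr h))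
        * (\<Sum>p\<in>?F. exp (- c1 * lambda powr h * (complexity G p - Cs)))"
      by (simp only: sum_distrib_left)
    \<comment> \<open>Condition (i) costs c1' in the exponent; the positive rest c1 - c1' makes the
      levels summable.\<close>
    also have "\<dots> \<le> exp (- (c1 * (eta * real l) powr h)) * exp (c1' * (eta * real l) powr h)"
      using sup l unfolding cond_sup_def Cs_def h_def by (intro mult_left_mono) auto
    also have "\<dots> = exp (- ((c1 - c1') * (eta * real l) powr h))"
      by (simp add: algebra_simps flip: exp_add)
    finally show "(\<Sum>p\<in>?F. fp p) \<le> exp (- ((c1 - c1') * (eta * real l) powr h))" .
  qed (use sup_pairsD(1)[OF setting] c1 in auto)
  have "2 * C * (\<Sum>p\<in>wrong_pairs G. fw p)
      + (2 * C * (\<Sum>p\<in>sub_pairs G. fs p) + 2 * C * (\<Sum>p\<in>sup_pairs G. fp p))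
    \<le> 2 * C * (exp (- (c / 2 * (ln (ln (real n)) / 8) powr h)) * 5)
      + (2 * C * (2 * exp_powr_const h 1 * (1 / eta\<^sup>2)) + 2 * C * (2 * exp_powr_const h (c1 - c1') * (1 / eta\<^sup>2)))"
    using C by (intro add_mono mult_left_mono sw ss sp) auto
  also have "\<dots> = 10 * C * exp (- (c / 2 * (ln (ln (real n)) / 8) powr h))
      + 4 * C * (exp_powr_const h 1 + exp_powr_const h (c1 - c1')) * (1 / eta\<^sup>2)"
    by (simp add: algebra_simps add_divide_distrib)
  finally show ?thesis using total unfolding h_def by linarith
qed

section \<open>Consistency\<close>

lemma exp_neg_powr_tendsto_0:
  fixes x :: "nat \<Rightarrow> real"
  assumes "filterlim x at_top sequentially" "0 < b" "0 < h"
  shows "(\<lambda>n. exp (- (b * x n powr h))) \<longlonglongrightarrow> 0"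
proof -
  have "filterlim (\<lambda>n. exp (h * ln (x n))) at_top sequentially"
    by (intro filterlim_compose[OF exp_at_top] filterlim_tendsto_pos_mult_at_top[OF tendsto_const]
        filterlim_compose[OF ln_at_top] assms)
  moreover have "\<forall>\<^sub>F n in sequentially. exp (h * ln (x n)) = x n powr h"
    using filterlim_at_top_dense[THEN iffD1, OF assms(1), rule_format, of 0]
    by eventually_elim (simp add: powr_def)
  ultimately have "filterlim (\<lambda>n. x n powr h) at_top sequentially"
    by (rule filterlim_cong[OF refl refl, THEN iffD1, rotated])
  then have "filterlim (\<lambda>n. b * x n powr h) at_top sequentially"
    by (rule filterlim_tendsto_pos_mult_at_top[OF tendsto_const assms(2)])
  then have "filterlim (\<lambda>n. - (b * x n powr h)) at_bot sequentially"
    by (simp add: filterlim_uminus_at_top)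
  then show ?thesis by (rule filterlim_compose[OF exp_at_bot])
qed

lemma ln_ln_at_top: "filterlim (\<lambda>n. ln (ln (real n))) at_top sequentially"
  by (intro filterlim_compose[OF ln_at_top] filterlim_real_sequentially)

text \<open>Problems, probability spaces and noise may change with n, as in a triangular array, and
  \<open>sel\<close> is any measurable choice among the minimisers.\<close>

theorem corollaryA4:
  fixes alpha zeta :: real
  assumes "0 < alpha" and "alpha \<le> 2" and "0 < zeta"
  shows "\<exists>lambda_sel > 0. \<exists>c1_max > 0. \<exists>c2_min > 1.
    \<forall>(G :: nat \<Rightarrow> selection_problem) (M :: nat \<Rightarrow> 'a measure) (eps :: nat \<Rightarrow> nat \<Rightarrow> 'a \<Rightarrow> real)
      (\<sigma> :: real) (eta :: nat \<Rightarrow> real).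
      \<sigma> > 0 \<longrightarrow>
      (\<forall>n\<ge>1. multi_class_setting n (G n) \<and> noise_model (M n) n \<sigma> alpha zeta (eps n)) \<longrightarrow>
      filterlim eta at_top sequentially \<longrightarrow>
      (\<forall>lambda \<ge> lambda_sel. \<forall>c1' c1 c2 (sel :: nat \<Rightarrow> 'a \<Rightarrow> model_pair).
        0 < c1' \<and> c1' < c1 \<and> c1 \<le> c1_max \<longrightarrow>
        c2 \<ge> c2_min \<longrightarrow>
        (\<forall>\<^sub>F n in sequentially.
           cond_sup (G n) alpha lambda (eta n) c1' c1 \<and>
           cond_sub (G n) \<sigma> alpha lambda (eta n) c2 \<and>
           cond_wrong (G n) \<sigma> alpha lambda (eta n)) \<longrightarrow>
        (\<forall>n\<ge>1. sel n \<in> measurable (M n) (count_space (agg_list (G n))) \<and>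
           (\<forall>\<omega> \<in> space (M n).
              sel n \<omega> \<in> DCIC_argmin (G n) \<sigma> alpha lambda (eta n) (response (G n) (eps n) \<omega>))) \<longrightarrow>
        (\<lambda>n. measure (M n) {\<omega> \<in> space (M n). sel n \<omega> = true_pair (G n)}) \<longlonglongrightarrow> 1)"
proof (rule noise_tails[OF assms, where 'a = 'a])
  fix C c :: real
  assume C: "0 < C" "0 < c" and tails: "\<And>(M :: 'a measure) n \<sigma> eps. 0 < \<sigma> \<Longrightarrow>
      noise_model M n \<sigma> alpha zeta eps \<Longrightarrow> noise_tail_bounds M n \<sigma> eps (alpha / 2) C c"
  define h where "h = alpha / 2"
  have h: "0 < h" using assms by (simp add: h_def)
  \<comment> \<open>Solutions of c/2 * (lambda/8)^h = 2 and of c/2 * (c2/16)^h = 1, the latter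
    combined with 4; \<open>c1_max\<close> is the rate left in the error bound for nested larger
    models.\<close>
  define lambda_sel where "lambda_sel = 8 * (4 / c) powr (1 / h)"
  define c1_max where "c1_max = c / 2 * (1 / 8) powr h"
  define c2_min where "c2_min = max 4 (16 * (2 / c) powr (1 / h))"
  have pos: "0 < lambda_sel" "0 < c1_max" "1 < c2_min"
    using C by (auto simp: lambda_sel_def c1_max_def c2_min_def)
  have main: "(\<lambda>n. measure (M n) {\<omega> \<in> space (M n). sel n \<omega> = true_pair (G n)}) \<longlonglongrightarrow> 1"
    if \<sigma>: "\<sigma> > 0"
      and setting: "\<forall>n\<ge>1. multi_class_setting n (G n) \<and> noise_model (M n) n \<sigma> alpha zeta (eps n)"
      and eta: "filterlim eta at_top sequentially"
      and lambda: "lambda_sel \<le> lambda"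
      and c1: "0 < c1' \<and> c1' < c1 \<and> c1 \<le> c1_max"
      and c2: "c2_min \<le> c2"
      and cond: "\<forall>\<^sub>F n in sequentially.
           cond_sup (G n) alpha lambda (eta n) c1' c1 \<and>
           cond_sub (G n) \<sigma> alpha lambda (eta n) c2 \<and>
           cond_wrong (G n) \<sigma> alpha lambda (eta n)"
      and sel: "\<forall>n\<ge>1. sel n \<in> measurable (M n) (count_space (agg_list (G n))) \<and>
           (\<forall>\<omega> \<in> space (M n).
              sel n \<omega> \<in> DCIC_argmin (G n) \<sigma> alpha lambda (eta n) (response (G n) (eps n) \<omega>))"
    for G :: "nat \<Rightarrow> selection_problem" and M :: "nat \<Rightarrow> 'a measure" and eps :: "nat \<Rightarrow> nat \<Rightarrow> 'a \<Rightarrow> real"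
      and \<sigma> :: real and eta :: "nat \<Rightarrow> real" and lambda c1' c1 c2 :: real and sel :: "nat \<Rightarrow> 'a \<Rightarrow> model_pair"
  proof -
    define b where "b = (\<lambda>n. 10 * C * exp (- (c / 2 * (ln (ln (real n)) / 8) powr h))
      + 4 * C * (exp_powr_const h 1 + exp_powr_const h (c1 - c1')) * (1 / (eta n)\<^sup>2))"
    have lam: "0 \<le> lambda" "2 \<le> c / 2 * (lambda / 8) powr h"
    proof -
      show "0 \<le> lambda" using pos lambda by simp
      have "4 / c = ((4 / c) powr (1 / h)) powr h" using C h by (simp add: powr_powr)
      also have "\<dots> \<le> (lambda / 8) powr h"
        using lambda h by (intro powr_mono2) (auto simp: lambda_sel_def)
      finally show "2 \<le> c / 2 * (lambda / 8) powr h" using C by (simp add: field_simps)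
    qed
    have c2': "4 \<le> c2" "1 \<le> c / 2 * (c2 / 16) powr h"
    proof -
      show "4 \<le> c2" using c2 by (simp add: c2_min_def)
      have "2 / c = ((2 / c) powr (1 / h)) powr h" using C h by (simp add: powr_powr)
      also have "\<dots> \<le> (c2 / 16) powr h"
        using c2 h by (intro powr_mono2) (auto simp: c2_min_def)
      finally show "1 \<le> c / 2 * (c2 / 16) powr h" using C by (simp add: field_simps)
    qed
    have "\<forall>\<^sub>F n in sequentially. 0 < ln (ln (real n))"
      using filterlim_at_top_dense[THEN iffD1, OF ln_ln_at_top] by blast
    moreover have "\<forall>\<^sub>F n in sequentially. 8 \<le> eta n"
      using filterlim_at_top[THEN iffD1, OF eta] by blast
    moreover have "\<forall>\<^sub>F n :: nat in sequentially. 1 \<le> n" by (rule eventually_ge_at_top)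
    ultimately have lower: "\<forall>\<^sub>F n in sequentially.
        1 - b n \<le> measure (M n) {\<omega> \<in> space (M n). sel n \<omega> = true_pair (G n)}"
      using cond
    proof eventually_elim
      case (elim n)
      have nm: "noise_model (M n) n \<sigma> alpha zeta (eps n)" and st: "multi_class_setting n (G n)"
        using setting elim by auto
      have "1 - measure (M n) {\<omega> \<in> space (M n). sel n \<omega> = true_pair (G n)} \<le> b n"
        unfolding b_def h_def
      proof (rule selection_error_bound[OF tails[OF \<sigma> nm] C assms(1,2) \<sigma> nm st])
        show "0 < ln (ln (real n))" "8 \<le> eta n" using elim by auto
        show "0 \<le> lambda" "2 \<le> c / 2 * (lambda / 8) powr (alpha / 2)" using lam by (auto simp: h_def)
        show "0 < c1'" "c1' < c1" "c1 \<le> c / 2 * (1 / 8) powr (alpha / 2)"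
          using c1 by (auto simp: c1_max_def h_def)
        show "4 \<le> c2" "1 \<le> c / 2 * (c2 / 16) powr (alpha / 2)" using c2' by (auto simp: h_def)
        show "cond_sup (G n) alpha lambda (eta n) c1' c1" "cond_sub (G n) \<sigma> alpha lambda (eta n) c2"
          "cond_wrong (G n) \<sigma> alpha lambda (eta n)" using elim by auto
        show "sel n \<in> measurable (M n) (count_space (agg_list (G n)))" using sel elim by auto
        show "sel n \<omega> \<in> DCIC_argmin (G n) \<sigma> alpha lambda (eta n) (response (G n) (eps n) \<omega>)"
          if "\<omega> \<in> space (M n)" for \<omega> using sel elim that by auto
      qed
      then show ?case by linarith
    qed
    have upper: "\<forall>\<^sub>F n in sequentially. measure (M n) {\<omega> \<in> space (M n). sel n \<omega> = true_pair (G n)} \<le> 1"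
      using eventually_ge_at_top[of 1]
    proof eventually_elim
      case (elim n)
      then have "prob_space (M n)" using setting by (simp add: noise_model_def)
      then show ?case by (rule prob_space.prob_le_1)
    qed
    have "filterlim (\<lambda>n. 1 / 8 * ln (ln (real n))) at_top sequentially"
      by (rule filterlim_tendsto_pos_mult_at_top[OF tendsto_const _ ln_ln_at_top]) simp
    then have "filterlim (\<lambda>n. ln (ln (real n)) / 8) at_top sequentially" by simp
    then have "(\<lambda>n. exp (- (c / 2 * (ln (ln (real n)) / 8) powr h))) \<longlonglongrightarrow> 0"
      using C h by (intro exp_neg_powr_tendsto_0) auto
    moreover have "(\<lambda>n. (inverse (eta n))\<^sup>2) \<longlonglongrightarrow> 0\<^sup>2"
      by (intro tendsto_power tendsto_inverse_0_at_top eta)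
    then have "(\<lambda>n. 1 / (eta n)\<^sup>2) \<longlonglongrightarrow> 0" 
      unfolding power_inverse by (simp add: inverse_eq_divide)
    ultimately have "b \<longlonglongrightarrow> 10 * C * 0 + 4 * C * (exp_powr_const h 1 + exp_powr_const h (c1 - c1')) * 0"
      unfolding b_def by (intro tendsto_add tendsto_mult tendsto_const)
    then have "(\<lambda>n. 1 - b n) \<longlonglongrightarrow> 1 - 0"
      by (intro tendsto_diff tendsto_const) simp
    then show ?thesis
      by (intro tendsto_sandwich[OF lower upper]) auto
  qed
  show ?thesis
  proof (rule exI[of _ lambda_sel], rule conjI[OF pos(1)], rule exI[of _ c1_max], rule conjI[OF pos(2)],
      rule exI[of _ c2_min], rule conjI[OF pos(3)], intro allI impI, goal_cases)
    case (1 G M eps \<sigma> eta lambda c1' c1 c2 sel)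
    then show ?case by (rule main)
  qed
qed

end
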